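(* Let $A=-\mathcal{A}$ be the opposite of a Sturm-Liouville operator on $X=L^2_\rho(a,b)$, with eigenvalues $\{\lambda_n\}_{n\in\mathbb{N}}$ and orthonormal basis of eigenfunctions $\{\phi_n\}_{n\in\mathbb{N}}$ of $X$, and let $\mu=\gamma+\epsilon$ with $\epsilon>0$ and $\lambda_n<\gamma<\infty$ for all $n$. Let $\alpha>0$, let $X_\alpha=D((\mu I-A)^\alpha)$, and set $\phi_{n,\alpha}=(\mu-\lambda_n)^{-\alpha}\phi_n$. Then the operator $A$, considered on $X_\alpha$ with domain $D(A)_\alpha=\{f\in X_\alpha:\ \sum_{n=1}^\infty\lambda_n^2\langle f,\phi_{n,\alpha}\rangle_\alpha^2<\infty\}$, is a self-adjoint Riesz-spectral operator on $X_\alpha$ with simple eigenvalues given by $\{\lambda_n\}_{n\in\mathbb{N}}$, associated to the orthonormal basis of eigenfunctions $\{\phi_{n,\alpha}\}_{n\in\mathbb{N}}$ of $X_\alpha$.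
   Context: Let $a<b$ be real. Let $p,\frac{dp}{dz},q,\rho$ be real-valued continuous functions on $[a,b]$ with $\rho>0$ and $p>0$. $X=L^2_\rho(a,b)$ denotes the space $L^2(a,b)$ of real-valued square integrable functions equipped with the inner product $\langle f,g\rangle_\rho=\int_a^b f(z)g(z)\rho(z)\,dz$. The Sturm-Liouville operator is $(\mathcal{A}f)(z)=\frac{1}{\rho(z)}\left(\frac{d}{dz}\left(-p(z)\frac{df}{dz}(z)\right)+q(z)f(z)\right)$ with domain $D(\mathcal{A})=\{f\in H^2(a,b):\ \alpha_a\frac{df}{dz}(a)+\beta_a f(a)=0=\alpha_b\frac{df}{dz}(b)+\beta_b f(b)\}$, where $(\alpha_a,\beta_a)\neq(0,0)\neq(\alpha_b,\beta_b)$ are real pairs. Put $A=-\mathcal{A}$, $D(A)=D(\mathcal{A})$. Known facts: $A$ is self-adjoint on $X$; its spectrum consists only of simple real eigenvalues $\{\lambda_n\}_{n\in\mathbb{N}}$, which are bounded from above; the normalized eigenfunctions $\{\phi_n\}_{n\in\mathbb{N}}$ form an orthonormal basis of $X$; and $Af=\sum_{n=1}^\infty\lambda_n\langle f,\phi_n\rangle_\rho\phi_n$ for $f\in D(A)=\{f\in X:\ \sum_{n=1}^\infty\lambda_n^2\langle f,\phi_n\rangle_\rho^2<\infty\}$. For $\mu$ as in the claim and $\alpha>0$, $(\mu I-A)^\alpha f=\sum_{n=1}^\infty(\mu-\lambda_n)^\alpha\langle f,\phi_n\rangle_\rho\phi_n$ with domain $X_\alpha:=D((\mu I-A)^\alpha)=\{f\in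 X:\ \sum_{n=1}^\infty(\mu-\lambda_n)^{2\alpha}\langle f,\phi_n\rangle_\rho^2<\infty\}$, which is a real Hilbert space for the inner product $\langle f,g\rangle_\alpha=\langle(\mu I-A)^\alpha f,(\mu I-A)^\alpha g\rangle_\rho$. A closed linear operator on a Hilbert space is called Riesz-spectral if it has simple eigenvalues $\{\lambda_n\}_{n\in\mathbb{N}}$ whose corresponding eigenvectors form a Riesz basis of the space, and the closure of $\{\lambda_n\}_{n\in\mathbb{N}}$ is totally disconnected. *)

theory Defs
  imports "HOL-Analysis.Analysis"
begin

section \<open>Real functions modulo equality almost everywhere\<close>

text \<open>A class of functions on an interval (a,b) is represented by its extension by zero to the
  real line. Thus all the spaces L^2(a,b) are subspaces of one type.\<close>

definition ae_eq :: "(real \<Rightarrow> real) \<Rightarrow> (real \<Rightarrow> real) \<Rightarrow> bool" where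
  "ae_eq f g \<longleftrightarrow> f \<in> borel_measurable borel \<and> g \<in> borel_measurable borel \<and> (AE x in lborel. f x = g x)"

quotient_type L0 = "real \<Rightarrow> real" / partial: ae_eq
proof (rule part_equivpI)
  show "\<exists>f. ae_eq f f"
    by (rule exI[of _ "\<lambda>_. 0"]) (simp add: ae_eq_def)
  show "symp ae_eq"
    by (auto simp: symp_def ae_eq_def elim: eventually_mono)
  show "transp ae_eq"
  proof (rule transpI)
    fix f g h assume fg: "ae_eq f g" and gh: "ae_eq g h"
    have "AE x in lborel. f x = h x"
      using fg gh unfolding ae_eq_def by (auto elim: eventually_elim2)
    with fg gh show "ae_eq f h" by (simp add: ae_eq_def)
  qed
qed

instantiation L0 :: "{real_algebra, comm_ring}"
begin

lift_definition zero_L0 :: L0 is "\<lambda>_. 0"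
  by (simp add: ae_eq_def)
lift_definition plus_L0 :: "L0 \<Rightarrow> L0 \<Rightarrow> L0" is "\<lambda>f g x. f x + g x"
  unfolding ae_eq_def by (auto elim: eventually_elim2)
lift_definition minus_L0 :: "L0 \<Rightarrow> L0 \<Rightarrow> L0" is "\<lambda>f g x. f x - g x"
  unfolding ae_eq_def by (auto elim: eventually_elim2)
lift_definition uminus_L0 :: "L0 \<Rightarrow> L0" is "\<lambda>f x. - f x"
  unfolding ae_eq_def by auto
lift_definition times_L0 :: "L0 \<Rightarrow> L0 \<Rightarrow> L0" is "\<lambda>f g x. f x * g x"
  unfolding ae_eq_def by (auto elim: eventually_elim2)
lift_definition scaleR_L0 :: "real \<Rightarrow> L0 \<Rightarrow> L0" is "\<lambda>c f x. c * f x"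
  unfolding ae_eq_def by (auto elim: eventually_mono)

instance
  by standard (transfer; auto simp: ae_eq_def algebra_simps)+

end

lift_definition L0_integral :: "L0 \<Rightarrow> real" is "\<lambda>f. integral\<^sup>L lborel f"
  unfolding ae_eq_def by (auto intro: integral_cong_AE)

lift_definition L0_integrable :: "L0 \<Rightarrow> bool" is "\<lambda>f. integrable lborel f"
  unfolding ae_eq_def by (rule integrable_cong_AE) auto

definition restr_class :: "real \<Rightarrow> real \<Rightarrow> (real \<Rightarrow> real) \<Rightarrow> L0" where
  "restr_class a b u = abs_L0 (\<lambda>x. indicat_real {a..b} x * u x)"


section \<open>The spaces L^2(a,b) and H^2(a,b)\<close>

text \<open>The first condition says that \<open>f\<close> vanishes almost everywhere outside [a,b].\<close>

definition L2 :: "real \<Rightarrow> real \<Rightarrow> L0 set" where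
  "L2 a b = {f. f * restr_class a b (\<lambda>_. 1) = f \<and> L0_integrable (f * f)}"

definition ip_weighted :: "real \<Rightarrow> real \<Rightarrow> (real \<Rightarrow> real) \<Rightarrow> L0 \<Rightarrow> L0 \<Rightarrow> real" where
  "ip_weighted a b \<rho> f g = L0_integral (f * g * restr_class a b \<rho>)"

text \<open>Weak derivatives are tested against continuously differentiable functions with compact support
  in (a,b); for locally integrable functions this is equivalent to testing against smooth ones.\<close>

definition test_function :: "real \<Rightarrow> real \<Rightarrow> (real \<Rightarrow> real) \<Rightarrow> bool" where
  "test_function a b \<psi> \<longleftrightarrow> \<psi> C1_differentiable_on UNIV \<and>
     (\<exists>c d. a < c \<and> d < b \<and> (\<forall>x. x \<notin> {c..d} \<longrightarrow> \<psi> x = 0))"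

definition has_weak_deriv :: "real \<Rightarrow> real \<Rightarrow> L0 \<Rightarrow> L0 \<Rightarrow> bool" where
  "has_weak_deriv a b f g \<longleftrightarrow> (\<forall>\<psi>. test_function a b \<psi> \<longrightarrow>
     L0_integral (f * restr_class a b (deriv \<psi>)) = - L0_integral (g * restr_class a b \<psi>))"

definition H1 :: "real \<Rightarrow> real \<Rightarrow> L0 set" where
  "H1 a b = {f \<in> L2 a b. \<exists>g \<in> L2 a b. has_weak_deriv a b f g}"

definition weak_deriv :: "real \<Rightarrow> real \<Rightarrow> L0 \<Rightarrow> L0" where
  "weak_deriv a b f = (THE g. g \<in> L2 a b \<and> has_weak_deriv a b f g)"

definition H2 :: "real \<Rightarrow> real \<Rightarrow> L0 set" where
  "H2 a b = {f \<in> H1 a b. weak_deriv a b f \<in> H1 a b}"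

text \<open>Point values, also at the end points, are those of the continuous representative on [a,b].\<close>

definition point_value :: "real \<Rightarrow> real \<Rightarrow> L0 \<Rightarrow> real \<Rightarrow> real" where
  "point_value a b f x =
     (THE y. \<exists>u. continuous_on {a..b} u \<and> f = restr_class a b u \<and> y = u x)"


section \<open>Sturm-Liouville operators\<close>

definition SL_op ::
  "real \<Rightarrow> real \<Rightarrow> (real \<Rightarrow> real) \<Rightarrow> (real \<Rightarrow> real) \<Rightarrow> (real \<Rightarrow> real) \<Rightarrow> L0 \<Rightarrow> L0" where
  "SL_op a b p q \<rho> f = restr_class a b (\<lambda>z. 1 / \<rho> z) *
     (weak_deriv a b (- (restr_class a b p * weak_deriv a b f)) + restr_class a b q * f)"

definition SL_dom :: "real \<Rightarrow> real \<Rightarrow> real \<Rightarrow> real \<Rightarrow> real \<Rightarrow> real \<Rightarrow> L0 set" where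
  "SL_dom a b \<alpha>a \<beta>a \<alpha>b \<beta>b = {f \<in> H2 a b.
     \<alpha>a * point_value a b (weak_deriv a b f) a + \<beta>a * point_value a b f a = 0 \<and>
     \<alpha>b * point_value a b (weak_deriv a b f) b + \<beta>b * point_value a b f b = 0}"


section \<open>Real Hilbert spaces with an explicit carrier and inner product\<close>

text \<open>The same vectors are considered with respect to several inner products, so a Hilbert space
  is a subspace \<open>V\<close> of a real vector space together with a function \<open>ip\<close>, used on \<open>V\<close> only.\<close>

definition ip_norm :: "('v::real_vector \<Rightarrow> 'v \<Rightarrow> real) \<Rightarrow> 'v \<Rightarrow> real" where
  "ip_norm ip f = sqrt (ip f f)"

definition inner_product_on :: "'v::real_vector set \<Rightarrow> ('v \<Rightarrow> 'v \<Rightarrow> real) \<Rightarrow> bool" where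
  "inner_product_on V ip \<longleftrightarrow>
     (\<forall>f\<in>V. \<forall>g\<in>V. ip f g = ip g f) \<and>
     (\<forall>f\<in>V. \<forall>g\<in>V. \<forall>h\<in>V. ip (f + g) h = ip f h + ip g h) \<and>
     (\<forall>c. \<forall>f\<in>V. \<forall>g\<in>V. ip (c *\<^sub>R f) g = c * ip f g) \<and>
     (\<forall>f\<in>V. f \<noteq> 0 \<longrightarrow> ip f f > 0)"

definition ip_tendsto :: "('v::real_vector \<Rightarrow> 'v \<Rightarrow> real) \<Rightarrow> (nat \<Rightarrow> 'v) \<Rightarrow> 'v \<Rightarrow> bool" where
  "ip_tendsto ip s f \<longleftrightarrow> (\<lambda>n. ip_norm ip (s n - f)) \<longlonglongrightarrow> 0"

definition ip_Cauchy :: "('v::real_vector \<Rightarrow> 'v \<Rightarrow> real) \<Rightarrow> (nat \<Rightarrow> 'v) \<Rightarrow> bool" where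
  "ip_Cauchy ip s \<longleftrightarrow> (\<forall>e>0. \<exists>N. \<forall>m\<ge>N. \<forall>n\<ge>N. ip_norm ip (s m - s n) < e)"

definition hilbert_space_on :: "'v::real_vector set \<Rightarrow> ('v \<Rightarrow> 'v \<Rightarrow> real) \<Rightarrow> bool" where
  "hilbert_space_on V ip \<longleftrightarrow> subspace V \<and> inner_product_on V ip \<and>
     (\<forall>s. (\<forall>n. s n \<in> V) \<and> ip_Cauchy ip s \<longrightarrow> (\<exists>f\<in>V. ip_tendsto ip s f))"

definition dense_in :: "'v::real_vector set \<Rightarrow> ('v \<Rightarrow> 'v \<Rightarrow> real) \<Rightarrow> 'v set \<Rightarrow> bool" where
  "dense_in V ip S \<longleftrightarrow> S \<subseteq> V \<and> (\<forall>f\<in>V. \<forall>e>0. \<exists>g\<in>S. ip_norm ip (f - g) < e)"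

definition orthonormal_basis ::
  "'v::real_vector set \<Rightarrow> ('v \<Rightarrow> 'v \<Rightarrow> real) \<Rightarrow> (nat \<Rightarrow> 'v) \<Rightarrow> bool" where
  "orthonormal_basis V ip \<phi> \<longleftrightarrow> (\<forall>n. \<phi> n \<in> V) \<and>
     (\<forall>m n. ip (\<phi> m) (\<phi> n) = (if m = n then 1 else 0)) \<and> dense_in V ip (span (range \<phi>))"

definition riesz_basis ::
  "'v::real_vector set \<Rightarrow> ('v \<Rightarrow> 'v \<Rightarrow> real) \<Rightarrow> (nat \<Rightarrow> 'v) \<Rightarrow> bool" where
  "riesz_basis V ip \<phi> \<longleftrightarrow> (\<forall>n. \<phi> n \<in> V) \<and> dense_in V ip (span (range \<phi>)) \<and>
     (\<exists>m>0. \<exists>M>0. \<forall>N. \<forall>c :: nat \<Rightarrow> real.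
        m * (\<Sum>n<N. (c n)\<^sup>2) \<le> (ip_norm ip (\<Sum>n<N. c n *\<^sub>R \<phi> n))\<^sup>2 \<and>
        (ip_norm ip (\<Sum>n<N. c n *\<^sub>R \<phi> n))\<^sup>2 \<le> M * (\<Sum>n<N. (c n)\<^sup>2))"

definition ip_suminf ::
  "'v::real_vector set \<Rightarrow> ('v \<Rightarrow> 'v \<Rightarrow> real) \<Rightarrow> (nat \<Rightarrow> 'v) \<Rightarrow> 'v" where
  "ip_suminf V ip x = (THE f. f \<in> V \<and> ip_tendsto ip (\<lambda>N. \<Sum>n<N. x n) f)"


section \<open>Unbounded operators\<close>

text \<open>An operator is given by its domain \<open>D\<close> and a function \<open>T\<close>, used on \<open>D\<close> only.\<close>

definition linear_operator_on :: "'v::real_vector set \<Rightarrow> 'v set \<Rightarrow> ('v \<Rightarrow> 'v) \<Rightarrow> bool" where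
  "linear_operator_on V D T \<longleftrightarrow> subspace D \<and> D \<subseteq> V \<and> T ` D \<subseteq> V \<and>
     (\<forall>f\<in>D. \<forall>g\<in>D. T (f + g) = T f + T g) \<and> (\<forall>c. \<forall>f\<in>D. T (c *\<^sub>R f) = c *\<^sub>R T f)"

definition closed_operator_on ::
  "'v::real_vector set \<Rightarrow> ('v \<Rightarrow> 'v \<Rightarrow> real) \<Rightarrow> 'v set \<Rightarrow> ('v \<Rightarrow> 'v) \<Rightarrow> bool" where
  "closed_operator_on V ip D T \<longleftrightarrow> linear_operator_on V D T \<and>
     (\<forall>s. \<forall>f\<in>V. \<forall>g\<in>V. (\<forall>n. s n \<in> D) \<and> ip_tendsto ip s f \<and> ip_tendsto ip (\<lambda>n. T (s n)) g
        \<longrightarrow> f \<in> D \<and> T f = g)"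

definition adjoint_dom ::
  "'v::real_vector set \<Rightarrow> ('v \<Rightarrow> 'v \<Rightarrow> real) \<Rightarrow> 'v set \<Rightarrow> ('v \<Rightarrow> 'v) \<Rightarrow> 'v set" where
  "adjoint_dom V ip D T = {g \<in> V. \<exists>h\<in>V. \<forall>f\<in>D. ip (T f) g = ip f h}"

definition adjoint_op ::
  "'v::real_vector set \<Rightarrow> ('v \<Rightarrow> 'v \<Rightarrow> real) \<Rightarrow> 'v set \<Rightarrow> ('v \<Rightarrow> 'v) \<Rightarrow> 'v \<Rightarrow> 'v" where
  "adjoint_op V ip D T g = (THE h. h \<in> V \<and> (\<forall>f\<in>D. ip (T f) g = ip f h))"

definition self_adjoint_on ::
  "'v::real_vector set \<Rightarrow> ('v \<Rightarrow> 'v \<Rightarrow> real) \<Rightarrow> 'v set \<Rightarrow> ('v \<Rightarrow> 'v) \<Rightarrow> bool" where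
  "self_adjoint_on V ip D T \<longleftrightarrow> linear_operator_on V D T \<and> dense_in V ip D \<and>
     adjoint_dom V ip D T = D \<and> (\<forall>g\<in>D. adjoint_op V ip D T g = T g)"

definition eigenvector ::
  "'v::real_vector set \<Rightarrow> ('v \<Rightarrow> 'v) \<Rightarrow> real \<Rightarrow> 'v \<Rightarrow> bool" where
  "eigenvector D T l f \<longleftrightarrow> f \<in> D \<and> f \<noteq> 0 \<and> T f = l *\<^sub>R f"

definition eigenvalues :: "'v::real_vector set \<Rightarrow> ('v \<Rightarrow> 'v) \<Rightarrow> real set" where
  "eigenvalues D T = {l. \<exists>f. eigenvector D T l f}"

fun ker_power :: "'v::real_vector set \<Rightarrow> ('v \<Rightarrow> 'v) \<Rightarrow> real \<Rightarrow> nat \<Rightarrow> 'v set" where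
  "ker_power D T l 0 = {0}"
| "ker_power D T l (Suc k) = {f \<in> D. T f - l *\<^sub>R f \<in> ker_power D T l k}"

text \<open>Simple means of algebraic multiplicity one. Infinite-dimensional spaces have \<open>dim\<close> 0.\<close>

definition simple_eigenvalue :: "'v::real_vector set \<Rightarrow> ('v \<Rightarrow> 'v) \<Rightarrow> real \<Rightarrow> bool" where
  "simple_eigenvalue D T l \<longleftrightarrow> l \<in> eigenvalues D T \<and> dim (\<Union>k. ker_power D T l k) = 1"

definition totally_disconnected :: "'a::topological_space set \<Rightarrow> bool" where
  "totally_disconnected S \<longleftrightarrow> (\<forall>C. C \<subseteq> S \<and> connected C \<longrightarrow> (\<exists>x. C \<subseteq> {x}))"

definition riesz_spectral_on ::
  "'v::real_vector set \<Rightarrow> ('v \<Rightarrow> 'v \<Rightarrow> real) \<Rightarrow> 'v set \<Rightarrow> ('v \<Rightarrow> 'v) \<Rightarrow> bool" where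
  "riesz_spectral_on V ip D T \<longleftrightarrow> hilbert_space_on V ip \<and> closed_operator_on V ip D T \<and>
     (\<exists>(l :: nat \<Rightarrow> real) e. bij_betw l UNIV (eigenvalues D T) \<and>
        (\<forall>n. simple_eigenvalue D T (l n) \<and> eigenvector D T (l n) (e n)) \<and>
        riesz_basis V ip e \<and> totally_disconnected (closure (range l)))"


section \<open>Fractional powers of a diagonal operator\<close>

definition frac_power_dom ::
  "'v::real_vector set \<Rightarrow> ('v \<Rightarrow> 'v \<Rightarrow> real) \<Rightarrow> (nat \<Rightarrow> real) \<Rightarrow> (nat \<Rightarrow> 'v) \<Rightarrow> real \<Rightarrow> real \<Rightarrow> 'v set" where
  "frac_power_dom V ip l \<phi> \<mu> \<alpha> =
     {f \<in> V. summable (\<lambda>n. (\<mu> - l n) powr (2 * \<alpha>) * (ip f (\<phi> n))\<^sup>2)}"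

definition frac_power ::
  "'v::real_vector set \<Rightarrow> ('v \<Rightarrow> 'v \<Rightarrow> real) \<Rightarrow> (nat \<Rightarrow> real) \<Rightarrow> (nat \<Rightarrow> 'v) \<Rightarrow> real \<Rightarrow> real \<Rightarrow> 'v \<Rightarrow> 'v" where
  "frac_power V ip l \<phi> \<mu> \<alpha> f =
     ip_suminf V ip (\<lambda>n. ((\<mu> - l n) powr \<alpha> * ip f (\<phi> n)) *\<^sub>R \<phi> n)"

definition ip_frac ::
  "'v::real_vector set \<Rightarrow> ('v \<Rightarrow> 'v \<Rightarrow> real) \<Rightarrow> (nat \<Rightarrow> real) \<Rightarrow> (nat \<Rightarrow> 'v) \<Rightarrow> real \<Rightarrow> real \<Rightarrow>
   'v \<Rightarrow> 'v \<Rightarrow> real" where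
  "ip_frac V ip l \<phi> \<mu> \<alpha> f g = ip (frac_power V ip l \<phi> \<mu> \<alpha> f) (frac_power V ip l \<phi> \<mu> \<alpha> g)"

end

theory Submission
  imports Defs
begin

text \<open>In coefficients with respect to the orthonormal basis \<open>\<phi>\<close>, the operator \<open>A\<close> is multiplication by
  \<open>lam\<close>, and \<open>(\<mu> - A)\<^sup>\<alpha>\<close> is an isometry of the fractional space onto \<open>L^2(a,b)\<close> that maps \<open>\<phi>\<alpha> n\<close> to
  \<open>\<phi> n\<close>. Hence \<open>A\<close> on the fractional space is again a diagonal operator, with its maximal domain, and
  self-adjointness, closedness and simplicity of the eigenvalues can be read off from the coefficients.

  Two facts depend on the differential operator. That \<open>A\<close> acts diagonally on infinite expansions
  follows from its closedness in \<open>L^2(a,b)\<close>. That the closure of the set of eigenvalues is totally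
  disconnected follows since only finitely many eigenvalues lie in a bounded interval. Both come from
  solving \<open>(p f')' = h\<close> by two integrations, which bounds \<open>f\<close> and \<open>f'\<close> uniformly on \<open>[a,b]\<close> by the
  \<open>L^2\<close> norms of \<open>f\<close> and \<open>A f\<close>.\<close>


section \<open>Orthonormal bases\<close>

text \<open>The hypotheses supply orthonormal eigenvectors of a concrete differential expression;
  its action on infinite expansions has to be derived. Weak derivatives and boundary values are
  definite descriptions on classes of functions, so no limit can be taken in them directly. The
  graph of \<open>A\<close>, with both boundary conditions, is therefore rewritten as equations
  between functionals of \<open>f\<close> and \<open>A f\<close> that are bounded in the L^2 norm
  and hence survive limits. The same bound makes point evaluation continuous in the graph norm, and
  this controls the number of eigenvalues in a bounded interval. The other constant that matters is
  the gap \<epsilon>: all \<mu> - lam n exceed it, so the weights (\<mu> - lam n) powr \<alpha> are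
  bounded away from 0. This makes the fractional power surjective onto L^2(a,b) and the norm of the
  fractional space stronger than that of L^2(a,b), so that summability in the former implies
  summability in the latter. Algebraic simplicity comes from the distinctness of the eigenvalues:
  the factor lam m - lam n cancels in every generalized eigenvector equation.\<close>

locale ip_space =
  fixes V :: "'v::real_vector set" and ip :: "'v \<Rightarrow> 'v \<Rightarrow> real"
  assumes subspace: "subspace V" and inner_product: "inner_product_on V ip"
begin

lemmas V_closed = subspace_0[OF subspace] subspace_add[OF subspace] subspace_diff[OF subspace]
  subspace_neg[OF subspace] subspace_scale[OF subspace]

lemma V_sum: "(\<And>i. i \<in> I \<Longrightarrow> x i \<in> V) \<Longrightarrow> sum x I \<in> V"
  by (rule subspace_sum[OF subspace])

lemma ip_commute: "f \<in> V \<Longrightarrow> g \<in> V \<Longrightarrow> ip f g = ip g f"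
  using inner_product by (auto simp: inner_product_on_def)

lemma ip_add_left: "f \<in> V \<Longrightarrow> g \<in> V \<Longrightarrow> h \<in> V \<Longrightarrow> ip (f + g) h = ip f h + ip g h"
  using inner_product by (auto simp: inner_product_on_def)

lemma ip_scale_left: "f \<in> V \<Longrightarrow> g \<in> V \<Longrightarrow> ip (c *\<^sub>R f) g = c * ip f g"
  using inner_product by (auto simp: inner_product_on_def)

lemma ip_pos: "f \<in> V \<Longrightarrow> f \<noteq> 0 \<Longrightarrow> 0 < ip f f"
  using inner_product by (auto simp: inner_product_on_def)

lemma ip_zero_left: "f \<in> V \<Longrightarrow> ip 0 f = 0"
  using ip_scale_left[of 0 f 0] V_closed(1) by simp

lemma ip_diff_left: "f \<in> V \<Longrightarrow> g \<in> V \<Longrightarrow> h \<in> V \<Longrightarrow> ip (f - g) h = ip f h - ip g h"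
  using ip_add_left[of f "(-1) *\<^sub>R g" h] ip_scale_left[of g h "-1"] V_closed(5)[of g "-1"] by simp

lemma ip_sum_left:
  assumes "\<And>i. i \<in> I \<Longrightarrow> x i \<in> V" "f \<in> V"
  shows "ip (sum x I) f = (\<Sum>i\<in>I. ip (x i) f)"
  using assms(1)
  by (induction I rule: infinite_finite_induct) (auto simp: ip_zero_left ip_add_left V_sum assms(2))

lemma ip_add_right: "f \<in> V \<Longrightarrow> g \<in> V \<Longrightarrow> h \<in> V \<Longrightarrow> ip h (f + g) = ip h f + ip h g"
  by (metis ip_commute ip_add_left V_closed(2))

lemma ip_diff_right: "f \<in> V \<Longrightarrow> g \<in> V \<Longrightarrow> h \<in> V \<Longrightarrow> ip h (f - g) = ip h f - ip h g"
  by (metis ip_commute ip_diff_left V_closed(3))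

lemma ip_scale_right: "f \<in> V \<Longrightarrow> g \<in> V \<Longrightarrow> ip f (c *\<^sub>R g) = c * ip f g"
  by (metis ip_commute ip_scale_left V_closed(5))

lemmas ip_simps = ip_add_left ip_diff_left ip_scale_left ip_add_right ip_diff_right ip_scale_right
  ip_zero_left V_closed

lemma ip_nonneg: "f \<in> V \<Longrightarrow> 0 \<le> ip f f"
  by (cases "f = 0") (auto simp: ip_zero_left intro: less_imp_le ip_pos)

lemma ip_eq_zero_iff: "f \<in> V \<Longrightarrow> ip f f = 0 \<longleftrightarrow> f = 0"
  using ip_pos[of f] ip_zero_left[of 0] V_closed(1) by fastforce

lemma ip_norm_nonneg: "f \<in> V \<Longrightarrow> 0 \<le> ip_norm ip f"
  by (simp add: ip_norm_def ip_nonneg)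

lemma ip_norm_square: "f \<in> V \<Longrightarrow> (ip_norm ip f)\<^sup>2 = ip f f"
  by (simp add: ip_norm_def ip_nonneg)

lemma Cauchy_Schwarz:
  assumes f: "f \<in> V" and g: "g \<in> V"
  shows "\<bar>ip f g\<bar> \<le> ip_norm ip f * ip_norm ip g"
proof (cases "g = 0")
  case True
  then show ?thesis using f g ip_commute[OF f g] by (simp add: ip_zero_left ip_norm_def)
next
  case False
  define t where "t = ip f g / ip g g"
  have gg: "ip g g > 0" using False g by (rule ip_pos[rotated])
  have "0 \<le> ip (f - t *\<^sub>R g) (f - t *\<^sub>R g)"
    using f g by (intro ip_nonneg) (auto simp: V_closed)
  also have "\<dots> = ip f f - 2 * t * ip f g + t\<^sup>2 * ip g g"
    using f g by (simp add: ip_simps ip_commute[of g f] power2_eq_square algebra_simps)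
  also have "\<dots> = ip f f - (ip f g)\<^sup>2 / ip g g"
    using gg by (simp add: t_def power2_eq_square field_simps)
  finally have "(ip f g)\<^sup>2 \<le> ip f f * ip g g"
    using gg by (simp add: field_simps)
  then have "sqrt ((ip f g)\<^sup>2) \<le> sqrt (ip f f * ip g g)" by (rule real_sqrt_le_mono)
  then show ?thesis by (simp add: ip_norm_def real_sqrt_mult)
qed

lemma ip_norm_triangle:
  assumes f: "f \<in> V" and g: "g \<in> V"
  shows "ip_norm ip (f + g) \<le> ip_norm ip f + ip_norm ip g"
proof (rule power2_le_imp_le)
  have "(ip_norm ip (f + g))\<^sup>2 = ip f f + 2 * ip f g + ip g g"
    using f g by (simp add: ip_norm_square ip_simps ip_commute[of g f])
  also have "\<dots> \<le> (ip_norm ip f + ip_norm ip g)\<^sup>2"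
    using Cauchy_Schwarz[OF f g] f g
    by (simp add: power2_sum ip_norm_square)
  finally show "(ip_norm ip (f + g))\<^sup>2 \<le> (ip_norm ip f + ip_norm ip g)\<^sup>2" .
qed (use f g in \<open>auto simp: ip_norm_nonneg\<close>)

lemma ip_norm_commute: "f \<in> V \<Longrightarrow> g \<in> V \<Longrightarrow> ip_norm ip (f - g) = ip_norm ip (g - f)"
  by (simp add: ip_norm_def ip_simps algebra_simps)

lemma ip_norm_scale: "f \<in> V \<Longrightarrow> ip_norm ip (c *\<^sub>R f) = \<bar>c\<bar> * ip_norm ip f"
  by (simp add: ip_norm_def ip_simps real_sqrt_mult mult.assoc[symmetric])

lemma tendsto_ip_left:
  assumes "ip_tendsto ip s f" "\<And>n. s n \<in> V" "f \<in> V" "g \<in> V"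
  shows "(\<lambda>n. ip (s n) g) \<longlonglongrightarrow> ip f g"
proof -
  have "(\<lambda>n. ip_norm ip (s n - f) * ip_norm ip g) \<longlonglongrightarrow> 0 * ip_norm ip g"
    using assms(1) unfolding ip_tendsto_def by (intro tendsto_intros)
  then have lim: "(\<lambda>n. ip_norm ip (s n - f) * ip_norm ip g) \<longlonglongrightarrow> 0" by simp
  have "(\<lambda>n. ip (s n) g - ip f g) \<longlonglongrightarrow> 0"
  proof (rule Lim_null_comparison[OF _ lim], intro always_eventually allI)
    fix n
    show "norm (ip (s n) g - ip f g) \<le> ip_norm ip (s n - f) * ip_norm ip g"
      using Cauchy_Schwarz[of "s n - f" g] assms by (simp add: ip_simps)
  qed
  then show ?thesis by (rule LIM_zero_cancel)
qed

lemma ip_tendsto_unique: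
  assumes "ip_tendsto ip s f" "ip_tendsto ip s g" "\<And>n. s n \<in> V" "f \<in> V" "g \<in> V"
  shows "f = g"
proof -
  have "ip f (f - g) = ip g (f - g)"
    by (rule LIMSEQ_unique[of "\<lambda>n. ip (s n) (f - g)"])
      (use assms in \<open>auto intro!: tendsto_ip_left simp: V_closed\<close>)
  then have "ip (f - g) (f - g) = 0"
    using assms by (simp add: ip_simps)
  then show ?thesis using assms by (simp add: ip_eq_zero_iff V_closed)
qed

text \<open>Limits are unique because the form is definite, so the definite description in
  \<open>ip_suminf\<close> denotes the limit as soon as one exists.\<close>

lemma ip_suminf_eqI:
  assumes "f \<in> V" "\<And>n. x n \<in> V" "ip_tendsto ip (\<lambda>N. \<Sum>n<N. x n) f"
  shows "ip_suminf V ip x = f"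
  unfolding ip_suminf_def
  by (rule the_equality) (use assms in \<open>auto intro!: ip_tendsto_unique V_sum\<close>)

end

locale onb_space =
  fixes V :: "'v::real_vector set" and ip :: "'v \<Rightarrow> 'v \<Rightarrow> real" and \<phi> :: "nat \<Rightarrow> 'v"
  assumes hilbert: "hilbert_space_on V ip" and onb: "orthonormal_basis V ip \<phi>"
begin

sublocale ip_space V ip
  using hilbert by unfold_locales (auto simp: hilbert_space_on_def)

lemma basis_in [simp]: "\<phi> n \<in> V"
  using onb by (auto simp: orthonormal_basis_def)

lemma ip_basis: "ip (\<phi> m) (\<phi> n) = (if m = n then 1 else 0)"
  using onb by (auto simp: orthonormal_basis_def)

lemma basis_nonzero: "\<phi> n \<noteq> 0"
  using ip_basis[of n n] ip_zero_left[of "\<phi> n"] by auto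

lemma lincomb_in: "(\<Sum>n\<in>I. c n *\<^sub>R \<phi> n) \<in> V"
  by (intro V_sum V_closed) auto

lemma ip_lincomb:
  assumes "finite I"
  shows "ip (\<Sum>n\<in>I. c n *\<^sub>R \<phi> n) (\<phi> m) = (if m \<in> I then c m else 0)"
  using assms by (simp add: ip_sum_left V_closed ip_scale_left ip_basis if_distrib cong: if_cong)

lemma ip_lincomb_left:
  assumes "f \<in> V"
  shows "ip (\<Sum>n\<in>I. c n *\<^sub>R \<phi> n) f = (\<Sum>n\<in>I. c n * ip f (\<phi> n))"
  using assms by (simp add: ip_sum_left V_closed ip_scale_left ip_commute[OF assms])

lemma ip_lincomb_self:
  assumes "finite I"
  shows "ip (\<Sum>n\<in>I. c n *\<^sub>R \<phi> n) (\<Sum>n\<in>I. c n *\<^sub>R \<phi> n) = (\<Sum>n\<in>I. (c n)\<^sup>2)"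
  unfolding ip_lincomb_left[OF lincomb_in] ip_lincomb[OF assms] power2_eq_square by simp

text \<open>Completing the square separates the defect in Bessel's inequality from the error of the
  coefficients. With \<open>c n = ip f (\<phi> n)\<close> it gives Bessel's inequality; with
  arbitrary \<open>c\<close> it shows that no combination comes closer than the Fourier sum.\<close>

lemma dist_lincomb:
  assumes f: "f \<in> V" and fin: "finite I"
  shows "(ip_norm ip (f - (\<Sum>n\<in>I. c n *\<^sub>R \<phi> n)))\<^sup>2
    = ip f f - (\<Sum>n\<in>I. (ip f (\<phi> n))\<^sup>2) + (\<Sum>n\<in>I. (ip f (\<phi> n) - c n)\<^sup>2)"
proof -
  let ?g = "\<Sum>n\<in>I. c n *\<^sub>R \<phi> n"
  have g: "?g \<in> V" by (rule lincomb_in)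
  have "(ip_norm ip (f - ?g))\<^sup>2 = ip f f - 2 * ip ?g f + ip ?g ?g"
    using f g by (simp add: ip_norm_square ip_simps ip_commute[of f ?g])
  also have "\<dots> = ip f f - 2 * (\<Sum>n\<in>I. c n * ip f (\<phi> n)) + (\<Sum>n\<in>I. (c n)\<^sup>2)"
    using f fin by (simp add: ip_lincomb_left ip_lincomb_self)
  finally show ?thesis
    by (simp add: power2_diff sum.distrib sum_subtractf sum_distrib_left algebra_simps)
qed

lemma span_basis_lincomb:
  assumes "g \<in> span (range \<phi>)"
  obtains N c where "g = (\<Sum>n<N. c n *\<^sub>R \<phi> n)"
proof -
  have "\<exists>N c. g = (\<Sum>n<N. c n *\<^sub>R \<phi> n)"
    using assms
  proof (induction rule: span_induct_alt)
    case base
    show ?case by (rule exI[of _ 0]) auto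
  next
    case (step t x y)
    then obtain N d m where y: "y = (\<Sum>n<N. d n *\<^sub>R \<phi> n)" and x: "x = \<phi> m" by blast
    let ?M = "max N (Suc m)"
    \<comment> \<open>\<open>d\<close> is arbitrary from \<open>N\<close> on, so it is cut off there
      before the new term at index \<open>m\<close> is added; the sum then runs over an initial
      segment that contains both.\<close>
    let ?e = "\<lambda>n. (if n < N then d n else 0) + (if n = m then t else 0)"
    have "(\<Sum>n<?M. ?e n *\<^sub>R \<phi> n) =
        (\<Sum>n<?M. (if n < N then d n else 0) *\<^sub>R \<phi> n) + (\<Sum>n<?M. (if n = m then t else 0) *\<^sub>R \<phi> n)"
      by (simp add: scaleR_add_left sum.distrib)
    also have "(\<Sum>n<?M. (if n < N then d n else 0) *\<^sub>R \<phi> n) = y"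
      unfolding y by (rule sum.mono_neutral_cong_right) auto
    also have "(\<Sum>n<?M. (if n = m then t else 0) *\<^sub>R \<phi> n) = (\<Sum>n\<in>{m}. t *\<^sub>R \<phi> n)"
      by (rule sum.mono_neutral_cong_right) auto
    finally show ?case unfolding x
      by (intro exI[of _ ?M] exI[of _ ?e]) (simp add: add.commute)
  qed
  then show ?thesis using that by blast
qed

text \<open>Density provides some combination \<open>g\<close> of the first \<open>N\<close> basis
  vectors close to \<open>f\<close>. By \<open>dist_lincomb\<close> the Bessel defect at
  \<open>N\<close> is at most the squared distance to \<open>g\<close>, and it only decreases for
  larger indices.\<close>

lemma Parseval:
  assumes f: "f \<in> V"
  shows "(\<lambda>n. (ip f (\<phi> n))\<^sup>2) sums ip f f"
proof -
  let ?S = "\<lambda>N. \<Sum>n<N. (ip f (\<phi> n))\<^sup>2"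
  have le: "?S N \<le> ip f f" for N
  proof -
    have "0 \<le> (ip_norm ip (f - (\<Sum>n<N. ip f (\<phi> n) *\<^sub>R \<phi> n)))\<^sup>2" by simp
    then show ?thesis by (simp add: dist_lincomb[OF f])
  qed
  have mono: "?S M \<le> ?S N" if "M \<le> N" for M N
    using that by (intro sum_mono2) auto
  have "?S \<longlonglongrightarrow> ip f f"
  proof (rule LIMSEQ_I)
    fix r :: real assume r: "0 < r"
    have "dense_in V ip (span (range \<phi>))" using onb by (simp add: orthonormal_basis_def)
    then obtain g where g: "g \<in> span (range \<phi>)" "ip_norm ip (f - g) < sqrt r"
      using f r unfolding dense_in_def by (meson real_sqrt_gt_zero)
    then obtain N c where gN: "g = (\<Sum>n<N. c n *\<^sub>R \<phi> n)" using span_basis_lincomb by blast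
    have "(ip_norm ip (f - g))\<^sup>2 < (sqrt r)\<^sup>2"
      by (rule power_strict_mono) (use g f gN in \<open>auto intro!: ip_norm_nonneg V_closed lincomb_in\<close>)
    then have "ip f f - ?S N + (\<Sum>n<N. (ip f (\<phi> n) - c n)\<^sup>2) < r"
      unfolding gN using r by (simp add: dist_lincomb[OF f])
    moreover have "0 \<le> (\<Sum>n<N. (ip f (\<phi> n) - c n)\<^sup>2)" by (intro sum_nonneg) simp
    ultimately have "ip f f - ?S N < r" by linarith
    then have "norm (?S M - ip f f) < r" if "N \<le> M" for M
      using le[of M] mono[OF that] by simp
    then show "\<exists>N. \<forall>M\<ge>N. norm (?S M - ip f f) < r" by blast
  qed
  then show ?thesis by (simp add: sums_def)
qed

lemma basis_expansion:
  assumes f: "f \<in> V"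
  shows "ip_tendsto ip (\<lambda>N. \<Sum>n<N. ip f (\<phi> n) *\<^sub>R \<phi> n) f"
proof -
  have "(\<lambda>N. ip f f - (\<Sum>n<N. (ip f (\<phi> n))\<^sup>2)) \<longlonglongrightarrow> ip f f - ip f f"
    using Parseval[OF f] unfolding sums_def by (intro tendsto_intros)
  then have "(\<lambda>N. (ip_norm ip (f - (\<Sum>n<N. ip f (\<phi> n) *\<^sub>R \<phi> n)))\<^sup>2) \<longlonglongrightarrow> 0"
    by (simp add: dist_lincomb[OF f])
  from tendsto_real_sqrt[OF this] show ?thesis
    unfolding ip_tendsto_def using f
    by (simp add: ip_norm_nonneg V_closed lincomb_in ip_norm_commute[of f])
qed

lemma Parseval_ip:
  assumes f: "f \<in> V" and g: "g \<in> V"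
  shows "(\<lambda>n. ip f (\<phi> n) * ip g (\<phi> n)) sums ip f g"
  using tendsto_ip_left[OF basis_expansion[OF f] _ f g] g
  by (simp add: sums_def lincomb_in ip_lincomb_left)

lemma coeff_eqI:
  assumes f: "f \<in> V" and g: "g \<in> V" and "\<And>n. ip f (\<phi> n) = ip g (\<phi> n)"
  shows "f = g"
proof -
  have "(\<lambda>n. 0) sums ip (f - g) (f - g)"
    using Parseval[of "f - g"] assms by (simp add: ip_simps)
  then have "ip (f - g) (f - g) = 0" using sums_unique by fastforce
  then show ?thesis using f g by (simp add: ip_eq_zero_iff V_closed)
qed

text \<open>By orthonormality the squared norm of a block of the series is a block of the convergent
  series of squares, so completeness applies. The convergence is part of the conclusion because the
  values of \<open>ip_suminf\<close> and the closedness of an operator are stated through partial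
  sums.\<close>

lemma Riesz_Fischer:
  assumes c: "summable (\<lambda>n. (c n)\<^sup>2)"
  obtains f where "f \<in> V" "\<And>n. ip f (\<phi> n) = c n" "ip_tendsto ip (\<lambda>N. \<Sum>n<N. c n *\<^sub>R \<phi> n) f"
proof -
  let ?s = "\<lambda>N. \<Sum>n<N. c n *\<^sub>R \<phi> n"
  have diff: "?s n - ?s m = (\<Sum>k\<in>{m..<n}. c k *\<^sub>R \<phi> k)" if "m \<le> n" for m n
    using that sum_diff_nat_ivl[of 0 m n] by (simp add: atLeast0LessThan)
  have "ip_Cauchy ip ?s"
    unfolding ip_Cauchy_def
  proof (intro allI impI)
    fix e :: real assume e: "0 < e"
    obtain N where N: "\<And>m n. m \<ge> N \<Longrightarrow> norm (\<Sum>k\<in>{m..<n}. (c k)\<^sup>2) < e\<^sup>2"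
      using c e unfolding summable_Cauchy by (metis zero_less_power)
    have *: "ip_norm ip (?s n - ?s m) < e" if "N \<le> m" "m \<le> n" for m n
    proof -
      have "(\<Sum>k\<in>{m..<n}. (c k)\<^sup>2) < e\<^sup>2" using N[OF that(1), of n] by auto
      then have "ip (?s n - ?s m) (?s n - ?s m) < e\<^sup>2"
        using that by (simp add: diff ip_lincomb_self)
      then show ?thesis using e real_sqrt_less_mono unfolding ip_norm_def by fastforce
    qed
    have "ip_norm ip (?s m - ?s n) < e" if "m \<ge> N" "n \<ge> N" for m n
      using *[of m n] *[of n m] that by (cases "m \<le> n") (auto simp: ip_norm_commute lincomb_in)
    then show "\<exists>N. \<forall>m\<ge>N. \<forall>n\<ge>N. ip_norm ip (?s m - ?s n) < e" by blast
  qed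
  moreover have "(\<forall>n. s n \<in> V) \<and> ip_Cauchy ip s \<longrightarrow> (\<exists>f\<in>V. ip_tendsto ip s f)" for s
    using hilbert by (simp add: hilbert_space_on_def)
  ultimately obtain f where f: "f \<in> V" and lim: "ip_tendsto ip ?s f"
    using lincomb_in by meson
  have "ip f (\<phi> n) = c n" for n
  proof (rule LIMSEQ_unique)
    show "(\<lambda>N. ip (?s N) (\<phi> n)) \<longlonglongrightarrow> ip f (\<phi> n)"
      using lim f by (intro tendsto_ip_left) (auto simp: lincomb_in)
    have "\<forall>\<^sub>F N in sequentially. c n = ip (?s N) (\<phi> n)"
      using eventually_gt_at_top[of n] by eventually_elim (simp add: ip_lincomb)
    then show "(\<lambda>N. ip (?s N) (\<phi> n)) \<longlonglongrightarrow> c n"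
      by (rule Lim_transform_eventually[OF tendsto_const])
  qed
  then show ?thesis using that f lim by blast
qed

lemma riesz_basis: "riesz_basis V ip \<phi>"
  unfolding riesz_basis_def
proof (intro conjI)
  show "dense_in V ip (span (range \<phi>))" using onb by (simp add: orthonormal_basis_def)
  show "\<exists>m>0. \<exists>M>0. \<forall>N. \<forall>c :: nat \<Rightarrow> real.
        m * (\<Sum>n<N. (c n)\<^sup>2) \<le> (ip_norm ip (\<Sum>n<N. c n *\<^sub>R \<phi> n))\<^sup>2 \<and>
        (ip_norm ip (\<Sum>n<N. c n *\<^sub>R \<phi> n))\<^sup>2 \<le> M * (\<Sum>n<N. (c n)\<^sup>2)"
    by (rule exI[of _ 1], rule conjI[OF zero_less_one], rule exI[of _ 1])
      (simp add: ip_norm_square lincomb_in ip_lincomb_self)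
qed simp

end

section \<open>Diagonal operators\<close>

text \<open>Nothing is assumed about \<open>T\<close> beyond its coefficients on the maximal domain.
  Since coefficients determine a vector, every identity for \<open>T\<close>, including linearity,
  is checked coefficient by coefficient.\<close>

locale diagonal_operator = onb_space V ip \<phi>
  for V :: "'v::real_vector set" and ip \<phi> +
  fixes D :: "'v set" and T :: "'v \<Rightarrow> 'v" and l :: "nat \<Rightarrow> real"
  assumes D_def: "D = {f \<in> V. summable (\<lambda>n. (l n)\<^sup>2 * (ip f (\<phi> n))\<^sup>2)}"
    and T_in: "f \<in> D \<Longrightarrow> T f \<in> V"
    and coeff_T: "f \<in> D \<Longrightarrow> ip (T f) (\<phi> n) = l n * ip f (\<phi> n)"
    and inj: "inj l"
begin

lemma D_V: "f \<in> D \<Longrightarrow> f \<in> V"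
  by (simp add: D_def)

lemma subspace_D: "subspace D"
proof (rule subspaceI)
  show "0 \<in> D" by (simp add: D_def ip_simps)
next
  fix f g assume fg: "f \<in> D" "g \<in> D"
  let ?u = "\<lambda>n. (l n)\<^sup>2 * (ip f (\<phi> n))\<^sup>2" and ?v = "\<lambda>n. (l n)\<^sup>2 * (ip g (\<phi> n))\<^sup>2"
  have V: "f \<in> V" "g \<in> V" using fg by (auto simp: D_def)
  have "summable (\<lambda>n. 2 * (?u n + ?v n))"
    using fg by (intro summable_mult summable_add) (auto simp: D_def)
  then have "summable (\<lambda>n. (l n)\<^sup>2 * (ip (f + g) (\<phi> n))\<^sup>2)"
  proof (rule summable_comparison_test[OF exI[of _ 0], rotated], intro allI impI)
    fix n
    have "(ip f (\<phi> n) + ip g (\<phi> n))\<^sup>2 \<le> 2 * ((ip f (\<phi> n))\<^sup>2 + (ip g (\<phi> n))\<^sup>2)"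
      using sum_squares_bound[of "ip f (\<phi> n)" "ip g (\<phi> n)"] by (simp add: power2_sum)
    then have "(l n)\<^sup>2 * (ip f (\<phi> n) + ip g (\<phi> n))\<^sup>2 \<le> (l n)\<^sup>2 * (2 * ((ip f (\<phi> n))\<^sup>2 + (ip g (\<phi> n))\<^sup>2))"
      by (rule mult_left_mono) simp
    then show "norm ((l n)\<^sup>2 * (ip (f + g) (\<phi> n))\<^sup>2) \<le> 2 * (?u n + ?v n)"
      using V by (simp add: ip_simps algebra_simps)
  qed
  then show "f + g \<in> D" using V by (simp add: D_def V_closed)
next
  fix c f assume f: "f \<in> D"
  then have "summable (\<lambda>n. c\<^sup>2 * ((l n)\<^sup>2 * (ip f (\<phi> n))\<^sup>2))"
    by (intro summable_mult) (simp add: D_def)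
  then show "c *\<^sub>R f \<in> D"
    using f by (simp add: D_def ip_simps power_mult_distrib algebra_simps)
qed

lemma basis_in_D: "\<phi> n \<in> D"
  by (auto simp: D_def ip_basis split: if_splits intro!: summable_finite[of "{n}"])

lemma T_basis: "T (\<phi> n) = l n *\<^sub>R \<phi> n"
  by (rule coeff_eqI) (auto simp: T_in basis_in_D coeff_T V_closed ip_scale_left ip_basis)

lemma linear_operator: "linear_operator_on V D T"
  unfolding linear_operator_on_def
proof (intro conjI ballI allI)
  fix f g assume "f \<in> D" "g \<in> D"
  then show "T (f + g) = T f + T g"
    by (intro coeff_eqI)
      (auto simp: T_in D_V subspace_add[OF subspace_D] V_closed coeff_T ip_add_left algebra_simps)
next
  fix c f assume "f \<in> D"
  then show "T (c *\<^sub>R f) = c *\<^sub>R T f"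
    by (intro coeff_eqI)
      (auto simp: T_in D_V subspace_scale[OF subspace_D] V_closed coeff_T ip_scale_left)
qed (auto simp: subspace_D T_in D_V)

lemma dense_D: "dense_in V ip D"
proof -
  have "span (range \<phi>) \<subseteq> D" by (rule span_minimal) (auto simp: basis_in_D subspace_D)
  moreover have "dense_in V ip (span (range \<phi>))" using onb by (simp add: orthonormal_basis_def)
  ultimately show ?thesis unfolding dense_in_def using D_V by blast
qed

text \<open>Each coefficient is continuous, so the coefficients of the limit \<open>g\<close> are
  \<open>l n\<close> times those of \<open>f\<close>. As coefficients of a vector they are square
  summable, which is exactly membership of \<open>f\<close> in the maximal domain.\<close>

lemma closed_operator: "closed_operator_on V ip D T"
  unfolding closed_operator_on_def
proof (intro conjI allI ballI impI linear_operator; elim conjE)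
  fix s f g
  assume f: "f \<in> V" and g: "g \<in> V" and s: "\<forall>n. s n \<in> D"
    and sf: "ip_tendsto ip s f" and Tsg: "ip_tendsto ip (\<lambda>n. T (s n)) g"
  have coeff: "ip g (\<phi> n) = l n * ip f (\<phi> n)" for n
  proof (rule LIMSEQ_unique)
    show "(\<lambda>k. ip (T (s k)) (\<phi> n)) \<longlonglongrightarrow> ip g (\<phi> n)"
      using Tsg s g by (intro tendsto_ip_left) (auto simp: T_in)
    have "(\<lambda>k. l n * ip (s k) (\<phi> n)) \<longlonglongrightarrow> l n * ip f (\<phi> n)"
      using sf s f by (intro tendsto_intros tendsto_ip_left) (auto simp: D_V)
    then show "(\<lambda>k. ip (T (s k)) (\<phi> n)) \<longlonglongrightarrow> l n * ip f (\<phi> n)"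
      using s by (simp add: coeff_T)
  qed
  have "summable (\<lambda>n. (ip g (\<phi> n))\<^sup>2)" using Parseval[OF g] by (rule sums_summable)
  then have "f \<in> D" using f by (simp add: D_def coeff power_mult_distrib)
  then show "f \<in> D" "T f = g"
    using g by (auto intro!: coeff_eqI simp: T_in coeff_T coeff)
qed

text \<open>Both sides of the symmetry relation are the series of
  \<open>l n * ip f (\<phi> n) * ip g (\<phi> n)\<close>. Conversely, testing the adjoint relation
  on basis vectors determines the coefficients of \<open>h\<close>, and maximality of
  \<open>D\<close> puts \<open>g\<close> into it.\<close>

lemma self_adjoint: "self_adjoint_on V ip D T"
proof -
  have sym: "ip (T f) g = ip f (T g)" if "f \<in> D" "g \<in> D" for f g
  proof (rule sums_unique2)
    show "(\<lambda>n. l n * ip f (\<phi> n) * ip g (\<phi> n)) sums ip (T f) g"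
      using Parseval_ip[of "T f" g] that by (simp add: T_in D_V coeff_T)
    show "(\<lambda>n. l n * ip f (\<phi> n) * ip g (\<phi> n)) sums ip f (T g)"
      using Parseval_ip[of f "T g"] that by (simp add: T_in D_V coeff_T algebra_simps)
  qed
  have adj: "ip h (\<phi> n) = l n * ip g (\<phi> n)"
    if "g \<in> V" "h \<in> V" "\<forall>f\<in>D. ip (T f) g = ip f h" for g h n
    using that(3)[rule_format, OF basis_in_D[of n]] that(1,2)
    by (simp add: T_basis ip_scale_left ip_commute)
  have "adjoint_dom V ip D T = D"
  proof
    show "D \<subseteq> adjoint_dom V ip D T"
      using sym T_in D_V by (auto simp: adjoint_dom_def)
    show "adjoint_dom V ip D T \<subseteq> D"
    proof
      fix g assume "g \<in> adjoint_dom V ip D T"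
      then obtain h where gh: "g \<in> V" "h \<in> V" "\<forall>f\<in>D. ip (T f) g = ip f h"
        by (auto simp: adjoint_dom_def)
      have "summable (\<lambda>n. (ip h (\<phi> n))\<^sup>2)" using Parseval[OF gh(2)] by (rule sums_summable)
      then show "g \<in> D" using gh by (simp add: D_def adj[OF gh] power_mult_distrib)
    qed
  qed
  moreover have "adjoint_op V ip D T g = T g" if g: "g \<in> D" for g
    unfolding adjoint_op_def
  proof (rule the_equality)
    show "T g \<in> V \<and> (\<forall>f\<in>D. ip (T f) g = ip f (T g))" using g sym T_in by blast
    show "h = T g" if "h \<in> V \<and> (\<forall>f\<in>D. ip (T f) g = ip f h)" for h
      using that g by (intro coeff_eqI) (auto simp: T_in coeff_T D_V intro!: adj)
  qed
  ultimately show ?thesis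
    by (simp add: self_adjoint_on_def linear_operator dense_D)
qed

lemma eigenvector_basis: "eigenvector D T (l n) (\<phi> n)"
  by (simp add: eigenvector_def basis_in_D T_basis basis_nonzero)

text \<open>An eigenvector is nonzero and so has some nonzero coefficient; comparing this
  coefficient on both sides of the eigenvalue equation identifies the eigenvalue.\<close>

lemma eigenvalues_eq: "eigenvalues D T = range l"
proof
  show "range l \<subseteq> eigenvalues D T" using eigenvector_basis by (auto simp: eigenvalues_def)
  show "eigenvalues D T \<subseteq> range l"
  proof
    fix x assume "x \<in> eigenvalues D T"
    then obtain f where f: "f \<in> D" "f \<noteq> 0" "T f = x *\<^sub>R f"
      by (auto simp: eigenvalues_def eigenvector_def)
    obtain n where n: "ip f (\<phi> n) \<noteq> 0"
      using coeff_eqI[of f 0] f by (auto simp: D_V ip_zero_left V_closed)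
    have "l n * ip f (\<phi> n) = x * ip f (\<phi> n)"
      unfolding coeff_T[OF f(1), symmetric] by (simp add: f ip_scale_left D_V)
    then have "x = l n" using n by simp
    then show "x \<in> range l" by simp
  qed
qed

text \<open>One application of \<open>T - l n\<close> multiplies the coefficient of index
  \<open>m\<close> by \<open>l m - l n\<close>, which is nonzero by injectivity. Generalized
  eigenvectors thus have no component outside the line of \<open>\<phi> n\<close>, which is what
  algebraic multiplicity one requires.\<close>

lemma ker_power_coeff:
  assumes "f \<in> ker_power D T (l n) k" "m \<noteq> n"
  shows "f \<in> V \<and> ip f (\<phi> m) = 0"
  using assms(1)
proof (induction k arbitrary: f)
  case 0
  then show ?case by (simp add: ip_zero_left V_closed)
next
  case (Suc k)
  then have f: "f \<in> D" and "ip (T f - l n *\<^sub>R f) (\<phi> m) = 0" by auto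
  then have "(l m - l n) * ip f (\<phi> m) = 0"
    by (simp add: ip_simps T_in D_V coeff_T algebra_simps)
  then show ?case using f assms(2) inj by (auto simp: D_V inj_eq)
qed

lemma simple_eigenvalue: "simple_eigenvalue D T (l n)"
proof -
  have "(\<Union>k. ker_power D T (l n) k) = span {\<phi> n}"
  proof
    show "(\<Union>k. ker_power D T (l n) k) \<subseteq> span {\<phi> n}"
    proof
      fix f assume "f \<in> (\<Union>k. ker_power D T (l n) k)"
      then obtain k where k: "f \<in> ker_power D T (l n) k" by auto
      \<comment> \<open>\<open>Suc n\<close> stands for any index different from \<open>n\<close>;
        only membership in \<open>V\<close> is extracted here.\<close>
      then have V: "f \<in> V" using ker_power_coeff[OF k, of "Suc n"] by simp
      have "f = ip f (\<phi> n) *\<^sub>R \<phi> n"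
        using V ker_power_coeff[OF k] by (intro coeff_eqI) (auto simp: ip_simps ip_basis)
      then show "f \<in> span {\<phi> n}" by (metis span_base span_scale singletonI)
    qed
    have "span {\<phi> n} \<subseteq> ker_power D T (l n) 1"
      using linear_operator basis_in_D[of n] subspace_D
      by (auto simp: span_singleton linear_operator_on_def T_basis subspace_scale)
    then show "span {\<phi> n} \<subseteq> (\<Union>k. ker_power D T (l n) k)" by blast
  qed
  then have "dim (\<Union>k. ker_power D T (l n) k) = 1"
    using basis_nonzero[of n] by (simp add: dim_eq_card_independent)
  then show ?thesis by (auto simp: simple_eigenvalue_def eigenvalues_eq)
qed

lemma riesz_spectral:
  assumes "totally_disconnected (closure (range l))"
  shows "riesz_spectral_on V ip D T"
  unfolding riesz_spectral_on_def
  using assms hilbert closed_operator riesz_basis simple_eigenvalue eigenvector_basis inj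
  by (auto simp: eigenvalues_eq bij_betw_def)

end


section \<open>The domain of a fractional power as a Hilbert space\<close>

text \<open>The partial sums of the expansion of \<open>f\<close> lie in \<open>D\<close>, and their
  images are the partial sums of the square-summable family \<open>l n * ip f (\<phi> n)\<close>.
  Both sequences converge, so the limit pair belongs to the closed graph.\<close>

lemma (in onb_space) closed_operator_diagonal:
  assumes closed: "closed_operator_on V ip D T"
    and eigen: "\<And>n. eigenvector D T (l n) (\<phi> n)"
    and f: "f \<in> V" and summable: "summable (\<lambda>n. (l n)\<^sup>2 * (ip f (\<phi> n))\<^sup>2)"
  shows "f \<in> D" and "ip (T f) (\<phi> n) = l n * ip f (\<phi> n)"
proof -
  obtain g where g: "g \<in> V" "\<And>n. ip g (\<phi> n) = l n * ip f (\<phi> n)"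
      "ip_tendsto ip (\<lambda>N. \<Sum>n<N. (l n * ip f (\<phi> n)) *\<^sub>R \<phi> n) g"
    using Riesz_Fischer[of "\<lambda>n. l n * ip f (\<phi> n)"] summable by (auto simp: power_mult_distrib)
  let ?s = "\<lambda>N. \<Sum>n<N. ip f (\<phi> n) *\<^sub>R \<phi> n"
  have linear: "linear_operator_on V D T" using closed by (simp add: closed_operator_on_def)
  then have D: "subspace D" and add: "\<And>f g. f \<in> D \<Longrightarrow> g \<in> D \<Longrightarrow> T (f + g) = T f + T g"
    and scale: "\<And>c f. f \<in> D \<Longrightarrow> T (c *\<^sub>R f) = c *\<^sub>R T f"
    by (auto simp: linear_operator_on_def)
  have \<phi>: "\<phi> n \<in> D" "T (\<phi> n) = l n *\<^sub>R \<phi> n" for n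
    using eigen by (auto simp: eigenvector_def)
  have T0: "T 0 = 0" using scale[OF subspace_0[OF D], of 0] by simp
  have s: "?s N \<in> D \<and> T (?s N) = (\<Sum>n<N. (l n * ip f (\<phi> n)) *\<^sub>R \<phi> n)" for N
    by (induction N)
      (auto simp: T0 add scale \<phi> subspace_0[OF D] subspace_add[OF D] subspace_scale[OF D] mult.commute)
  have "f \<in> D \<and> T f = g"
    using closed unfolding closed_operator_on_def
    by (elim conjE allE[of _ ?s] ballE[of _ _ f] ballE[of _ _ g])
      (use basis_expansion[OF f] s g(1,3) f in auto)
  then show "f \<in> D" "ip (T f) (\<phi> n) = l n * ip f (\<phi> n)" using g(2) by auto
qed

text \<open>\<open>\<delta>\<close> is a uniform gap between \<mu> and the numbers
  \<open>l n\<close>. Positivity of each \<mu> - l n alone would not bound the negative powers of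
  these differences.\<close>

locale frac_power_space = onb_space V ip \<phi>
  for V :: "'v::real_vector set" and ip \<phi> +
  fixes l :: "nat \<Rightarrow> real" and \<mu> \<alpha> \<delta> :: real
  assumes \<delta>: "\<delta> > 0" "\<And>n. \<delta> \<le> \<mu> - l n" and \<alpha>: "\<alpha> > 0"
begin

abbreviation W :: "'v set" where "W \<equiv> frac_power_dom V ip l \<phi> \<mu> \<alpha>"
abbreviation F :: "'v \<Rightarrow> 'v" where "F \<equiv> frac_power V ip l \<phi> \<mu> \<alpha>"
abbreviation ipW :: "'v \<Rightarrow> 'v \<Rightarrow> real" where "ipW \<equiv> ip_frac V ip l \<phi> \<mu> \<alpha>"
abbreviation \<psi> :: "nat \<Rightarrow> 'v" where "\<psi> n \<equiv> ((\<mu> - l n) powr (- \<alpha>)) *\<^sub>R \<phi> n"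

lemma gap_pos: "0 < \<mu> - l n"
  using \<delta>(1) \<delta>(2)[of n] by linarith

lemma powr_square: "((\<mu> - l n) powr \<alpha> * x)\<^sup>2 = (\<mu> - l n) powr (2 * \<alpha>) * x\<^sup>2"
proof -
  have "((\<mu> - l n) powr \<alpha>)\<^sup>2 = (\<mu> - l n) powr (2 * \<alpha>)"
    by (simp add: power2_eq_square powr_add[symmetric])
  then show ?thesis by (simp add: power_mult_distrib)
qed

lemma powr_cancel: "(\<mu> - l n) powr \<alpha> * (\<mu> - l n) powr (- \<alpha>) = 1"
  using gap_pos[of n] by (simp add: powr_minus)

lemma powr_lower: "0 < \<delta> powr \<alpha>" "\<delta> powr \<alpha> \<le> (\<mu> - l n) powr \<alpha>"
  using \<delta> \<alpha> by (auto intro: powr_mono2 less_imp_le)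

lemma W_V: "f \<in> W \<Longrightarrow> f \<in> V"
  by (simp add: frac_power_dom_def)

lemma W_iff: "f \<in> W \<longleftrightarrow> f \<in> V \<and> summable (\<lambda>n. ((\<mu> - l n) powr \<alpha> * ip f (\<phi> n))\<^sup>2)"
  by (simp add: frac_power_dom_def powr_square)

lemma frac_power_coeff:
  assumes f: "f \<in> W"
  shows "F f \<in> V" "ip (F f) (\<phi> n) = (\<mu> - l n) powr \<alpha> * ip f (\<phi> n)"
proof -
  let ?c = "\<lambda>n. (\<mu> - l n) powr \<alpha> * ip f (\<phi> n)"
  obtain g where g: "g \<in> V" "\<And>n. ip g (\<phi> n) = ?c n" "ip_tendsto ip (\<lambda>N. \<Sum>n<N. ?c n *\<^sub>R \<phi> n) g"
    using Riesz_Fischer[of ?c] f by (auto simp: W_iff)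
  have "F f = g"
    unfolding frac_power_def by (rule ip_suminf_eqI) (use g in \<open>auto simp: V_closed\<close>)
  then show "F f \<in> V" "ip (F f) (\<phi> n) = ?c n" using g by auto
qed

text \<open>The gap bounds (\<mu> - l n) powr (- \<alpha>) by \<delta> powr (- \<alpha>), so
  dividing the coefficients of \<open>g\<close> by the weights preserves square summability. The
  completeness of \<open>W\<close> relies on this.\<close>

lemma frac_power_surj:
  assumes g: "g \<in> V"
  obtains f where "f \<in> W" "F f = g"
proof -
  let ?c = "\<lambda>n. (\<mu> - l n) powr (- \<alpha>) * ip g (\<phi> n)"
  have "summable (\<lambda>n. (\<delta> powr (- \<alpha>))\<^sup>2 * (ip g (\<phi> n))\<^sup>2)"
    using Parseval[OF g] by (intro summable_mult sums_summable)
  then have "summable (\<lambda>n. (?c n)\<^sup>2)"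
  proof (rule summable_comparison_test[OF exI[of _ 0], rotated], intro allI impI)
    fix n
    have "(\<mu> - l n) powr (- \<alpha>) \<le> \<delta> powr (- \<alpha>)"
      using \<delta> \<alpha> gap_pos[of n] by (intro powr_mono2') auto
    then have "((\<mu> - l n) powr (- \<alpha>))\<^sup>2 \<le> (\<delta> powr (- \<alpha>))\<^sup>2"
      by (intro power_mono) auto
    then show "norm ((?c n)\<^sup>2) \<le> (\<delta> powr (- \<alpha>))\<^sup>2 * (ip g (\<phi> n))\<^sup>2"
      by (simp add: power_mult_distrib mult_right_mono)
  qed
  then obtain f where f: "f \<in> V" "\<And>n. ip f (\<phi> n) = ?c n"
    using Riesz_Fischer[of ?c] by metis
  have c: "(\<mu> - l n) powr \<alpha> * ip f (\<phi> n) = ip g (\<phi> n)" for n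
    unfolding f mult.assoc[symmetric] powr_cancel by simp
  have W: "f \<in> W"
    unfolding W_iff c using f(1) sums_summable[OF Parseval[OF g]] by blast
  moreover have "F f = g"
    using W g by (intro coeff_eqI) (auto simp: frac_power_coeff c)
  ultimately show ?thesis using that by blast
qed

text \<open>The weighted coefficients of \<open>f + g\<close> are the coefficients of the vector
  \<open>F f + F g\<close> of \<open>V\<close>, so Parseval's identity gives their square
  summability without any estimate. The scalar multiple is treated in the same way.\<close>

lemma subspace_W: "subspace W"
proof (rule subspaceI)
  show "0 \<in> W" by (simp add: W_iff ip_simps)
next
  fix f g assume fg: "f \<in> W" "g \<in> W"
  then have V: "f \<in> V" "g \<in> V" "F f + F g \<in> V"
    by (auto simp: W_V V_closed frac_power_coeff)
  have "ip (F f + F g) (\<phi> n) = (\<mu> - l n) powr \<alpha> * ip (f + g) (\<phi> n)" for n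
    using fg V by (simp add: ip_add_left frac_power_coeff algebra_simps)
  then show "f + g \<in> W"
    using Parseval[OF V(3)] V by (auto simp: W_iff V_closed sums_summable)
next
  fix c f assume f: "f \<in> W"
  then have V: "f \<in> V" "c *\<^sub>R F f \<in> V"
    by (auto simp: W_V V_closed frac_power_coeff)
  have "ip (c *\<^sub>R F f) (\<phi> n) = (\<mu> - l n) powr \<alpha> * ip (c *\<^sub>R f) (\<phi> n)" for n
    using f V by (simp add: ip_scale_left frac_power_coeff)
  then show "c *\<^sub>R f \<in> W"
    using Parseval[OF V(2)] V by (auto simp: W_iff V_closed sums_summable)
qed

lemma frac_power_add:
  assumes "f \<in> W" "g \<in> W"
  shows "F (f + g) = F f + F g"
  using assms subspace_add[OF subspace_W assms]
  by (intro coeff_eqI) (auto simp: frac_power_coeff V_closed ip_add_left W_V algebra_simps)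

lemma frac_power_scale:
  assumes "f \<in> W"
  shows "F (c *\<^sub>R f) = c *\<^sub>R F f"
  using assms subspace_scale[OF subspace_W assms]
  by (intro coeff_eqI) (auto simp: frac_power_coeff V_closed ip_scale_left W_V)

lemma frac_power_diff:
  assumes "f \<in> W" "g \<in> W"
  shows "F (f - g) = F f - F g"
  using assms subspace_diff[OF subspace_W assms]
  by (intro coeff_eqI) (auto simp: frac_power_coeff V_closed ip_diff_left W_V algebra_simps)

lemma frac_power_lincomb:
  assumes "\<And>n. n \<in> I \<Longrightarrow> x n \<in> W"
  shows "F (\<Sum>n\<in>I. c n *\<^sub>R x n) = (\<Sum>n\<in>I. c n *\<^sub>R F (x n))"
  using assms
proof (induction I rule: infinite_finite_induct)
  case (insert n I)
  then show ?case
    by (simp add: frac_power_add frac_power_scale subspace_scale[OF subspace_W]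
      subspace_sum[OF subspace_W])
qed (use frac_power_scale[OF subspace_0[OF subspace_W], of 0] in auto)

lemma frac_power_eq_0: "f \<in> W \<Longrightarrow> F f = 0 \<Longrightarrow> f = 0"
  using powr_lower by (intro coeff_eqI)
    (metis W_V V_closed(1) frac_power_coeff(2) ip_zero_left basis_in mult_eq_0_iff not_less)+

lemma ip_norm_W: "ip_norm ipW f = ip_norm ip (F f)"
  by (simp add: ip_norm_def ip_frac_def)

lemma ip_tendsto_W:
  "(\<And>n. s n \<in> W) \<Longrightarrow> f \<in> W \<Longrightarrow> ip_tendsto ipW s f \<longleftrightarrow> ip_tendsto ip (\<lambda>n. F (s n)) (F f)"
  by (simp add: ip_tendsto_def ip_norm_W frac_power_diff)

text \<open>Definiteness is the injectivity of \<open>F\<close>. For completeness, the image of a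
  Cauchy sequence converges in \<open>V\<close>, and surjectivity provides a preimage of the
  limit.\<close>

lemma hilbert_W: "hilbert_space_on W ipW"
  unfolding hilbert_space_on_def
proof (intro conjI allI impI subspace_W; (elim conjE)?)
  show "inner_product_on W ipW"
    unfolding inner_product_on_def ip_frac_def
    by (intro conjI ballI allI impI ip_commute ip_pos)
      (auto simp: frac_power_add frac_power_scale frac_power_coeff ip_add_left ip_scale_left
        dest: frac_power_eq_0)
next
  fix s assume s: "\<forall>n. s n \<in> W" and "ip_Cauchy ipW s"
  then have "ip_Cauchy ip (\<lambda>n. F (s n))"
    by (simp add: ip_Cauchy_def ip_norm_W frac_power_diff)
  moreover have "(\<forall>n. t n \<in> V) \<and> ip_Cauchy ip t \<longrightarrow> (\<exists>f\<in>V. ip_tendsto ip t f)" for t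
    using hilbert by (simp add: hilbert_space_on_def)
  ultimately obtain g where g: "g \<in> V" "ip_tendsto ip (\<lambda>n. F (s n)) g"
    using s frac_power_coeff(1) by meson
  then obtain f where "f \<in> W" "F f = g" using frac_power_surj by blast
  then show "\<exists>f\<in>W. ip_tendsto ipW s f" using s g by (auto simp: ip_tendsto_W)
qed

lemma psi_in_W: "\<psi> n \<in> W"
  by (auto simp: W_iff V_closed ip_scale_left ip_basis split: if_splits intro!: summable_finite[of "{n}"])

lemma frac_power_psi: "F (\<psi> n) = \<phi> n"
  using psi_in_W[of n] powr_cancel[of n]
  by (intro coeff_eqI) (auto simp: frac_power_coeff ip_scale_left ip_basis)

lemma ip_W_psi: "f \<in> W \<Longrightarrow> ipW f (\<psi> n) = (\<mu> - l n) powr \<alpha> * ip f (\<phi> n)"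
  by (simp add: ip_frac_def frac_power_psi frac_power_coeff)

lemma onb_W: "orthonormal_basis W ipW \<psi>"
  unfolding orthonormal_basis_def
proof (intro conjI allI)
  fix m n
  show "\<psi> n \<in> W" by (rule psi_in_W)
  show "ipW (\<psi> m) (\<psi> n) = (if m = n then 1 else 0)"
    by (simp add: ip_frac_def frac_power_psi ip_basis)
next
  show "dense_in W ipW (span (range \<psi>))"
    unfolding dense_in_def
  proof (intro conjI ballI allI impI)
    show "span (range \<psi>) \<subseteq> W" using psi_in_W by (intro span_minimal subspace_W) auto
  next
    fix f and e :: real assume f: "f \<in> W" and e: "e > 0"
    have "dense_in V ip (span (range \<phi>))" using onb by (simp add: orthonormal_basis_def)
    then obtain g where "g \<in> span (range \<phi>)" and ge: "ip_norm ip (F f - g) < e"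
      using frac_power_coeff(1)[OF f] e unfolding dense_in_def by meson
    then obtain N c where g: "g = (\<Sum>n<N. c n *\<^sub>R \<phi> n)" using span_basis_lincomb by blast
    \<comment> \<open>The coefficients that approximate \<open>F f\<close> in terms of
      \<open>\<phi>\<close> are reused for \<open>\<psi>\<close>; \<open>F\<close> maps this
      combination to \<open>g\<close> and preserves distances.\<close>
    let ?h = "\<Sum>n<N. c n *\<^sub>R \<psi> n"
    have "?h \<in> W" by (intro subspace_sum[OF subspace_W] subspace_scale[OF subspace_W] psi_in_W)
    moreover have "F ?h = g"
      unfolding g by (subst frac_power_lincomb) (auto simp: psi_in_W frac_power_psi)
    ultimately have "ip_norm ipW (f - ?h) < e" using f ge by (simp add: ip_norm_W frac_power_diff)
    moreover have "?h \<in> span (range \<psi>)"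
      by (intro span_sum span_scale span_base) auto
    ultimately show "\<exists>g\<in>span (range \<psi>). ip_norm ipW (f - g) < e" by blast
  qed
qed

text \<open>The coefficients with respect to \<open>\<psi>\<close> are those with respect to
  \<open>\<phi>\<close> times weights bounded below, so the summability that defines
  \<open>DW\<close> implies the one needed for closedness in \<open>V\<close>. The weighted
  coefficients of \<open>T f\<close> are the very family whose squares are summed in
  \<open>DW\<close>, hence \<open>T f\<close> stays in \<open>W\<close>.\<close>

lemma closed_operator_restrict:
  assumes closed: "closed_operator_on V ip D T"
    and eigen: "\<And>n. eigenvector D T (l n) (\<phi> n)" and inj: "inj l"
  defines "DW \<equiv> {f \<in> W. summable (\<lambda>n. (l n)\<^sup>2 * (ipW f (\<psi> n))\<^sup>2)}"
  shows "DW \<subseteq> D" and "diagonal_operator W ipW \<psi> DW T l"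
proof -
  have *: "f \<in> D \<and> T f \<in> W \<and> (\<forall>n. ipW (T f) (\<psi> n) = l n * ipW f (\<psi> n))" if "f \<in> DW" for f
  proof -
    have f: "f \<in> W" "f \<in> V" and sum: "summable (\<lambda>n. (l n)\<^sup>2 * ((\<mu> - l n) powr \<alpha> * ip f (\<phi> n))\<^sup>2)"
      using that by (auto simp: DW_def ip_W_psi W_V)
    \<comment> \<open>The constant is the reciprocal of the lower bound for the squared
      weights.\<close>
    have "summable (\<lambda>n. inverse ((\<delta> powr \<alpha>)\<^sup>2) * ((l n)\<^sup>2 * ((\<mu> - l n) powr \<alpha> * ip f (\<phi> n))\<^sup>2))"
      using sum by (rule summable_mult)
    then have "summable (\<lambda>n. (l n)\<^sup>2 * (ip f (\<phi> n))\<^sup>2)"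
    proof (rule summable_comparison_test[OF exI[of _ 0], rotated], intro allI impI)
      fix n
      have "(\<delta> powr \<alpha>)\<^sup>2 * ((l n)\<^sup>2 * (ip f (\<phi> n))\<^sup>2) \<le> ((\<mu> - l n) powr \<alpha>)\<^sup>2 * ((l n)\<^sup>2 * (ip f (\<phi> n))\<^sup>2)"
        using powr_lower(2)[of n] by (intro mult_right_mono power_mono) auto
      then show "norm ((l n)\<^sup>2 * (ip f (\<phi> n))\<^sup>2)
          \<le> inverse ((\<delta> powr \<alpha>)\<^sup>2) * ((l n)\<^sup>2 * ((\<mu> - l n) powr \<alpha> * ip f (\<phi> n))\<^sup>2)"
        using zero_less_power[OF powr_lower(1), of 2]
        by (simp add: pos_le_divide_eq inverse_eq_divide power_mult_distrib mult_ac)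
    qed
    note diag = closed_operator_diagonal[OF closed eigen f(2) this]
    have TV: "T f \<in> V"
      using closed diag(1) by (auto simp: closed_operator_on_def linear_operator_on_def)
    then have "T f \<in> W"
      using sum by (simp add: W_iff diag(2) power_mult_distrib mult.left_commute)
    then show ?thesis using diag f by (simp add: ip_W_psi)
  qed
  then show "DW \<subseteq> D" by blast
  show "diagonal_operator W ipW \<psi> DW T l"
    by unfold_locales (use * inj hilbert_W onb_W in \<open>auto simp: DW_def\<close>)
qed

end


section \<open>The space L^2(a,b)\<close>

lemma ae_eq_refl: "f \<in> borel_measurable borel \<Longrightarrow> ae_eq f f"
  by (simp add: ae_eq_def)

lemma L0_cases:
  obtains f0 where "f0 \<in> borel_measurable borel" "f = abs_L0 f0"
proof -
  have "ae_eq (rep_L0 f) (rep_L0 f)" "abs_L0 (rep_L0 f) = f"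
    using Quotient3_rep_reflp[OF Quotient3_L0] Quotient3_abs_rep[OF Quotient3_L0] by auto
  then show ?thesis using that[of "rep_L0 f"] by (simp add: ae_eq_def)
qed

lemma abs_L0_eq_iff:
  assumes "f \<in> borel_measurable borel" "g \<in> borel_measurable borel"
  shows "abs_L0 f = abs_L0 g \<longleftrightarrow> (AE x in lborel. f x = g x)"
  using assms Quotient3_rel[OF Quotient3_L0, of f g] by (auto simp: ae_eq_def)

lemma abs_L0_ops:
  assumes "f \<in> borel_measurable borel" "g \<in> borel_measurable borel"
  shows "abs_L0 f + abs_L0 g = abs_L0 (\<lambda>x. f x + g x)"
    and "abs_L0 f - abs_L0 g = abs_L0 (\<lambda>x. f x - g x)"
    and "abs_L0 f * abs_L0 g = abs_L0 (\<lambda>x. f x * g x)"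
  using assms
  by (simp_all add: ae_eq_refl plus_L0.abs_eq minus_L0.abs_eq times_L0.abs_eq)

lemma abs_L0_unary:
  assumes "f \<in> borel_measurable borel"
  shows "- abs_L0 f = abs_L0 (\<lambda>x. - f x)" and "c *\<^sub>R abs_L0 f = abs_L0 (\<lambda>x. c * f x)"
    and "L0_integral (abs_L0 f) = integral\<^sup>L lborel f"
    and "L0_integrable (abs_L0 f) \<longleftrightarrow> integrable lborel f"
  using assms
  by (simp_all add: ae_eq_refl uminus_L0.abs_eq scaleR_L0.abs_eq L0_integral.abs_eq L0_integrable.abs_eq)

lemma zero_L0_eq: "0 = abs_L0 (\<lambda>_. 0)"
  by (simp add: zero_L0_def)

definition restr :: "real \<Rightarrow> real \<Rightarrow> (real \<Rightarrow> real) \<Rightarrow> real \<Rightarrow> real" where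
  "restr a b u x = indicat_real {a..b} x * u x"

lemma restr_class_eq: "restr_class a b u = abs_L0 (restr a b u)"
  by (simp add: restr_class_def restr_def[abs_def])

lemma restr_simps: "x \<in> {a..b} \<Longrightarrow> restr a b u x = u x" "x \<notin> {a..b} \<Longrightarrow> restr a b u x = 0"
  by (auto simp: restr_def)

lemma restr_measurable: "continuous_on {a..b} u \<Longrightarrow> restr a b u \<in> borel_measurable borel"
  using borel_measurable_continuous_on_indicator[of "{a..b}" u] by (simp add: restr_def[abs_def])

lemma restr_integrable: "continuous_on {a..b} u \<Longrightarrow> integrable lborel (restr a b u)"
  using borel_integrable_atLeastAtMost'[of a b u]
  by (simp add: restr_def[abs_def] set_integrable_def)

lemma continuous_on_interval_bounded:
  fixes u :: "real \<Rightarrow> real"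
  assumes "continuous_on {a..b} u"
  obtains B where "B > 0" "\<And>x. x \<in> {a..b} \<Longrightarrow> \<bar>u x\<bar> \<le> B"
proof -
  have "bounded (u ` {a..b})"
    using assms by (intro compact_imp_bounded compact_continuous_image) auto
  then show ?thesis using that by (auto simp: bounded_pos)
qed

text \<open>Representatives of the elements of \<open>L2 a b\<close>, with vanishing outside the
  interval demanded at every point. Pointwise identities under an integral then need no exceptional
  set. \<open>sqint_L2\<close> and \<open>L2_cases\<close> translate between the two levels.\<close>

definition sqint :: "real \<Rightarrow> real \<Rightarrow> (real \<Rightarrow> real) \<Rightarrow> bool" where
  "sqint a b f \<longleftrightarrow> f \<in> borel_measurable borel \<and> (\<forall>x. x \<notin> {a..b} \<longrightarrow> f x = 0) \<and>
     integrable lborel (\<lambda>x. (f x)\<^sup>2)"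

lemma sqint_measurable [measurable_dest]: "sqint a b f \<Longrightarrow> f \<in> borel_measurable borel"
  by (simp add: sqint_def)

lemma sqint_outside: "sqint a b f \<Longrightarrow> x \<notin> {a..b} \<Longrightarrow> f x = 0"
  by (simp add: sqint_def)

lemma sqint_integrable_square: "sqint a b f \<Longrightarrow> integrable lborel (\<lambda>x. (f x)\<^sup>2)"
  by (simp add: sqint_def)

lemma sqint_integrable_mult:
  assumes f: "sqint a b f" and g: "sqint a b g"
  shows "integrable lborel (\<lambda>x. f x * g x)"
proof (rule Bochner_Integration.integrable_bound)
  show "integrable lborel (\<lambda>x. (f x)\<^sup>2 + (g x)\<^sup>2)"
    using f g by (intro Bochner_Integration.integrable_add sqint_integrable_square)
  show "(\<lambda>x. f x * g x) \<in> borel_measurable lborel"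
    using f g by (auto simp: sqint_def)
  show "AE x in lborel. norm (f x * g x) \<le> norm ((f x)\<^sup>2 + (g x)\<^sup>2)"
  proof (intro always_eventually allI)
    fix x
    have "2 * (\<bar>f x\<bar> * \<bar>g x\<bar>) \<le> (f x)\<^sup>2 + (g x)\<^sup>2"
      using sum_squares_bound[of "\<bar>f x\<bar>" "\<bar>g x\<bar>"] by simp
    moreover have "0 \<le> \<bar>f x\<bar> * \<bar>g x\<bar>" by simp
    ultimately show "norm (f x * g x) \<le> norm ((f x)\<^sup>2 + (g x)\<^sup>2)"
      unfolding real_norm_def abs_mult by linarith
  qed
qed

lemma sqint_add:
  assumes f: "sqint a b f" and g: "sqint a b g"
  shows "sqint a b (\<lambda>x. f x + g x)"
proof -
  have "integrable lborel (\<lambda>x. (f x)\<^sup>2 + (g x)\<^sup>2 + 2 * (f x * g x))"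
    using f g by (intro Bochner_Integration.integrable_add sqint_integrable_square
        Bochner_Integration.integrable_mult_right sqint_integrable_mult)
  then show ?thesis using f g by (auto simp: sqint_def power2_sum algebra_simps)
qed

lemma sqint_mult_bounded:
  assumes f: "sqint a b f" and u[measurable]: "u \<in> borel_measurable borel"
    and B: "\<And>x. x \<in> {a..b} \<Longrightarrow> \<bar>u x\<bar> \<le> B"
  shows "sqint a b (\<lambda>x. u x * f x)"
proof -
  note [measurable] = sqint_measurable[OF f]
  have "integrable lborel (\<lambda>x. (u x * f x)\<^sup>2)"
  proof (rule Bochner_Integration.integrable_bound)
    show "integrable lborel (\<lambda>x. B\<^sup>2 * (f x)\<^sup>2)"
      using f by (intro Bochner_Integration.integrable_mult_right sqint_integrable_square)
    show "(\<lambda>x. (u x * f x)\<^sup>2) \<in> borel_measurable lborel" by simp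
    show "AE x in lborel. norm ((u x * f x)\<^sup>2) \<le> norm (B\<^sup>2 * (f x)\<^sup>2)"
    proof (intro always_eventually allI)
      fix x
      show "norm ((u x * f x)\<^sup>2) \<le> norm (B\<^sup>2 * (f x)\<^sup>2)"
      proof (cases "x \<in> {a..b}")
        case True
        then have "(u x)\<^sup>2 \<le> B\<^sup>2" using B[of x] by (metis abs_ge_zero power2_abs power_mono)
        then show ?thesis by (simp add: power_mult_distrib mult_right_mono)
      qed (use sqint_outside[OF f] in auto)
    qed
  qed
  then show ?thesis using f by (auto simp: sqint_def)
qed

lemma sqint_scale: "sqint a b f \<Longrightarrow> sqint a b (\<lambda>x. c * f x)"
  by (rule sqint_mult_bounded[of _ _ _ _ "\<bar>c\<bar>"]) auto

lemma sqint_diff: "sqint a b f \<Longrightarrow> sqint a b g \<Longrightarrow> sqint a b (\<lambda>x. f x - g x)"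
  using sqint_add[of a b f "\<lambda>x. (-1) * g x"] sqint_scale[of a b g "-1"] by simp

lemma sqint_restr:
  assumes u: "continuous_on {a..b} u"
  shows "sqint a b (restr a b u)"
proof -
  have "(\<lambda>x. (restr a b u x)\<^sup>2) = restr a b (\<lambda>x. (u x)\<^sup>2)"
    by (auto simp: restr_def fun_eq_iff indicator_def)
  then show ?thesis
    using restr_integrable[of a b "\<lambda>x. (u x)\<^sup>2"] restr_measurable[OF u] u
    by (auto simp: sqint_def restr_simps continuous_on_power)
qed

lemma sqint_mult_restr:
  assumes f: "sqint a b f" and u: "continuous_on {a..b} u"
  shows "sqint a b (\<lambda>x. restr a b u x * f x)"
proof -
  obtain B where "\<And>x. x \<in> {a..b} \<Longrightarrow> \<bar>u x\<bar> \<le> B"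
    using continuous_on_interval_bounded[OF u] by blast
  then show ?thesis
    using f restr_measurable[OF u] by (intro sqint_mult_bounded[of _ _ _ _ B]) (auto simp: restr_simps)
qed

lemma sqint_integrable:
  assumes f: "sqint a b f"
  shows "integrable lborel f"
proof -
  have "integrable lborel (\<lambda>x. f x * restr a b (\<lambda>_. 1) x)"
    by (rule sqint_integrable_mult[OF f sqint_restr]) simp
  also have "(\<lambda>x. f x * restr a b (\<lambda>_. 1) x) = f"
    using sqint_outside[OF f] by (auto simp: restr_def fun_eq_iff indicator_def)
  finally show ?thesis .
qed

lemma sqint_L2: "sqint a b f \<Longrightarrow> abs_L0 f \<in> L2 a b"
proof -
  assume f: "sqint a b f"
  have one: "restr a b (\<lambda>_. 1) \<in> borel_measurable borel" by (intro restr_measurable) simp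
  have "(\<lambda>x. f x * restr a b (\<lambda>_. 1) x) = f"
    using sqint_outside[OF f] by (auto simp: restr_def fun_eq_iff indicator_def)
  moreover have "integrable lborel (\<lambda>x. f x * f x)"
    using f by (intro sqint_integrable_mult)
  ultimately show ?thesis
    using one sqint_measurable[OF f]
    by (simp add: L2_def restr_class_eq abs_L0_ops abs_L0_unary)
qed

lemma L2_cases:
  assumes "f \<in> L2 a b"
  obtains f0 where "sqint a b f0" "f = abs_L0 f0"
proof -
  obtain g where g: "g \<in> borel_measurable borel" "f = abs_L0 g" by (rule L0_cases)
  have one: "restr a b (\<lambda>_. 1) \<in> borel_measurable borel" by (intro restr_measurable) simp
  \<comment> \<open>An arbitrary representative is cut off outside the interval; the first condition
    in \<open>L2\<close> says that this does not change the class.\<close>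
  define f0 where "f0 x = g x * restr a b (\<lambda>_. 1) x" for x
  have m: "f0 \<in> borel_measurable borel" using g one by (simp add: f0_def[abs_def])
  have f: "f = abs_L0 f0"
    using assms g one by (simp add: L2_def restr_class_eq abs_L0_ops f0_def[abs_def])
  have "integrable lborel (\<lambda>x. f0 x * f0 x)"
    using assms m unfolding f L2_def by (simp add: abs_L0_ops abs_L0_unary)
  then have "sqint a b f0"
    using m by (auto simp: sqint_def f0_def restr_def power2_eq_square)
  then show ?thesis using that f by blast
qed

lemma restr_class_L2: "continuous_on {a..b} u \<Longrightarrow> restr_class a b u \<in> L2 a b"
  by (simp add: restr_class_eq sqint_L2 sqint_restr)

lemma restr_class_mult_L2:
  assumes "continuous_on {a..b} u" "f \<in> L2 a b"
  shows "restr_class a b u * f \<in> L2 a b"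
proof -
  obtain f0 where f0: "sqint a b f0" "f = abs_L0 f0" using L2_cases assms by blast
  then show ?thesis
    using sqint_L2[OF sqint_mult_restr[OF f0(1) assms(1)]] restr_measurable[OF assms(1)]
    by (simp add: restr_class_eq abs_L0_ops sqint_measurable)
qed

lemma L2_integrable_mult:
  assumes "f \<in> L2 a b" "g \<in> L2 a b"
  shows "L0_integrable (f * g)"
proof -
  obtain f0 g0 where "sqint a b f0" "f = abs_L0 f0" "sqint a b g0" "g = abs_L0 g0"
    using L2_cases assms by metis
  then show ?thesis
    using sqint_integrable_mult[of a b f0 g0]
    by (simp add: abs_L0_ops abs_L0_unary sqint_measurable)
qed

lemma L0_integral_linear:
  assumes "L0_integrable f" "L0_integrable g"
  shows "L0_integral (f + g) = L0_integral f + L0_integral g" "L0_integrable (f + g)"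
    and "L0_integral (c *\<^sub>R f) = c * L0_integral f" "L0_integrable (c *\<^sub>R f)"
proof -
  obtain f0 g0 where "f0 \<in> borel_measurable borel" "f = abs_L0 f0"
      "g0 \<in> borel_measurable borel" "g = abs_L0 g0"
    using L0_cases by metis
  then show "L0_integral (f + g) = L0_integral f + L0_integral g" "L0_integrable (f + g)"
    and "L0_integral (c *\<^sub>R f) = c * L0_integral f" "L0_integrable (c *\<^sub>R f)"
    using assms by (simp_all add: abs_L0_ops abs_L0_unary)
qed

lemma subspace_L2: "subspace (L2 a b)"
proof (rule subspaceI)
  show "0 \<in> L2 a b"
    unfolding zero_L0_eq by (rule sqint_L2) (simp add: sqint_def)
next
  fix f g assume "f \<in> L2 a b" "g \<in> L2 a b"
  then obtain f0 g0 where "sqint a b f0" "f = abs_L0 f0" "sqint a b g0" "g = abs_L0 g0"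
    using L2_cases by metis
  then show "f + g \<in> L2 a b"
    using sqint_L2[OF sqint_add[of a b f0 g0]] by (simp add: abs_L0_ops sqint_measurable)
next
  fix c f assume "f \<in> L2 a b"
  then obtain f0 where "sqint a b f0" "f = abs_L0 f0" using L2_cases by metis
  then show "c *\<^sub>R f \<in> L2 a b"
    using sqint_L2[OF sqint_scale[of a b f0 c]] by (simp add: abs_L0_unary sqint_measurable)
qed

lemma ip_weighted_abs:
  assumes "sqint a b f" "sqint a b g" "continuous_on {a..b} \<rho>"
  shows "ip_weighted a b \<rho> (abs_L0 f) (abs_L0 g) = (\<integral>x. f x * g x * restr a b \<rho> x \<partial>lborel)"
  using assms(1,2)[THEN sqint_measurable] restr_measurable[OF assms(3)]
  by (simp add: ip_weighted_def restr_class_eq abs_L0_ops abs_L0_unary)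

lemma sqint_integrable_weighted:
  assumes "sqint a b f" "sqint a b g" "continuous_on {a..b} \<rho>"
  shows "integrable lborel (\<lambda>x. f x * g x * restr a b \<rho> x)"
  using sqint_integrable_mult[OF assms(1) sqint_mult_restr[OF assms(2,3)]]
  by (simp add: mult_ac)

section \<open>Weighted inner products and completeness\<close>

lemma inner_product_L2:
  assumes \<rho>: "continuous_on {a..b} \<rho>" and pos: "\<And>x. x \<in> {a..b} \<Longrightarrow> \<rho> x > 0"
  shows "inner_product_on (L2 a b) (ip_weighted a b \<rho>)"
  unfolding inner_product_on_def
proof (intro conjI ballI allI impI)
  fix f g assume fg: "f \<in> L2 a b" "g \<in> L2 a b"
  show "ip_weighted a b \<rho> f g = ip_weighted a b \<rho> g f"
    by (simp add: ip_weighted_def mult.commute[of f g])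
  have "L0_integrable (f * g * restr_class a b \<rho>)"
    using L2_integrable_mult[OF fg(1) restr_class_mult_L2[OF \<rho> fg(2)]] by (simp add: mult_ac)
  then show "ip_weighted a b \<rho> (c *\<^sub>R f) g = c * ip_weighted a b \<rho> f g" for c
    by (simp add: ip_weighted_def L0_integral_linear(3))
next
  fix f g h assume fgh: "f \<in> L2 a b" "g \<in> L2 a b" "h \<in> L2 a b"
  have "L0_integrable (f * h * restr_class a b \<rho>)" "L0_integrable (g * h * restr_class a b \<rho>)"
    using L2_integrable_mult[OF fgh(1) restr_class_mult_L2[OF \<rho> fgh(3)]]
      L2_integrable_mult[OF fgh(2) restr_class_mult_L2[OF \<rho> fgh(3)]] by (simp_all add: mult_ac)
  then show "ip_weighted a b \<rho> (f + g) h = ip_weighted a b \<rho> f h + ip_weighted a b \<rho> g h"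
    by (simp add: ip_weighted_def distrib_right L0_integral_linear(1))
next
  fix f assume f: "f \<in> L2 a b" "f \<noteq> 0"
  obtain f0 where f0: "sqint a b f0" "f = abs_L0 f0" using L2_cases f by blast
  let ?u = "\<lambda>x. f0 x * f0 x * restr a b \<rho> x"
  have int: "integrable lborel ?u" by (rule sqint_integrable_weighted[OF f0(1) f0(1) \<rho>])
  have nn: "0 \<le> ?u x" for x
    using pos[of x] by (cases "x \<in> {a..b}") (auto simp: restr_simps intro!: mult_nonneg_nonneg less_imp_le)
  have "integral\<^sup>L lborel ?u \<noteq> 0"
  proof
    assume "integral\<^sup>L lborel ?u = 0"
    then have "AE x in lborel. ?u x = 0"
      using integral_nonneg_eq_0_iff_AE[OF int] nn by simp
    then have "AE x in lborel. f0 x = 0"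
    proof eventually_elim
      case (elim x)
      then show ?case using pos[of x] sqint_outside[OF f0(1), of x]
        by (cases "x \<in> {a..b}") (auto simp: restr_simps)
    qed
    then have "f = 0"
      unfolding f0(2) zero_L0_eq using sqint_measurable[OF f0(1)] by (subst abs_L0_eq_iff) auto
    then show False using f by simp
  qed
  moreover have "0 \<le> integral\<^sup>L lborel ?u" using nn by simp
  ultimately show "ip_weighted a b \<rho> f f > 0"
    by (simp add: f0 ip_weighted_abs[OF f0(1) f0(1) \<rho>])
qed

text \<open>The quotient of the two weights is continuous on a compact interval, hence bounded. The
  auxiliary statement is applied with \<rho> and 1 in either order; it allows all later estimates
  and the completeness proof to be carried out with weight 1.\<close>

lemma ip_weighted_bounds:
  assumes \<rho>: "continuous_on {a..b} \<rho>" and pos: "\<And>x. x \<in> {a..b} \<Longrightarrow> \<rho> x > 0"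
  obtains m M where "m > 0" "M > 0"
    "\<And>f. f \<in> L2 a b \<Longrightarrow> ip_norm (ip_weighted a b (\<lambda>_. 1)) f \<le> m * ip_norm (ip_weighted a b \<rho>) f"
    "\<And>f. f \<in> L2 a b \<Longrightarrow> ip_norm (ip_weighted a b \<rho>) f \<le> M * ip_norm (ip_weighted a b (\<lambda>_. 1)) f"
proof -
  have *: "\<exists>C>0. \<forall>f\<in>L2 a b. ip_norm (ip_weighted a b u) f \<le> C * ip_norm (ip_weighted a b v) f"
    if u: "continuous_on {a..b} u" and v: "continuous_on {a..b} v"
      and pos: "\<And>x. x \<in> {a..b} \<Longrightarrow> v x > 0" for u v :: "real \<Rightarrow> real"
  proof -
    have "continuous_on {a..b} (\<lambda>x. u x / v x)"
      using u v pos by (intro continuous_intros) force+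
    then obtain B where B: "B > 0" "\<And>x. x \<in> {a..b} \<Longrightarrow> \<bar>u x / v x\<bar> \<le> B"
      using continuous_on_interval_bounded by blast
    have le: "u x \<le> B * v x" if "x \<in> {a..b}" for x
      using B(2)[OF that] pos[OF that] by (simp add: field_simps abs_if split: if_splits)
    have "ip_norm (ip_weighted a b u) f \<le> sqrt B * ip_norm (ip_weighted a b v) f" if "f \<in> L2 a b" for f
    proof -
      obtain f0 where f0: "sqint a b f0" "f = abs_L0 f0" using L2_cases \<open>f \<in> L2 a b\<close> by blast
      have "(\<integral>x. f0 x * f0 x * restr a b u x \<partial>lborel) \<le> (\<integral>x. B * (f0 x * f0 x * restr a b v x) \<partial>lborel)"
      proof (rule integral_mono)
        show "integrable lborel (\<lambda>x. f0 x * f0 x * restr a b u x)"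
          by (rule sqint_integrable_weighted[OF f0(1) f0(1) u])
        show "integrable lborel (\<lambda>x. B * (f0 x * f0 x * restr a b v x))"
          by (intro Bochner_Integration.integrable_mult_right sqint_integrable_weighted[OF f0(1) f0(1) v])
        fix x
        show "f0 x * f0 x * restr a b u x \<le> B * (f0 x * f0 x * restr a b v x)"
          using mult_left_mono[OF le[of x], of "f0 x * f0 x"]
          by (cases "x \<in> {a..b}") (auto simp: restr_simps mult_ac)
      qed
      then have "ip_weighted a b u f f \<le> B * ip_weighted a b v f f"
        by (simp add: f0 ip_weighted_abs u v)
      then show ?thesis
        by (simp add: ip_norm_def real_sqrt_mult[symmetric])
    qed
    then show ?thesis using B(1) by (intro exI[of _ "sqrt B"]) auto
  qed
  obtain m where "m > 0" "\<forall>f\<in>L2 a b. ip_norm (ip_weighted a b (\<lambda>_. 1)) f \<le> m * ip_norm (ip_weighted a b \<rho>) f"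
    using *[of "\<lambda>_. 1" \<rho>] \<rho> pos by auto
  moreover obtain M where "M > 0" "\<forall>f\<in>L2 a b. ip_norm (ip_weighted a b \<rho>) f \<le> M * ip_norm (ip_weighted a b (\<lambda>_. 1)) f"
    using *[of \<rho> "\<lambda>_. 1"] \<rho> pos by auto
  ultimately show ?thesis using that by blast
qed

abbreviation ip1 :: "real \<Rightarrow> real \<Rightarrow> L0 \<Rightarrow> L0 \<Rightarrow> real" where
  "ip1 a b \<equiv> ip_weighted a b (\<lambda>_. 1)"

lemma ip_space_L2:
  assumes "continuous_on {a..b} \<rho>" "\<And>x. x \<in> {a..b} \<Longrightarrow> \<rho> x > 0"
  shows "ip_space (L2 a b) (ip_weighted a b \<rho>)"
  by unfold_locales (auto intro: subspace_L2 inner_product_L2 assms)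

lemma ip_space_L2_1: "ip_space (L2 a b) (ip1 a b)"
  by (rule ip_space_L2) auto

lemma ip1_abs:
  assumes f: "sqint a b f" and g: "sqint a b g"
  shows "ip1 a b (abs_L0 f) (abs_L0 g) = (\<integral>x. f x * g x \<partial>lborel)"
proof -
  have "(\<lambda>x. f x * g x * restr a b (\<lambda>_. 1) x) = (\<lambda>x. f x * g x)"
    using sqint_outside[OF f] by (auto simp: restr_def fun_eq_iff indicator_def)
  then show ?thesis using ip_weighted_abs[OF f g, of "\<lambda>_. 1"] by simp
qed

text \<open>Cauchy-Schwarz against the constant 1. It turns an L^2 Cauchy sequence into an L^1
  Cauchy sequence, for which a subsequence converges almost everywhere.\<close>

lemma sqint_L1_bound:
  assumes ab: "a \<le> b" and f: "sqint a b f"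
  shows "(\<integral>x. \<bar>f x\<bar> \<partial>lborel) \<le> sqrt (b - a) * sqrt (\<integral>x. (f x)\<^sup>2 \<partial>lborel)"
proof -
  interpret ip_space "L2 a b" "ip1 a b" by (rule ip_space_L2_1)
  let ?one = "restr a b (\<lambda>_. 1)"
  have one: "sqint a b ?one" by (rule sqint_restr) simp
  have af: "sqint a b (\<lambda>x. \<bar>f x\<bar>)" using f by (auto simp: sqint_def)
  have "(\<lambda>x. \<bar>f x\<bar> * ?one x) = (\<lambda>x. \<bar>f x\<bar>)"
    using sqint_outside[OF f] by (auto simp: restr_def fun_eq_iff indicator_def)
  moreover have "(\<lambda>x. ?one x * ?one x) = indicator {a..b}"
    by (auto simp: restr_def fun_eq_iff indicator_def)
  ultimately show ?thesis
    using Cauchy_Schwarz[OF sqint_L2[OF af] sqint_L2[OF one]] ab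
    by (simp add: ip_norm_def ip1_abs af one power2_eq_square mult.commute)
qed

text \<open>A subsequence converges almost everywhere, and Fatou's lemma along it bounds the L^2
  distance between the pointwise limit and any late member of the full sequence.\<close>

lemma L2_complete_unweighted:
  assumes ab: "a \<le> b" and s: "\<And>n. s n \<in> L2 a b" and Cauchy: "ip_Cauchy (ip1 a b) s"
  obtains f where "f \<in> L2 a b" "ip_tendsto (ip1 a b) s f"
proof -
  interpret ip_space "L2 a b" "ip1 a b" by (rule ip_space_L2_1)
  have "\<forall>n. \<exists>f0. sqint a b f0 \<and> s n = abs_L0 f0" using s L2_cases by metis
  then obtain t where t: "\<And>n. sqint a b (t n)" and st: "\<And>n. s n = abs_L0 (t n)" by metis
  note tm[measurable] = t[THEN sqint_measurable]
  have td: "sqint a b (\<lambda>x. t m x - t n x)" for m n using t by (intro sqint_diff)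
  have norm_diff: "ip_norm (ip1 a b) (s m - s n) = sqrt (\<integral>x. (t m x - t n x)\<^sup>2 \<partial>lborel)" for m n
    using td[of m n] by (simp add: ip_norm_def st abs_L0_ops tm ip1_abs power2_eq_square)
  obtain r where r: "strict_mono r" and "AE x in lborel. Cauchy (\<lambda>i. t (r i) x)"
  proof (rule cauchy_L1_AE_cauchy_subseq[of lborel t])
    show "integrable lborel (t n)" for n by (rule sqint_integrable[OF t])
    fix e :: real assume e: "0 < e"
    \<comment> \<open>The summand 1 keeps the divisor positive when a = b.\<close>
    define c where "c = sqrt (b - a) + 1"
    have c: "c > 0" "sqrt (b - a) \<le> c" using ab by (auto simp: c_def add_nonneg_pos)
    obtain N where N: "\<And>m n. m \<ge> N \<Longrightarrow> n \<ge> N \<Longrightarrow> ip_norm (ip1 a b) (s m - s n) < e / c"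
      using Cauchy e c unfolding ip_Cauchy_def by (meson divide_pos_pos)
    have "(\<integral>x. norm (t m x - t n x) \<partial>lborel) < e" if "m \<ge> N" "n \<ge> N" for m n
    proof -
      have "(\<integral>x. norm (t m x - t n x) \<partial>lborel) \<le> sqrt (b - a) * ip_norm (ip1 a b) (s m - s n)"
        using sqint_L1_bound[OF ab td[of m n]] by (simp add: norm_diff)
      also have "\<dots> \<le> c * ip_norm (ip1 a b) (s m - s n)"
        using c by (intro mult_right_mono) (auto simp: norm_diff)
      also have "\<dots> < e" using N[OF that] c by (simp add: field_simps)
      finally show ?thesis .
    qed
    then show "\<exists>N. \<forall>i\<ge>N. \<forall>j\<ge>N. (\<integral>x. norm (t i x - t j x) \<partial>lborel) < e" by blast
  qed blast
  define f where "f x = (if x \<in> {a..b} then lim (\<lambda>i. t (r i) x) else 0)" for x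
  have fm[measurable]: "f \<in> borel_measurable borel" unfolding f_def by measurable
  have lim: "AE x in lborel. (\<lambda>i. t (r i) x) \<longlonglongrightarrow> f x"
    using \<open>AE x in lborel. Cauchy (\<lambda>i. t (r i) x)\<close>
  proof eventually_elim
    case (elim x)
    then have "convergent (\<lambda>i. t (r i) x)" by (rule Cauchy_convergent)
    moreover have "t n x = 0" if "x \<notin> {a..b}" for n using sqint_outside[OF t that] .
    ultimately show ?case by (auto simp: f_def convergent_LIMSEQ_iff)
  qed
  \<comment> \<open>The Cauchy estimate between two members is passed to the limit in one of them;
    integrability of the difference comes out together with the bound.\<close>
  have bound: "sqint a b (\<lambda>x. f x - t n x) \<and> sqrt (\<integral>x. (f x - t n x)\<^sup>2 \<partial>lborel) \<le> e"
    if e: "e > 0" and N: "\<And>m n. m \<ge> N \<Longrightarrow> n \<ge> N \<Longrightarrow> ip_norm (ip1 a b) (s m - s n) < e" and n: "n \<ge> N"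
    for e N n
  proof -
    have le: "(\<integral>\<^sup>+x. ennreal ((t m x - t n x)\<^sup>2) \<partial>lborel) \<le> ennreal (e\<^sup>2)" if "m \<ge> N" for m
    proof -
      have "sqrt (\<integral>x. (t m x - t n x)\<^sup>2 \<partial>lborel) \<le> e" using N[OF that n] by (simp add: norm_diff)
      then have "(\<integral>x. (t m x - t n x)\<^sup>2 \<partial>lborel) \<le> e\<^sup>2" by (rule sqrt_le_D)
      moreover have "(\<integral>\<^sup>+x. ennreal ((t m x - t n x)\<^sup>2) \<partial>lborel) = ennreal (\<integral>x. (t m x - t n x)\<^sup>2 \<partial>lborel)"
        by (intro nn_integral_eq_integral sqint_integrable_square[OF td]) simp
      ultimately show ?thesis by (simp add: ennreal_leI)
    qed
    have "(\<integral>\<^sup>+x. ennreal ((f x - t n x)\<^sup>2) \<partial>lborel)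
        = (\<integral>\<^sup>+x. liminf (\<lambda>i. ennreal ((t (r i) x - t n x)\<^sup>2)) \<partial>lborel)"
    proof (rule nn_integral_cong_AE)
      show "AE x in lborel. ennreal ((f x - t n x)\<^sup>2) = liminf (\<lambda>i. ennreal ((t (r i) x - t n x)\<^sup>2))"
        using lim
      proof eventually_elim
        case (elim x)
        then have "(\<lambda>i. ennreal ((t (r i) x - t n x)\<^sup>2)) \<longlonglongrightarrow> ennreal ((f x - t n x)\<^sup>2)"
          by (intro tendsto_ennrealI tendsto_intros)
        then show ?case by (rule lim_imp_Liminf[OF sequentially_bot, symmetric])
      qed
    qed
    also have "\<dots> \<le> liminf (\<lambda>i. \<integral>\<^sup>+x. ennreal ((t (r i) x - t n x)\<^sup>2) \<partial>lborel)"
      by (rule nn_integral_liminf) simp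
    also have "\<dots> \<le> ennreal (e\<^sup>2)"
    proof (rule Liminf_le[OF sequentially_bot], rule eventually_sequentiallyI[of N])
      fix i assume "N \<le> i"
      then have "r i \<ge> N" using seq_suble[OF r, of i] by simp
      then show "(\<integral>\<^sup>+x. ennreal ((t (r i) x - t n x)\<^sup>2) \<partial>lborel) \<le> ennreal (e\<^sup>2)" by (rule le)
    qed
    finally have nn: "(\<integral>\<^sup>+x. ennreal ((f x - t n x)\<^sup>2) \<partial>lborel) \<le> ennreal (e\<^sup>2)" .
    have int: "integrable lborel (\<lambda>x. (f x - t n x)\<^sup>2)"
      by (rule integrableI_bounded) (use nn in \<open>auto simp: le_less_trans\<close>)
    have "ennreal (\<integral>x. (f x - t n x)\<^sup>2 \<partial>lborel) \<le> ennreal (e\<^sup>2)"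
      using nn nn_integral_eq_integral[OF int] by simp
    then have "(\<integral>x. (f x - t n x)\<^sup>2 \<partial>lborel) \<le> e\<^sup>2" by simp
    then have "sqrt (\<integral>x. (f x - t n x)\<^sup>2 \<partial>lborel) \<le> e" using e by (intro real_le_lsqrt) auto
    moreover have "sqint a b (\<lambda>x. f x - t n x)"
      using int sqint_outside[OF t] by (auto simp: sqint_def f_def)
    ultimately show ?thesis by blast
  qed
  obtain N where N: "\<And>m n. m \<ge> N \<Longrightarrow> n \<ge> N \<Longrightarrow> ip_norm (ip1 a b) (s m - s n) < 1"
    using Cauchy unfolding ip_Cauchy_def by (meson zero_less_one)
  \<comment> \<open>Writing \<open>f\<close> as \<open>(f - t N) + t N\<close> for one late index
    \<open>N\<close> shows that it is square integrable.\<close>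
  have f: "sqint a b f"
    using sqint_add[OF bound[THEN conjunct1, of 1 N N] t[of N]] N by simp
  have "ip_tendsto (ip1 a b) s (abs_L0 f)"
    unfolding ip_tendsto_def
  proof (rule LIMSEQ_I)
    fix e :: real assume e: "0 < e"
    \<comment> \<open>Half of \<open>e\<close>, because \<open>bound\<close> yields only a weak
      inequality.\<close>
    then obtain N where N: "\<And>m n. m \<ge> N \<Longrightarrow> n \<ge> N \<Longrightarrow> ip_norm (ip1 a b) (s m - s n) < e / 2"
      using Cauchy unfolding ip_Cauchy_def by (meson half_gt_zero)
    have "norm (ip_norm (ip1 a b) (s n - abs_L0 f) - 0) < e" if n: "n \<ge> N" for n
    proof -
      have *: "sqint a b (\<lambda>x. f x - t n x)" "sqrt (\<integral>x. (f x - t n x)\<^sup>2 \<partial>lborel) \<le> e / 2"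
        using bound[of "e / 2" N n] N e n by auto
      have "ip_norm (ip1 a b) (abs_L0 f - s n) = sqrt (\<integral>x. (f x - t n x)\<^sup>2 \<partial>lborel)"
        using *(1) by (simp add: ip_norm_def st abs_L0_ops tm fm ip1_abs power2_eq_square)
      then have "ip_norm (ip1 a b) (s n - abs_L0 f) \<le> e / 2"
        using * s[of n] sqint_L2[OF f] by (simp add: ip_norm_commute)
      moreover have "0 \<le> ip_norm (ip1 a b) (s n - abs_L0 f)"
        using s[of n] sqint_L2[OF f] by (intro ip_norm_nonneg V_closed)
      ultimately show ?thesis using e by simp
    qed
    then show "\<exists>N. \<forall>n\<ge>N. norm (ip_norm (ip1 a b) (s n - abs_L0 f) - 0) < e" by blast
  qed
  then show ?thesis using that sqint_L2[OF f] by blast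
qed

lemma ip_tendsto_bound:
  assumes "ip_tendsto ip s f" "\<And>n. ip_norm ip' (s n - f) \<le> C * ip_norm ip (s n - f)"
    "\<And>n. 0 \<le> ip_norm ip' (s n - f)"
  shows "ip_tendsto ip' s f"
proof -
  have "(\<lambda>n. C * ip_norm ip (s n - f)) \<longlonglongrightarrow> C * 0"
    using assms(1) unfolding ip_tendsto_def by (intro tendsto_intros)
  then have lim: "(\<lambda>n. C * ip_norm ip (s n - f)) \<longlonglongrightarrow> 0" by simp
  show ?thesis
    unfolding ip_tendsto_def
    by (rule Lim_null_comparison[OF _ lim]) (use assms in \<open>auto intro!: always_eventually\<close>)
qed

lemma hilbert_space_L2:
  assumes ab: "a \<le> b" and \<rho>: "continuous_on {a..b} \<rho>" and pos: "\<And>x. x \<in> {a..b} \<Longrightarrow> \<rho> x > 0"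
  shows "hilbert_space_on (L2 a b) (ip_weighted a b \<rho>)"
  unfolding hilbert_space_on_def
proof (intro conjI allI impI subspace_L2 inner_product_L2 \<rho> pos)
  fix s assume s: "(\<forall>n. s n \<in> L2 a b) \<and> ip_Cauchy (ip_weighted a b \<rho>) s"
  interpret ip_space "L2 a b" "ip_weighted a b \<rho>" using \<rho> pos by (rule ip_space_L2)
  obtain m M where mM: "m > 0" "M > 0"
    "\<And>f. f \<in> L2 a b \<Longrightarrow> ip_norm (ip1 a b) f \<le> m * ip_norm (ip_weighted a b \<rho>) f"
    "\<And>f. f \<in> L2 a b \<Longrightarrow> ip_norm (ip_weighted a b \<rho>) f \<le> M * ip_norm (ip1 a b) f"
    using ip_weighted_bounds[OF \<rho> pos] by blast
  have "ip_Cauchy (ip1 a b) s"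
    unfolding ip_Cauchy_def
  proof (intro allI impI)
    fix e :: real assume "e > 0"
    then obtain N where N: "\<And>i j. i \<ge> N \<Longrightarrow> j \<ge> N \<Longrightarrow> ip_norm (ip_weighted a b \<rho>) (s i - s j) < e / m"
      using s mM(1) unfolding ip_Cauchy_def by (meson divide_pos_pos)
    have "ip_norm (ip1 a b) (s i - s j) < e" if "i \<ge> N" "j \<ge> N" for i j
      using mM(3)[of "s i - s j"] N[OF that] s mM(1) by (simp add: V_closed field_simps)
    then show "\<exists>N. \<forall>i\<ge>N. \<forall>j\<ge>N. ip_norm (ip1 a b) (s i - s j) < e" by blast
  qed
  then obtain f where f: "f \<in> L2 a b" "ip_tendsto (ip1 a b) s f"
    using L2_complete_unweighted[OF ab] s by blast
  have "ip_tendsto (ip_weighted a b \<rho>) s f"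
    by (rule ip_tendsto_bound[OF f(2) mM(4)]) (use s f in \<open>auto intro!: V_closed ip_norm_nonneg\<close>)
  then show "\<exists>f\<in>L2 a b. ip_tendsto (ip_weighted a b \<rho>) s f" using f(1) by blast
qed


section \<open>Weak derivatives on an interval\<close>

text \<open>The positive and the negative part of \<open>h\<close> are densities of two measures
  that are finite and equal on all half-lines, hence equal. Uniqueness of densities makes the two
  parts agree almost everywhere, which is possible only where \<open>h\<close> is 0.\<close>

lemma AE_eq_0_of_interval_integrals:
  fixes h :: "real \<Rightarrow> real"
  assumes int: "integrable lborel h" and zero: "\<And>x. (\<integral>t. indicator {x<..} t * h t \<partial>lborel) = 0"
  shows "AE x in lborel. h x = 0"
proof -
  have [measurable]: "h \<in> borel_measurable borel" using int by simp
  let ?M = "\<lambda>u. density lborel (\<lambda>x. ennreal (u x))"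
  have em: "emeasure (?M (\<lambda>x. max 0 (u x))) {x<..} = ennreal (\<integral>t. indicator {x<..} t * max 0 (u t) \<partial>lborel)"
    if u: "integrable lborel u" for u :: "real \<Rightarrow> real" and x
  proof -
    have [measurable]: "u \<in> borel_measurable borel" using u by simp
    have "integrable lborel (\<lambda>t. max 0 (u t))" using u by simp
    from integrable_mult_indicator[OF _ this, of "{x<..}"]
    have i: "integrable lborel (\<lambda>t. indicator {x<..} t * max 0 (u t))" by simp
    have "emeasure (?M (\<lambda>x. max 0 (u x))) {x<..} = (\<integral>\<^sup>+t. ennreal (max 0 (u t)) * indicator {x<..} t \<partial>lborel)"
      by (subst emeasure_density) auto
    also have "\<dots> = (\<integral>\<^sup>+t. ennreal (indicator {x<..} t * max 0 (u t)) \<partial>lborel)"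
      by (intro nn_integral_cong) (auto simp: indicator_def)
    also have "\<dots> = ennreal (\<integral>t. indicator {x<..} t * max 0 (u t) \<partial>lborel)"
      using i by (rule nn_integral_eq_integral) auto
    finally show ?thesis .
  qed
  have em1: "emeasure (?M (\<lambda>x. max 0 (h x))) {x<..} = ennreal (\<integral>t. indicator {x<..} t * max 0 (h t) \<partial>lborel)"
    and em2: "emeasure (?M (\<lambda>x. max 0 (- h x))) {x<..} = ennreal (\<integral>t. indicator {x<..} t * max 0 (- h t) \<partial>lborel)" for x
    using em[of h x] em[of "\<lambda>x. - h x" x] int by auto
  have "?M (\<lambda>x. max 0 (h x)) = ?M (\<lambda>x. max 0 (- h x))"
  proof (rule measure_eqI_lessThan)
    fix x
    show "emeasure (?M (\<lambda>x. max 0 (h x))) {x<..} < \<infinity>" by (simp add: em1)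
    have i: "integrable lborel (\<lambda>t. indicator {x<..} t * max 0 (h t))"
      "integrable lborel (\<lambda>t. indicator {x<..} t * max 0 (- h t))"
      using integrable_mult_indicator[of "{x<..}" lborel "\<lambda>t. max 0 (h t)"]
        integrable_mult_indicator[of "{x<..}" lborel "\<lambda>t. max 0 (- h t)"] int by auto
    have "(\<integral>t. indicator {x<..} t * max 0 (h t) \<partial>lborel) - (\<integral>t. indicator {x<..} t * max 0 (- h t) \<partial>lborel)
        = (\<integral>t. indicator {x<..} t * h t \<partial>lborel)"
      by (subst Bochner_Integration.integral_diff[OF i, symmetric])
        (auto intro!: Bochner_Integration.integral_cong simp: indicator_def max_def)
    then show "emeasure (?M (\<lambda>x. max 0 (h x))) {x<..} = emeasure (?M (\<lambda>x. max 0 (- h x))) {x<..}"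
      using zero[of x] by (simp add: em1 em2)
  qed auto
  then have "AE x in lborel. ennreal (max 0 (h x)) = ennreal (max 0 (- h x))"
    by (subst (asm) sigma_finite_measure.density_unique_iff[OF sigma_finite_lborel]) auto
  then show ?thesis
    by eventually_elim (auto simp: max_def split: if_splits)
qed

section \<open>Primitives of integrable functions and integration by parts\<close>

definition prim :: "real \<Rightarrow> (real \<Rightarrow> real) \<Rightarrow> real \<Rightarrow> real" where
  "prim a g x = (\<integral>t. indicator {a..x} t * g t \<partial>lborel)"

lemma integrable_indicator_mult:
  fixes g :: "real \<Rightarrow> real"
  shows "integrable lborel g \<Longrightarrow> A \<in> sets borel \<Longrightarrow> integrable lborel (\<lambda>t. indicator A t * g t)"
  using integrable_mult_indicator[of A lborel g] by simp

lemma continuous_on_prim: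
  assumes g: "integrable lborel g"
  shows "continuous_on {a..b} (prim a g)"
proof -
  have s: "set_integrable lborel {a..x} g" for x
    using integrable_indicator_mult[OF g, of "{a..x}"] by (simp add: set_integrable_def)
  have "prim a g x = integral {a..x} g" for x
    using set_borel_integral_eq_integral(2)[OF s[of x]]
    by (simp add: prim_def set_lebesgue_integral_def)
  then show ?thesis
    using indefinite_integral_continuous_1[OF set_borel_integral_eq_integral(1)[OF s]]
    by (simp cong: continuous_on_cong)
qed

lemma prim_start: "prim a g a = 0"
  unfolding prim_def
  by (rule integral_eq_zero_AE) (use AE_lborel_singleton[of a] in \<open>auto elim!: eventually_mono\<close>)

lemma prim_diff:
  assumes g: "integrable lborel g" and "a \<le> s" "s \<le> x"
  shows "(\<integral>t. indicator {s<..<x} t * g t \<partial>lborel) = prim a g x - prim a g s"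
proof -
  have [measurable]: "g \<in> borel_measurable borel" using g by simp
  have "prim a g x - prim a g s = (\<integral>t. indicator {a..x} t * g t - indicator {a..s} t * g t \<partial>lborel)"
    unfolding prim_def using g by (subst Bochner_Integration.integral_diff) (auto intro!: integrable_indicator_mult)
  also have "\<dots> = (\<integral>t. indicator {s<..<x} t * g t \<partial>lborel)"
  proof (rule integral_cong_AE)
    show "AE t in lborel. indicator {a..x} t * g t - indicator {a..s} t * g t = indicator {s<..<x} t * g t"
      using AE_lborel_singleton[of x]
      by eventually_elim (use assms in \<open>auto simp: indicator_def\<close>)
  qed auto
  finally show ?thesis by simp
qed

lemma prim_total:
  assumes "\<And>x. x \<notin> {a..b} \<Longrightarrow> g x = 0"
  shows "prim a g b = (\<integral>t. g t \<partial>lborel)"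
  unfolding prim_def using assms
  by (intro Bochner_Integration.integral_cong) (auto simp: indicator_def)

lemma AE_eq_0_of_prim:
  assumes ab: "a \<le> b" and g: "integrable lborel g" and out: "\<And>x. x \<notin> {a..b} \<Longrightarrow> g x = 0"
    and zero: "\<And>x. x \<in> {a..b} \<Longrightarrow> prim a g x = 0"
  shows "AE x in lborel. g x = 0"
proof (rule AE_eq_0_of_interval_integrals[OF g])
  fix x
  have tot: "(\<integral>t. g t \<partial>lborel) = 0" using prim_total[of a b g] out zero[of b] ab by simp
  consider "x < a" | "x \<in> {a..b}" | "b < x" by fastforce
  then show "(\<integral>t. indicator {x<..} t * g t \<partial>lborel) = 0"
  proof cases
    case 1
    then have "(\<lambda>t. indicator {x<..} t * g t) = g" using out by (auto simp: fun_eq_iff indicator_def)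
    then show ?thesis using tot by simp
  next
    case 2
    have "(\<lambda>t. indicator {x<..} t * g t) = (\<lambda>t. g t - indicator {a..x} t * g t)"
      using out 2 by (auto simp: fun_eq_iff indicator_def)
    then have "(\<integral>t. indicator {x<..} t * g t \<partial>lborel) = (\<integral>t. g t \<partial>lborel) - prim a g x"
      unfolding prim_def using g by (simp add: integrable_indicator_mult)
    then show ?thesis using tot zero[OF 2] by simp
  next
    case 3
    then have "(\<lambda>t. indicator {x<..} t * g t) = (\<lambda>t. 0)" using out by (auto simp: fun_eq_iff indicator_def)
    then show ?thesis by simp
  qed
qed

text \<open>Since \<open>g\<close> is merely integrable, its primitive need not be differentiable
  everywhere and the product rule is not at hand. Instead the order of integration is exchanged over
  the triangle a \<le> t \<le> x \<le> b.\<close>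

lemma integral_by_parts_prim:
  assumes ab: "a \<le> b" and g: "integrable lborel g" and out: "\<And>x. x \<notin> {a..b} \<Longrightarrow> g x = 0"
    and deriv: "\<And>x. x \<in> {a..b} \<Longrightarrow> (\<eta> has_real_derivative \<eta>' x) (at x within {a..b})"
    and cont: "continuous_on {a..b} \<eta>'"
  shows "(\<integral>x. prim a g x * restr a b \<eta>' x \<partial>lborel) = prim a g b * \<eta> b - (\<integral>x. g x * restr a b \<eta> x \<partial>lborel)"
proof -
  have gm[measurable]: "g \<in> borel_measurable borel" using g by simp
  have rm[measurable]: "restr a b \<eta>' \<in> borel_measurable borel" using cont by (rule restr_measurable)
  have cont_eta: "continuous_on {a..b} \<eta>"
    using deriv by (meson DERIV_continuous continuous_on_eq_continuous_within)
  let ?k = "\<lambda>x t. restr a b \<eta>' x * ((if a \<le> t \<and> t \<le> x then 1 else 0) * g t)"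
  have ind: "(if a \<le> t \<and> t \<le> x then 1 else 0) = indicat_real {a..x} t" for t x
    by (auto simp: indicator_def)
  have km: "case_prod ?k \<in> borel_measurable (lborel \<Otimes>\<^sub>M lborel)" by measurable
  have int: "integrable (lborel \<Otimes>\<^sub>M lborel) (case_prod ?k)"
  proof (rule lborel_pair.Fubini_integrable[OF km])
    have "integrable lborel (\<lambda>x. \<integral>t. norm (?k x t) \<partial>lborel)"
    proof (rule Bochner_Integration.integrable_bound)
      show "integrable lborel (\<lambda>x. \<bar>restr a b \<eta>' x\<bar> * (\<integral>t. \<bar>g t\<bar> \<partial>lborel))"
        using restr_integrable[OF cont] by (intro Bochner_Integration.integrable_mult_left integrable_abs)
      have "(\<lambda>(x, t). norm (?k x t)) \<in> borel_measurable (lborel \<Otimes>\<^sub>M lborel)" by measurable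
      then show "(\<lambda>x. \<integral>t. norm (?k x t) \<partial>lborel) \<in> borel_measurable lborel"
        by (rule lborel.borel_measurable_lebesgue_integral)
      show "AE x in lborel. norm (\<integral>t. norm (?k x t) \<partial>lborel) \<le> norm (\<bar>restr a b \<eta>' x\<bar> * (\<integral>t. \<bar>g t\<bar> \<partial>lborel))"
      proof (intro always_eventually allI)
        fix x
        have "(\<integral>t. norm (?k x t) \<partial>lborel) = \<bar>restr a b \<eta>' x\<bar> * (\<integral>t. indicator {a..x} t * \<bar>g t\<bar> \<partial>lborel)"
          by (simp add: ind abs_mult)
        also have "\<dots> \<le> \<bar>restr a b \<eta>' x\<bar> * (\<integral>t. \<bar>g t\<bar> \<partial>lborel)"
          using g by (intro mult_left_mono integral_mono integrable_indicator_mult)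
            (auto simp: indicator_def)
        finally show "norm (\<integral>t. norm (?k x t) \<partial>lborel) \<le> norm (\<bar>restr a b \<eta>' x\<bar> * (\<integral>t. \<bar>g t\<bar> \<partial>lborel))"
          by simp
      qed
    qed
    then show "integrable lborel (\<lambda>x. \<integral>t. norm (case_prod ?k (x, t)) \<partial>lborel)" by simp
    show "AE x in lborel. integrable lborel (\<lambda>t. case_prod ?k (x, t))"
      using g by (auto simp: ind intro!: integrable_indicator_mult)
  qed
  \<comment> \<open>For fixed \<open>t\<close> the remaining integral of \<open>\<eta>'\<close> runs
    from \<open>t\<close> to \<open>b\<close>. Outside the interval both sides vanish with
    \<open>g t\<close>.\<close>
  have inner: "(\<integral>x. ?k x t \<partial>lborel) = g t * \<eta> b - g t * restr a b \<eta> t" for t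
  proof (cases "t \<in> {a..b}")
    case True
    have "(\<integral>x. indicator {t..b} x *\<^sub>R \<eta>' x \<partial>lborel) = \<eta> b - \<eta> t"
    proof (rule integral_FTC_atLeastAtMost)
      show "t \<le> b" using True by simp
      show "(\<eta> has_vector_derivative \<eta>' x) (at x within {t..b})" if "t \<le> x" "x \<le> b" for x
        using deriv[of x] that True
        by (auto simp: has_real_derivative_iff_has_vector_derivative
            intro: has_vector_derivative_within_subset)
      show "continuous_on {t..b} \<eta>'" using cont True by (auto intro: continuous_on_subset)
    qed
    moreover have "(\<lambda>x. ?k x t) = (\<lambda>x. g t * (indicator {t..b} x *\<^sub>R \<eta>' x))"
      using True by (auto simp: fun_eq_iff indicator_def restr_def)
    ultimately show ?thesis
      unfolding restr_simps(1)[OF True] by (simp add: right_diff_distrib)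
  next
    case False
    then show ?thesis using out by simp
  qed
  have "(\<integral>x. prim a g x * restr a b \<eta>' x \<partial>lborel) = (\<integral>x. (\<integral>t. ?k x t \<partial>lborel) \<partial>lborel)"
    by (simp add: prim_def ind mult.commute)
  also have "\<dots> = (\<integral>t. (\<integral>x. ?k x t \<partial>lborel) \<partial>lborel)"
    by (rule lborel_pair.Fubini_integral[OF int, symmetric])
  also have "\<dots> = (\<integral>t. g t * \<eta> b - g t * restr a b \<eta> t \<partial>lborel)"
    by (simp only: inner)
  also have "\<dots> = (\<integral>t. g t \<partial>lborel) * \<eta> b - (\<integral>t. g t * restr a b \<eta> t \<partial>lborel)"
  proof -
    obtain B where B: "B > 0" "\<And>x. x \<in> {a..b} \<Longrightarrow> \<bar>\<eta> x\<bar> \<le> B"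
      using continuous_on_interval_bounded[OF cont_eta] by blast
    have [measurable]: "restr a b \<eta> \<in> borel_measurable borel" using cont_eta by (rule restr_measurable)
    have "integrable lborel (\<lambda>t. g t * restr a b \<eta> t)"
    proof (rule Bochner_Integration.integrable_bound)
      show "integrable lborel (\<lambda>t. B * g t)" using g by simp
      show "AE t in lborel. norm (g t * restr a b \<eta> t) \<le> norm (B * g t)"
      proof (intro always_eventually allI)
        fix t
        show "norm (g t * restr a b \<eta> t) \<le> norm (B * g t)"
          using B(2)[of t] out[of t] B(1)
          by (cases "t \<in> {a..b}") (auto simp: restr_simps abs_mult intro!: mult_right_mono
              simp: mult.commute[of "\<bar>g t\<bar>"])
      qed
    qed simp
    then show ?thesis using g by (subst Bochner_Integration.integral_diff) auto
  qed
  finally show ?thesis using prim_total[of a b g] out by simp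
qed

section \<open>Trapezoidal cut-offs of slope k, test functions and the du Bois-Reymond lemma\<close>

definition hat :: "real \<Rightarrow> real \<Rightarrow> nat \<Rightarrow> real \<Rightarrow> real" where
  "hat s t k x = max 0 (min 1 (real k * min (x - s) (t - x)))"

lemma hat_bounds: "0 \<le> hat s t k x" "hat s t k x \<le> 1"
  by (auto simp: hat_def)

lemma hat_outside:
  assumes "x \<notin> {s<..<t}"
  shows "hat s t k x = 0"
proof -
  have "min (x - s) (t - x) \<le> 0" using assms by auto
  then have "real k * min (x - s) (t - x) \<le> 0" by (intro mult_nonneg_nonpos) auto
  then show ?thesis unfolding hat_def by linarith
qed

lemma continuous_on_hat: "continuous_on S (hat s t k)"
  unfolding hat_def[abs_def] by (intro continuous_intros)

lemma hat_tendsto: "(\<lambda>k. hat s t k x) \<longlonglongrightarrow> indicator {s<..<t} x"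
proof (cases "x \<in> {s<..<t}")
  case True
  define m where "m = min (x - s) (t - x)"
  have m: "m > 0" using True by (auto simp: m_def)
  obtain N where N: "1 / m < real N" using reals_Archimedean2 by blast
  have "\<forall>\<^sub>F k in sequentially. 1 = hat s t k x"
    using eventually_ge_at_top[of N]
  proof eventually_elim
    case (elim k)
    then have "1 / m < real k" using N by simp
    then have "1 \<le> real k * m" using m by (simp add: field_simps)
    then show ?case by (simp add: hat_def m_def[symmetric])
  qed
  then show ?thesis using True Lim_transform_eventually[OF tendsto_const[of 1]] by fastforce
qed (simp add: hat_outside)

lemma integral_hat_tendsto:
  assumes f: "integrable lborel f"
  shows "(\<lambda>k. \<integral>x. f x * hat s t k x \<partial>lborel) \<longlonglongrightarrow> (\<integral>x. f x * indicator {s<..<t} x \<partial>lborel)"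
proof (rule integral_dominated_convergence[where w = "\<lambda>x. \<bar>f x\<bar>"])
  have [measurable]: "f \<in> borel_measurable borel" using f by simp
  have [measurable]: "hat s t k \<in> borel_measurable borel" for k
    by (intro borel_measurable_continuous_onI continuous_on_hat)
  show "(\<lambda>x. f x * indicator {s<..<t} x) \<in> borel_measurable lborel"
    "\<And>k. (\<lambda>x. f x * hat s t k x) \<in> borel_measurable lborel" by measurable
  show "integrable lborel (\<lambda>x. \<bar>f x\<bar>)" using f by simp
  show "AE x in lborel. (\<lambda>k. f x * hat s t k x) \<longlonglongrightarrow> f x * indicator {s<..<t} x"
    by (intro always_eventually allI tendsto_intros hat_tendsto)
  show "AE x in lborel. norm (f x * hat s t k x) \<le> \<bar>f x\<bar>" for k
    using hat_bounds by (auto simp: abs_mult intro!: always_eventually mult_left_le)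
qed

lemma test_functionD:
  assumes "test_function a b \<psi>" "a < b"
  shows "\<psi> a = 0" "\<psi> b = 0" "(\<psi> has_real_derivative deriv \<psi> x) (at x within S)"
    "continuous_on S (deriv \<psi>)" "continuous_on S \<psi>"
proof -
  obtain c d where "a < c" "d < b" "\<And>x. x \<notin> {c..d} \<Longrightarrow> \<psi> x = 0"
    using assms by (auto simp: test_function_def)
  then show "\<psi> a = 0" "\<psi> b = 0" by auto
  obtain D where D: "\<And>x. (\<psi> has_real_derivative D x) (at x)" "continuous_on UNIV D"
    using assms by (auto simp: test_function_def C1_differentiable_on_def
        has_real_derivative_iff_has_vector_derivative)
  have "deriv \<psi> = D" using D(1) by (auto intro!: DERIV_imp_deriv)
  then show *: "(\<psi> has_real_derivative deriv \<psi> x) (at x within S)" "continuous_on S (deriv \<psi>)" for x S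
    using D by (auto intro: has_field_derivative_at_within continuous_on_subset)
  show "continuous_on S \<psi>"
    using *(1) by (meson DERIV_continuous continuous_on_eq_continuous_within)
qed

text \<open>The antiderivative normalized at \<open>c\<close> vanishes to the left of
  \<open>c\<close>, and the zero mean makes it vanish again to the right of \<open>d\<close>. So
  continuous functions of mean zero with support inside (a,b) are exactly what derivatives of test
  functions can probe.\<close>

lemma test_function_antiderivative:
  assumes cont: "continuous_on UNIV \<zeta>" and cd: "a < c" "c \<le> d" "d < b"
    and out: "\<And>x. x \<notin> {c<..<d} \<Longrightarrow> \<zeta> x = 0" and zero: "(\<integral>x. \<zeta> x \<partial>lborel) = 0"
  obtains \<psi> where "test_function a b \<psi>" "deriv \<psi> = \<zeta>"
proof -
  obtain F where F: "\<And>x. (F has_real_derivative \<zeta> x) (at x)"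
    using einterval_antiderivative[of "-\<infinity>" "\<infinity>" \<zeta>] cont
    by (auto simp: has_real_derivative_iff_has_vector_derivative continuous_on_eq_continuous_at)
  have FTC: "F y - F x = (\<integral>t. indicator {x..y} t * \<zeta> t \<partial>lborel)" if "x \<le> y" for x y
    using integral_FTC_atLeastAtMost[OF that, of F \<zeta>] F continuous_on_subset[OF cont subset_UNIV]
    by (simp add: has_real_derivative_iff_has_vector_derivative has_vector_derivative_at_within)
  have "F x - F c = 0" if "x \<notin> {c..d}" for x
  proof (cases "x < c")
    case True
    then have "(\<lambda>t. indicator {x..c} t * \<zeta> t) = (\<lambda>t. 0)"
      using out by (auto simp: fun_eq_iff indicator_def)
    then show ?thesis using FTC[of x c] True by simp
  next
    case False
    then have "indicator {c..x} t * \<zeta> t = \<zeta> t" for t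
      using out[of t] that by (cases "t \<in> {c<..<d}") (auto simp: indicator_def)
    then have "(\<lambda>t. indicator {c..x} t * \<zeta> t) = \<zeta>" by (rule ext)
    then show ?thesis using FTC[of c x] False zero by simp
  qed
  moreover have D: "((\<lambda>x. F x - F c) has_real_derivative \<zeta> x) (at x)" for x
    using F[of x] by (auto intro!: derivative_eq_intros)
  moreover have "(\<lambda>x. F x - F c) C1_differentiable_on UNIV"
    unfolding C1_differentiable_on_def using D cont
    by (auto simp: has_real_derivative_iff_has_vector_derivative)
  ultimately have "test_function a b (\<lambda>x. F x - F c)"
    unfolding test_function_def using cd by blast
  moreover have "deriv (\<lambda>x. F x - F c) = \<zeta>" using D by (auto intro!: DERIV_imp_deriv)
  ultimately show ?thesis using that by blast
qed

text \<open>Each cut-off is corrected to mean zero by a multiple of one fixed reference cut-off,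
  whose pairing with \<open>f\<close> determines the constant \<open>c\<close>. In the limit the
  integral of \<open>f\<close> over every interior interval is \<open>c\<close> times its length, so
  \<open>f\<close> minus this constant has a constant primitive, which is 0 because it starts at
  0.\<close>

lemma du_Bois_Reymond:
  assumes ab: "a < b" and f: "integrable lborel f" and out: "\<And>x. x \<notin> {a..b} \<Longrightarrow> f x = 0"
    and test: "\<And>\<psi>. test_function a b \<psi> \<Longrightarrow> (\<integral>x. f x * restr a b (deriv \<psi>) x \<partial>lborel) = 0"
  obtains c where "AE x in lborel. f x = restr a b (\<lambda>_. c) x"
proof -
  have [measurable]: "f \<in> borel_measurable borel" using f by simp
  have hm[measurable]: "hat s t k \<in> borel_measurable borel" for s t k
    by (intro borel_measurable_continuous_onI continuous_on_hat)
  have ind_int: "integrable lborel (indicat_real {s..t})" for s t :: real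
    using restr_integrable[of s t "\<lambda>_. 1"] by (simp add: restr_def[abs_def])
  have hint: "integrable lborel (hat s t k)" for s t k
  proof (rule Bochner_Integration.integrable_bound)
    show "integrable lborel (indicat_real {s..t})" by (rule ind_int)
    show "AE x in lborel. norm (hat s t k x) \<le> norm (indicat_real {s..t} x)"
    proof (intro always_eventually allI)
      fix x show "norm (hat s t k x) \<le> norm (indicat_real {s..t} x)"
        using hat_bounds[of s t k x] hat_outside[of x s t k]
        by (cases "x \<in> {s<..<t}") (auto simp: indicator_def)
    qed
  qed simp
  have fhint: "integrable lborel (\<lambda>x. f x * hat s t k x)" for s t k
    by (rule Bochner_Integration.integrable_bound[OF f])
      (use hat_bounds in \<open>auto simp: abs_mult intro!: always_eventually mult_left_le\<close>)
  have hat_lim: "(\<lambda>k. \<integral>x. hat s t k x \<partial>lborel) \<longlonglongrightarrow> t - s" if "s < t" for s t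
  proof -
    have "(\<lambda>k. \<integral>x. indicator {s..t} x * hat s t k x \<partial>lborel) \<longlonglongrightarrow> (\<integral>x. indicator {s..t} x * indicator {s<..<t} x \<partial>lborel)"
      by (rule integral_hat_tendsto[OF ind_int])
    moreover have "indicator {s..t} x * hat s t k x = hat s t k x" for x k
      using hat_outside[of x s t k] by (cases "x \<in> {s<..<t}") (auto simp: indicator_def)
    moreover have "indicator {s..t} x * indicator {s<..<t} x = indicat_real {s<..<t} x" for x
      by (auto simp: indicator_def)
    ultimately show ?thesis using that by simp
  qed
  \<comment> \<open>The reference cut-off sits on the middle third of the interval, away from both
    end points.\<close>
  define s0 where "s0 = (2 * a + b) / 3"
  define t0 where "t0 = (a + 2 * b) / 3"
  have st0: "a < s0" "s0 < t0" "t0 < b" using ab by (auto simp: s0_def t0_def)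
  \<comment> \<open>The integrals of the cut-offs tend to the positive length
    \<open>t0 - s0\<close>, so they cannot all vanish.\<close>
  have "\<exists>k. (\<integral>x. hat s0 t0 k x \<partial>lborel) \<noteq> 0"
  proof (rule ccontr)
    assume "\<not> ?thesis"
    then have "t0 - s0 = 0" using LIMSEQ_unique[OF hat_lim[OF st0(2)], of 0] by simp
    then show False using st0 by simp
  qed
  then obtain k0 where k0: "(\<integral>x. hat s0 t0 k0 x \<partial>lborel) \<noteq> 0" by blast
  define J where "J = (\<integral>x. hat s0 t0 k0 x \<partial>lborel)"
  define c where "c = (\<integral>x. f x * hat s0 t0 k0 x \<partial>lborel) / J"
  have J: "J \<noteq> 0" using k0 by (simp add: J_def)
  have fhat: "(\<integral>x. f x * hat s t k x \<partial>lborel) = c * (\<integral>x. hat s t k x \<partial>lborel)"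
    if st: "a < s" "s < t" "t < b" for s t k
  proof -
    define I where "I = (\<integral>x. hat s t k x \<partial>lborel)"
    let ?\<zeta> = "\<lambda>x. hat s t k x - I / J * hat s0 t0 k0 x"
    have "continuous_on UNIV ?\<zeta>" by (intro continuous_intros continuous_on_hat)
    moreover have "(\<integral>x. ?\<zeta> x \<partial>lborel) = 0"
      using hint J by (simp add: I_def[symmetric] J_def[symmetric])
    moreover have "?\<zeta> x = 0" if "x \<notin> {min s s0<..<max t t0}" for x
    proof -
      have "x \<notin> {s<..<t}" "x \<notin> {s0<..<t0}" using that by auto
      then show ?thesis by (simp add: hat_outside)
    qed
    moreover have "a < min s s0" "min s s0 \<le> max t t0" "max t t0 < b" using st st0 by auto
    ultimately obtain \<psi> where \<psi>: "test_function a b \<psi>" "deriv \<psi> = ?\<zeta>"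
      using test_function_antiderivative[of ?\<zeta> a "min s s0" "max t t0" b] by metis
    have "f x * restr a b (deriv \<psi>) x = f x * hat s t k x - I / J * (f x * hat s0 t0 k0 x)" for x
      unfolding \<psi>(2) using out[of x] by (cases "x \<in> {a..b}") (auto simp: restr_simps algebra_simps)
    then have "0 = (\<integral>x. f x * hat s t k x \<partial>lborel) - I / J * (\<integral>x. f x * hat s0 t0 k0 x \<partial>lborel)"
      using test[OF \<psi>(1)] fhint by simp
    then show ?thesis by (simp add: c_def I_def[symmetric])
  qed
  have fint: "(\<integral>x. f x * indicator {s<..<t} x \<partial>lborel) = c * (t - s)" if "a < s" "s < t" "t < b" for s t
    by (rule LIMSEQ_unique[OF integral_hat_tendsto[OF f]])
      (unfold fhat[OF that], intro tendsto_intros hat_lim that)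
  define h where "h x = f x - restr a b (\<lambda>_. c) x" for x
  have h: "integrable lborel h" using f restr_integrable[of a b "\<lambda>_. c"] by (simp add: h_def[abs_def])
  have hout: "h x = 0" if "x \<notin> {a..b}" for x using out[OF that] that by (simp add: h_def restr_simps)
  have hst: "prim a h t = prim a h s" if "a < s" "s < t" "t < b" for s t
  proof -
    have "(\<integral>x. indicator {s<..<t} x * h x \<partial>lborel)
        = (\<integral>x. f x * indicator {s<..<t} x - c * indicator {s<..<t} x \<partial>lborel)"
      using that by (intro Bochner_Integration.integral_cong) (auto simp: h_def restr_def indicator_def)
    also have "\<dots> = c * (t - s) - c * (t - s)"
    proof (subst Bochner_Integration.integral_diff)
      show "integrable lborel (\<lambda>x. f x * indicator {s<..<t} x)"
        using integrable_indicator_mult[OF f, of "{s<..<t}"] by (simp add: mult.commute)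
    qed (use that in \<open>auto simp: fint\<close>)
    finally show ?thesis using prim_diff[OF h, of a s t] that by simp
  qed
  \<comment> \<open>The tests reach only interior intervals. Continuity extends the constancy to the
    end point \<open>a\<close>, where the primitive is known to be 0.\<close>
  have const: "prim a h x = prim a h s0" if "x \<in> {a..b}" for x
  proof (rule continuous_constant_on_closure[of "{a<..<b}" "prim a h" "prim a h s0" x])
    show "continuous_on (closure {a<..<b}) (prim a h)" using ab by (simp add: continuous_on_prim[OF h])
    show "x \<in> closure {a<..<b}" using that ab by simp
    show "prim a h x = prim a h s0" if "x \<in> {a<..<b}" for x
      using hst[of x s0] hst[of s0 x] that st0 by (cases x s0 rule: linorder_cases) auto
  qed
  have "prim a h x = 0" if "x \<in> {a..b}" for x
    using const[OF that] const[of a] ab prim_start[of a h] by simp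
  then have "AE x in lborel. h x = 0" using ab by (intro AE_eq_0_of_prim[OF _ h hout]) auto
  then have "AE x in lborel. f x = restr a b (\<lambda>_. c) x" by (simp add: h_def)
  then show ?thesis using that by blast
qed


text \<open>The integral from \<open>a\<close> to \<open>x\<close>, written as a pairing with the
  class of an indicator function. It is thereby defined on classes, and its linearity and its bound
  are properties of the inner product.\<close>

definition primitive :: "real \<Rightarrow> real \<Rightarrow> L0 \<Rightarrow> real \<Rightarrow> real" where
  "primitive a b g x = ip1 a b g (restr_class a x (\<lambda>_. 1))"

lemma sqint_restr_one: "x \<in> {a..b} \<Longrightarrow> sqint a b (restr a x (\<lambda>_. 1))"
  using sqint_restr[of a x "\<lambda>_. 1"] by (auto simp: sqint_def)

lemma primitive_abs:
  assumes g: "sqint a b g" and x: "x \<in> {a..b}"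
  shows "primitive a b (abs_L0 g) x = prim a g x"
  unfolding primitive_def restr_class_eq ip1_abs[OF g sqint_restr_one[OF x]] prim_def
  by (simp add: restr_def mult.commute)

lemma continuous_on_primitive:
  assumes "g \<in> L2 a b"
  shows "continuous_on {a..b} (primitive a b g)"
proof -
  obtain g0 where "sqint a b g0" "g = abs_L0 g0" using L2_cases assms by blast
  then show ?thesis
    by (intro continuous_on_eq[OF continuous_on_prim[OF sqint_integrable, of a b g0]])
      (simp_all add: primitive_abs)
qed

lemma primitive_linear:
  assumes "f \<in> L2 a b" "g \<in> L2 a b" "x \<in> {a..b}"
  shows "primitive a b (f + g) x = primitive a b f x + primitive a b g x"
    and "primitive a b (c *\<^sub>R f) x = c * primitive a b f x"
proof -
  interpret ip_space "L2 a b" "ip1 a b" by (rule ip_space_L2_1)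
  have "restr_class a x (\<lambda>_. 1) \<in> L2 a b"
    using sqint_L2[OF sqint_restr_one[OF assms(3)]] by (simp add: restr_class_eq)
  then show "primitive a b (f + g) x = primitive a b f x + primitive a b g x"
    and "primitive a b (c *\<^sub>R f) x = c * primitive a b f x"
    using assms by (simp_all add: primitive_def ip_simps)
qed

lemma primitive_start: "a \<le> b \<Longrightarrow> g \<in> L2 a b \<Longrightarrow> primitive a b g a = 0"
  by (metis L2_cases primitive_abs prim_start atLeastAtMost_iff order_refl)

section \<open>Classes with continuous representatives and their point values\<close>

lemma restr_class_cong: "(\<And>x. x \<in> {a..b} \<Longrightarrow> u x = v x) \<Longrightarrow> restr_class a b u = restr_class a b v"
  unfolding restr_class_def by (rule arg_cong[of _ _ abs_L0]) (auto simp: indicator_def fun_eq_iff)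

lemma restr_class_ops:
  assumes u: "continuous_on {a..b} u" and v: "continuous_on {a..b} v"
  shows "restr_class a b (\<lambda>x. u x + v x) = restr_class a b u + restr_class a b v"
    and "restr_class a b (\<lambda>x. u x - v x) = restr_class a b u - restr_class a b v"
    and "restr_class a b (\<lambda>x. u x * v x) = restr_class a b u * restr_class a b v"
    and "restr_class a b (\<lambda>x. c * u x) = c *\<^sub>R restr_class a b u"
    and "restr_class a b (\<lambda>x. - u x) = - restr_class a b u"
  using restr_measurable[OF u] restr_measurable[OF v]
  by (auto simp: restr_class_eq abs_L0_ops abs_L0_unary restr_def fun_eq_iff indicator_def algebra_simps
      intro!: arg_cong[of _ _ abs_L0])

lemma restr_class_zero: "restr_class a b (\<lambda>_. 0) = 0"
  by (simp add: restr_class_def zero_L0_eq)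

lemma restr_class_one_mult: "f \<in> L2 a b \<Longrightarrow> restr_class a b (\<lambda>_. 1) * f = f"
  by (simp add: L2_def mult.commute)

text \<open>The squared difference is continuous, nonnegative and has integral 0, so it vanishes at
  every point, the end points included. This makes the definite description in
  \<open>point_value\<close> well defined.\<close>

lemma restr_class_eq_iff:
  assumes ab: "a < b" and u: "continuous_on {a..b} u" and v: "continuous_on {a..b} v"
  shows "restr_class a b u = restr_class a b v \<longleftrightarrow> (\<forall>x\<in>{a..b}. u x = v x)"
proof
  assume "restr_class a b u = restr_class a b v"
  then have ae: "AE x in lborel. restr a b u x = restr a b v x"
    using u v by (simp add: restr_class_eq abs_L0_eq_iff restr_measurable)
  let ?w = "\<lambda>x. (u x - v x)\<^sup>2"
  have w: "continuous_on {a..b} ?w" using u v by (intro continuous_intros)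
  have "(\<integral>x. restr a b ?w x \<partial>lborel) = 0"
    by (rule integral_eq_zero_AE) (use ae in \<open>auto elim!: eventually_mono simp: restr_def indicator_def\<close>)
  moreover have "set_integrable lborel {a..b} ?w"
    using restr_integrable[OF w] by (simp add: set_integrable_def restr_def[abs_def])
  ultimately have "integral {a..b} ?w = 0"
    using set_borel_integral_eq_integral(2)[of "{a..b}" ?w]
    by (simp add: set_lebesgue_integral_def restr_def[abs_def])
  then show "\<forall>x\<in>{a..b}. u x = v x"
    using integral_eq_0_iff[OF w ab] by simp
qed (auto intro: restr_class_cong)

lemma point_value_restr:
  assumes ab: "a < b" and u: "continuous_on {a..b} u" and x: "x \<in> {a..b}"
  shows "point_value a b (restr_class a b u) x = u x"
  unfolding point_value_def
proof (rule the_equality)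
  show "\<exists>v. continuous_on {a..b} v \<and> restr_class a b u = restr_class a b v \<and> u x = v x"
    using u by blast
  show "y = u x" if y: "\<exists>v. continuous_on {a..b} v \<and> restr_class a b u = restr_class a b v \<and> y = v x" for y
  proof -
    obtain v where v: "continuous_on {a..b} v" "restr_class a b u = restr_class a b v" "y = v x"
      using y by blast
    then show ?thesis using restr_class_eq_iff[OF ab u v(1)] x by simp
  qed
qed

section \<open>Weak differentiation and integration as inverse operations\<close>

lemma has_weak_deriv_abs:
  assumes ab: "a < b" and f: "sqint a b f" and g: "sqint a b g"
  shows "has_weak_deriv a b (abs_L0 f) (abs_L0 g) \<longleftrightarrow> (\<forall>\<psi>. test_function a b \<psi> \<longrightarrow>
    (\<integral>x. f x * restr a b (deriv \<psi>) x \<partial>lborel) = - (\<integral>x. g x * restr a b \<psi> x \<partial>lborel))"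
proof -
  have "L0_integral (abs_L0 h * restr_class a b u) = (\<integral>x. h x * restr a b u x \<partial>lborel)"
    if "sqint a b h" "continuous_on {a..b} u" for h u
    using sqint_measurable[OF that(1)] restr_measurable[OF that(2)]
    by (simp add: restr_class_eq abs_L0_ops abs_L0_unary)
  then show ?thesis
    using f g test_functionD(4,5)[OF _ ab] by (simp add: has_weak_deriv_def cong: all_cong)
qed

lemma integral_by_parts_L2:
  assumes ab: "a \<le> b" and g: "g \<in> L2 a b"
    and deriv: "\<And>x. x \<in> {a..b} \<Longrightarrow> (\<eta> has_real_derivative \<eta>' x) (at x within {a..b})"
    and cont: "continuous_on {a..b} \<eta>'"
  shows "L0_integral (restr_class a b (\<lambda>x. (c + primitive a b g x) * \<eta>' x))
    = (c + primitive a b g b) * \<eta> b - c * \<eta> a - L0_integral (g * restr_class a b \<eta>)"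
proof -
  obtain g0 where g0: "sqint a b g0" "g = abs_L0 g0" using L2_cases g by blast
  note gm = sqint_measurable[OF g0(1)]
  have cont_eta: "continuous_on {a..b} \<eta>"
    using deriv by (meson DERIV_continuous continuous_on_eq_continuous_within)
  have FTC: "(\<integral>x. restr a b \<eta>' x \<partial>lborel) = \<eta> b - \<eta> a"
    using integral_FTC_atLeastAtMost[OF ab, of \<eta> \<eta>'] deriv cont
    by (simp add: restr_def has_real_derivative_iff_has_vector_derivative)
  have pc: "continuous_on {a..b} (\<lambda>x. prim a g0 x * \<eta>' x)"
    using continuous_on_prim[OF sqint_integrable[OF g0(1)]] cont by (intro continuous_intros)
  have int: "integrable lborel (\<lambda>x. prim a g0 x * restr a b \<eta>' x)"
  proof -
    have "(\<lambda>x. prim a g0 x * restr a b \<eta>' x) = restr a b (\<lambda>x. prim a g0 x * \<eta>' x)"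
      by (simp add: restr_def fun_eq_iff)
    then show ?thesis using restr_integrable[OF pc] by simp
  qed
  have cc: "continuous_on {a..b} (\<lambda>x. (c + primitive a b g x) * \<eta>' x)"
    using continuous_on_primitive[OF g] cont by (intro continuous_intros)
  have "L0_integral (restr_class a b (\<lambda>x. (c + primitive a b g x) * \<eta>' x))
      = (\<integral>x. restr a b (\<lambda>x. (c + primitive a b g x) * \<eta>' x) x \<partial>lborel)"
    using restr_measurable[OF cc] by (simp add: restr_class_eq abs_L0_unary)
  also have "\<dots> = (\<integral>x. c * restr a b \<eta>' x + prim a g0 x * restr a b \<eta>' x \<partial>lborel)"
    by (intro Bochner_Integration.integral_cong)
      (auto simp: restr_def indicator_def g0(2) primitive_abs[OF g0(1)] algebra_simps)
  also have "\<dots> = c * (\<eta> b - \<eta> a) + (prim a g0 b * \<eta> b - (\<integral>x. g0 x * restr a b \<eta> x \<partial>lborel))"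
    using integral_by_parts_prim[OF ab sqint_integrable[OF g0(1)] sqint_outside[OF g0(1)] deriv cont]
      int restr_integrable[OF cont] by (simp add: FTC)
  also have "(\<integral>x. g0 x * restr a b \<eta> x \<partial>lborel) = L0_integral (g * restr_class a b \<eta>)"
    using gm restr_measurable[OF cont_eta] by (simp add: g0 restr_class_eq abs_L0_ops abs_L0_unary)
  finally show ?thesis
    using ab by (simp add: g0(2) primitive_abs[OF g0(1)] algebra_simps)
qed

lemma L0_integral_add_L2:
  assumes "f \<in> L2 a b" "g \<in> L2 a b" "continuous_on {a..b} u"
  shows "L0_integral ((f + g) * restr_class a b u) = L0_integral (f * restr_class a b u) + L0_integral (g * restr_class a b u)"
  using L2_integrable_mult[OF assms(1) restr_class_L2[OF assms(3)]]
    L2_integrable_mult[OF assms(2) restr_class_L2[OF assms(3)]]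
  by (simp add: distrib_right L0_integral_linear)

text \<open>A product rule for a continuously differentiable factor \<theta>: integrate by parts
  against \<theta> \<psi>, which vanishes at both end points. The cases used are \<theta> = 1, 1 / p
  and p.\<close>

lemma has_weak_deriv_mult:
  assumes ab: "a < b" and g: "g \<in> L2 a b"
    and \<theta>: "\<And>x. x \<in> {a..b} \<Longrightarrow> (\<theta> has_real_derivative \<theta>' x) (at x within {a..b})"
    and \<theta>': "continuous_on {a..b} \<theta>'"
  shows "has_weak_deriv a b (restr_class a b (\<lambda>x. \<theta> x * (c + primitive a b g x)))
    (restr_class a b \<theta> * g + restr_class a b (\<lambda>x. \<theta>' x * (c + primitive a b g x)))"
  unfolding has_weak_deriv_def
proof (intro allI impI)
  fix \<psi> assume \<psi>: "test_function a b \<psi>"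
  note \<psi> = test_functionD[OF \<psi> ab]
  have c\<theta>: "continuous_on {a..b} \<theta>"
    using \<theta> by (meson DERIV_continuous continuous_on_eq_continuous_within)
  let ?w = "\<lambda>x. c + primitive a b g x"
  have w: "continuous_on {a..b} ?w"
    using continuous_on_primitive[OF g] by (intro continuous_intros)
  let ?\<eta> = "\<lambda>x. \<theta> x * \<psi> x" and ?\<eta>' = "\<lambda>x. \<theta> x * deriv \<psi> x + \<theta>' x * \<psi> x"
  have c1: "continuous_on {a..b} (\<lambda>x. ?w x * (\<theta> x * deriv \<psi> x))"
    "continuous_on {a..b} (\<lambda>x. ?w x * (\<theta>' x * \<psi> x))"
    by (intro continuous_on_mult w c\<theta> \<theta>' \<psi>(4,5))+
  have "L0_integral (restr_class a b (\<lambda>x. ?w x * ?\<eta>' x)) = - L0_integral (g * restr_class a b ?\<eta>)"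
  proof (subst integral_by_parts_L2[OF less_imp_le[OF ab] g, of ?\<eta>])
    show "(?\<eta> has_real_derivative ?\<eta>' x) (at x within {a..b})" if "x \<in> {a..b}" for x
      using \<theta>[OF that] \<psi>(3)[of x "{a..b}"] by (auto intro!: derivative_eq_intros)
    show "continuous_on {a..b} ?\<eta>'"
      by (intro continuous_on_add continuous_on_mult c\<theta> \<theta>' \<psi>(4,5))
  qed (simp add: \<psi>(1,2))
  moreover have "L0_integral (restr_class a b (\<lambda>x. ?w x * ?\<eta>' x)) =
      L0_integral (restr_class a b (\<lambda>x. ?w x * (\<theta> x * deriv \<psi> x))) + L0_integral (restr_class a b (\<lambda>x. ?w x * (\<theta>' x * \<psi> x)))"
    using restr_class_ops(1)[OF c1] L0_integral_linear(1)[of "restr_class a b (\<lambda>x. ?w x * (\<theta> x * deriv \<psi> x))" "restr_class a b (\<lambda>x. ?w x * (\<theta>' x * \<psi> x))"]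
      restr_integrable[OF c1(1)] restr_integrable[OF c1(2)] restr_measurable[OF c1(1)] restr_measurable[OF c1(2)]
    by (simp add: distrib_left restr_class_eq abs_L0_unary)
  moreover have "restr_class a b (\<lambda>x. ?w x * (\<theta> x * deriv \<psi> x)) = restr_class a b (\<lambda>x. \<theta> x * ?w x) * restr_class a b (deriv \<psi>)"
    using w c\<theta> \<psi>(4) by (subst restr_class_ops(3)[symmetric]) (auto intro!: continuous_intros restr_class_cong)
  moreover have "restr_class a b (\<lambda>x. ?w x * (\<theta>' x * \<psi> x)) = restr_class a b (\<lambda>x. \<theta>' x * ?w x) * restr_class a b \<psi>"
    using w \<theta>' \<psi>(5) by (subst restr_class_ops(3)[symmetric]) (auto intro!: continuous_intros restr_class_cong)
  moreover have "g * restr_class a b ?\<eta> = restr_class a b \<theta> * g * restr_class a b \<psi>"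
    using restr_class_ops(3)[OF c\<theta> \<psi>(5)] by (simp add: mult_ac)
  moreover have "L0_integral ((restr_class a b \<theta> * g + restr_class a b (\<lambda>x. \<theta>' x * ?w x)) * restr_class a b \<psi>)
      = L0_integral (restr_class a b \<theta> * g * restr_class a b \<psi>) + L0_integral (restr_class a b (\<lambda>x. \<theta>' x * ?w x) * restr_class a b \<psi>)"
    by (intro L0_integral_add_L2 restr_class_mult_L2 restr_class_L2 continuous_on_mult w c\<theta> \<theta>' \<psi>(5) g)
  ultimately show "L0_integral (restr_class a b (\<lambda>x. \<theta> x * ?w x) * restr_class a b (deriv \<psi>)) =
      - L0_integral ((restr_class a b \<theta> * g + restr_class a b (\<lambda>x. \<theta>' x * ?w x)) * restr_class a b \<psi>)"
    by simp
qed

lemma has_weak_deriv_primitive: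
  assumes "a < b" "g \<in> L2 a b"
  shows "has_weak_deriv a b (restr_class a b (\<lambda>x. c + primitive a b g x)) g"
  using has_weak_deriv_mult[OF assms, of "\<lambda>_. 1" "\<lambda>_. 0" c]
  by (simp add: restr_class_one_mult[OF assms(2)] restr_class_zero)

text \<open>\<open>f\<close> and the primitive of \<open>g\<close> have the same weak derivative, so
  their difference satisfies the hypothesis of the du Bois-Reymond lemma and is constant.\<close>

lemma has_weak_deriv_imp_primitive:
  assumes ab: "a < b" and f: "f \<in> L2 a b" and g: "g \<in> L2 a b" and D: "has_weak_deriv a b f g"
  obtains c where "f = restr_class a b (\<lambda>x. c + primitive a b g x)"
proof -
  obtain f0 where f0: "sqint a b f0" "f = abs_L0 f0" using L2_cases f by blast
  obtain g0 where g0: "sqint a b g0" "g = abs_L0 g0" using L2_cases g by blast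
  let ?G = "restr a b (primitive a b g)"
  have G: "sqint a b ?G" by (intro sqint_restr continuous_on_primitive g)
  have G': "has_weak_deriv a b (abs_L0 ?G) g"
    using has_weak_deriv_primitive[OF ab g, of 0] by (simp add: restr_class_eq)
  define h where "h x = f0 x - ?G x" for x
  have h: "sqint a b h" unfolding h_def[abs_def] by (rule sqint_diff[OF f0(1) G])
  obtain c where c: "AE x in lborel. h x = restr a b (\<lambda>_. c) x"
  proof (rule du_Bois_Reymond[OF ab sqint_integrable[OF h] sqint_outside[OF h]])
    fix \<psi> assume \<psi>: "test_function a b \<psi>"
    let ?r = "restr a b (deriv \<psi>)"
    have "sqint a b ?r" using test_functionD(4)[OF \<psi> ab] by (rule sqint_restr)
    then have "integrable lborel (\<lambda>x. f0 x * ?r x)" "integrable lborel (\<lambda>x. ?G x * ?r x)"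
      using f0(1) G by (auto intro!: sqint_integrable_mult)
    then have "(\<integral>x. h x * ?r x \<partial>lborel) = (\<integral>x. f0 x * ?r x \<partial>lborel) - (\<integral>x. ?G x * ?r x \<partial>lborel)"
      by (simp add: h_def left_diff_distrib)
    also have "\<dots> = 0"
      using D G' \<psi> unfolding f0(2) g0(2) has_weak_deriv_abs[OF ab f0(1) g0(1)]
        has_weak_deriv_abs[OF ab G[unfolded g0(2)] g0(1)] by simp
    finally show "(\<integral>x. h x * ?r x \<partial>lborel) = 0" .
  qed blast
  have "AE x in lborel. f0 x = restr a b (\<lambda>x. c + primitive a b g x) x"
    using c by eventually_elim (auto simp: h_def restr_def algebra_simps)
  moreover have "restr a b (\<lambda>x. c + primitive a b g x) \<in> borel_measurable borel"
    using continuous_on_primitive[OF g] by (intro restr_measurable continuous_intros)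
  ultimately have "f = restr_class a b (\<lambda>x. c + primitive a b g x)"
    using sqint_measurable[OF f0(1)] by (simp add: f0 restr_class_eq abs_L0_eq_iff)
  then show ?thesis by (rule that)
qed

lemma primitive_eq_0:
  assumes ab: "a < b" and g: "g \<in> L2 a b" and zero: "\<And>x. x \<in> {a..b} \<Longrightarrow> primitive a b g x = 0"
  shows "g = 0"
proof -
  obtain g0 where g0: "sqint a b g0" "g = abs_L0 g0" using L2_cases g by blast
  have "AE x in lborel. g0 x = 0"
    using ab zero
    by (intro AE_eq_0_of_prim[OF _ sqint_integrable[OF g0(1)] sqint_outside[OF g0(1)]])
      (auto simp: g0(2) primitive_abs[OF g0(1)])
  then show ?thesis
    using sqint_measurable[OF g0(1)] by (simp add: g0(2) zero_L0_eq abs_L0_eq_iff)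
qed

text \<open>Both representatives are continuous, so they agree at every point; at \<open>a\<close>
  the primitives vanish and the constants must coincide.\<close>

lemma primitive_unique:
  assumes ab: "a < b" and f: "f \<in> L2 a b" and g: "g \<in> L2 a b"
    and eq: "restr_class a b (\<lambda>x. c + primitive a b f x) = restr_class a b (\<lambda>x. d + primitive a b g x)"
  shows "c = d" "f = g"
proof -
  interpret ip_space "L2 a b" "ip1 a b" by (rule ip_space_L2_1)
  have *: "c + primitive a b f x = d + primitive a b g x" if "x \<in> {a..b}" for x
    using eq that continuous_on_primitive[OF f] continuous_on_primitive[OF g]
    by (subst (asm) restr_class_eq_iff[OF ab]) (auto intro!: continuous_intros)
  show cd: "c = d" using *[of a] ab f g by (simp add: primitive_start)
  have "primitive a b (f - g) x = 0" if x: "x \<in> {a..b}" for x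
    using *[OF x] primitive_linear[of "f - g" a b g x] f g x V_closed(3)[OF f g] cd by simp
  then have "f - g = 0" using f g by (intro primitive_eq_0[OF ab]) (auto intro: V_closed)
  then show "f = g" by simp
qed

text \<open>Two weak derivatives represent \<open>f\<close> as a constant plus a primitive, and such
  a representation is unique. From here on the definite description in \<open>weak_deriv\<close> can
  be evaluated.\<close>

lemma weak_deriv_eqI:
  assumes ab: "a < b" and f: "f \<in> L2 a b" and g: "g \<in> L2 a b" and D: "has_weak_deriv a b f g"
  shows "weak_deriv a b f = g"
  unfolding weak_deriv_def
proof (rule the_equality)
  show "h = g" if h: "h \<in> L2 a b \<and> has_weak_deriv a b f h" for h
  proof -
    obtain c where "f = restr_class a b (\<lambda>x. c + primitive a b g x)"
      using has_weak_deriv_imp_primitive[OF ab f g D] by blast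
    moreover obtain d where "f = restr_class a b (\<lambda>x. d + primitive a b h x)"
      using has_weak_deriv_imp_primitive[OF ab f conjunct1[OF h] conjunct2[OF h]] by blast
    ultimately show ?thesis using primitive_unique(2)[OF ab] h g by metis
  qed
qed (use g D in simp)

lemma H1I:
  assumes "a < b" "f \<in> L2 a b" "g \<in> L2 a b" "has_weak_deriv a b f g"
  shows "f \<in> H1 a b" "weak_deriv a b f = g"
  using assms weak_deriv_eqI by (auto simp: H1_def)

lemma H1D:
  assumes ab: "a < b" and f: "f \<in> H1 a b"
  obtains c where "weak_deriv a b f \<in> L2 a b" "f = restr_class a b (\<lambda>x. c + primitive a b (weak_deriv a b f) x)"
proof -
  obtain g where g: "f \<in> L2 a b" "g \<in> L2 a b" "has_weak_deriv a b f g" using f by (auto simp: H1_def)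
  then have "weak_deriv a b f = g" using weak_deriv_eqI[OF ab] by blast
  then show ?thesis using has_weak_deriv_imp_primitive[OF ab g] g that by metis
qed

section \<open>Norm bounds for continuous functions, multiplication and integration\<close>

lemma ip_norm_restr_class:
  assumes ab: "a \<le> b" and u: "continuous_on {a..b} u" and B: "\<And>x. x \<in> {a..b} \<Longrightarrow> \<bar>u x\<bar> \<le> B"
  shows "ip_norm (ip1 a b) (restr_class a b u) \<le> sqrt (b - a) * B"
proof -
  have s: "sqint a b (restr a b u)" using u by (rule sqint_restr)
  have B0: "0 \<le> B" using B[of a] ab by auto
  have "(\<integral>x. restr a b u x * restr a b u x \<partial>lborel) \<le> (\<integral>x. restr a b (\<lambda>_. B\<^sup>2) x \<partial>lborel)"
  proof (rule integral_mono)
    show "integrable lborel (\<lambda>x. restr a b u x * restr a b u x)" by (rule sqint_integrable_mult[OF s s])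
    show "integrable lborel (restr a b (\<lambda>_. B\<^sup>2))" by (rule restr_integrable) simp
    show "restr a b u x * restr a b u x \<le> restr a b (\<lambda>_. B\<^sup>2) x" for x
    proof (cases "x \<in> {a..b}")
      case True
      then have "\<bar>u x\<bar>\<^sup>2 \<le> B\<^sup>2" using B by (intro power_mono) auto
      then show ?thesis using True by (simp add: restr_simps power2_eq_square)
    qed (simp add: restr_simps)
  qed
  also have "\<dots> = (b - a) * B\<^sup>2" using ab by (simp add: restr_def)
  finally have "ip1 a b (restr_class a b u) (restr_class a b u) \<le> (b - a) * B\<^sup>2"
    by (simp add: restr_class_eq ip1_abs[OF s s])
  then show ?thesis
    using B0 real_sqrt_le_mono by (fastforce simp: ip_norm_def real_sqrt_mult)
qed

lemma ip_norm_restr_class_mult: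
  assumes u: "continuous_on {a..b} u" and B: "\<And>x. x \<in> {a..b} \<Longrightarrow> \<bar>u x\<bar> \<le> B" and f: "f \<in> L2 a b" and B0: "0 \<le> B"
  shows "ip_norm (ip1 a b) (restr_class a b u * f) \<le> B * ip_norm (ip1 a b) f"
proof -
  obtain f0 where f0: "sqint a b f0" "f = abs_L0 f0" using L2_cases f by blast
  have s: "sqint a b (\<lambda>x. restr a b u x * f0 x)" by (rule sqint_mult_restr[OF f0(1) u])
  have eq: "restr_class a b u * f = abs_L0 (\<lambda>x. restr a b u x * f0 x)"
    using restr_measurable[OF u] sqint_measurable[OF f0(1)] by (simp add: f0 restr_class_eq abs_L0_ops)
  have "(\<integral>x. (restr a b u x * f0 x) * (restr a b u x * f0 x) \<partial>lborel) \<le> (\<integral>x. B\<^sup>2 * (f0 x * f0 x) \<partial>lborel)"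
  proof (rule integral_mono)
    show "integrable lborel (\<lambda>x. (restr a b u x * f0 x) * (restr a b u x * f0 x))"
      by (rule sqint_integrable_mult[OF s s])
    show "integrable lborel (\<lambda>x. B\<^sup>2 * (f0 x * f0 x))"
      by (intro Bochner_Integration.integrable_mult_right sqint_integrable_mult[OF f0(1) f0(1)])
    show "(restr a b u x * f0 x) * (restr a b u x * f0 x) \<le> B\<^sup>2 * (f0 x * f0 x)" for x
    proof (cases "x \<in> {a..b}")
      case True
      then have "\<bar>u x\<bar>\<^sup>2 \<le> B\<^sup>2" using B by (intro power_mono) auto
      then have "(u x)\<^sup>2 * (f0 x)\<^sup>2 \<le> B\<^sup>2 * (f0 x)\<^sup>2" by (intro mult_right_mono) auto
      then show ?thesis using True by (simp add: restr_simps power2_eq_square mult_ac)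
    qed (simp add: restr_simps)
  qed
  then have "ip1 a b (restr_class a b u * f) (restr_class a b u * f) \<le> B\<^sup>2 * ip1 a b f f"
    unfolding eq ip1_abs[OF s s] by (simp add: f0 ip1_abs[OF f0(1) f0(1)])
  then show ?thesis
    using B0 real_sqrt_le_mono by (fastforce simp: ip_norm_def real_sqrt_mult)
qed

text \<open>Cauchy-Schwarz with the indicator of [a,x], whose norm is the square root of x -
  a.\<close>

lemma primitive_bound:
  assumes ab: "a \<le> b" and g: "g \<in> L2 a b" and x: "x \<in> {a..b}"
  shows "\<bar>primitive a b g x\<bar> \<le> sqrt (b - a) * ip_norm (ip1 a b) g"
proof -
  interpret ip_space "L2 a b" "ip1 a b" by (rule ip_space_L2_1)
  let ?o = "restr_class a x (\<lambda>_. 1)"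
  note s = sqint_restr_one[OF x]
  have o: "?o \<in> L2 a b" using sqint_L2[OF s] by (simp add: restr_class_eq)
  have "(\<lambda>t. restr a x (\<lambda>_. 1) t * restr a x (\<lambda>_. 1) t) = indicator {a..x}"
    by (auto simp: restr_def indicator_def fun_eq_iff)
  then have "ip1 a b ?o ?o = x - a" using x by (simp add: restr_class_eq ip1_abs[OF s s])
  then have "ip_norm (ip1 a b) ?o \<le> sqrt (b - a)" using x by (simp add: ip_norm_def)
  then have "ip_norm (ip1 a b) g * ip_norm (ip1 a b) ?o \<le> ip_norm (ip1 a b) g * sqrt (b - a)"
    using ip_norm_nonneg[OF g] by (rule mult_left_mono)
  then show ?thesis
    using Cauchy_Schwarz[OF g o] by (simp add: primitive_def mult.commute)
qed


section \<open>Sturm-Liouville operators\<close>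

lemma restr_class_mult_assoc:
  assumes "continuous_on {a..b} u" "continuous_on {a..b} v"
  shows "restr_class a b u * (restr_class a b v * f) = restr_class a b (\<lambda>x. u x * v x) * f"
  using restr_class_ops(3)[OF assms] by (simp add: mult.assoc)

lemma ip_norm_restr_class_mult_bound:
  assumes u: "continuous_on {a..b} u"
  obtains B where "B \<ge> 0" "\<And>f. f \<in> L2 a b \<Longrightarrow>
    ip_norm (ip1 a b) (restr_class a b u * f) \<le> B * ip_norm (ip1 a b) f"
proof -
  obtain B where B: "B > 0" "\<And>x. x \<in> {a..b} \<Longrightarrow> \<bar>u x\<bar> \<le> B"
    using continuous_on_interval_bounded[OF u] by blast
  show ?thesis
    by (rule that[of B]) (use B in \<open>auto intro!: ip_norm_restr_class_mult[OF u]\<close>)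
qed

locale sturm_liouville =
  fixes a b :: real and p dp q \<rho> :: "real \<Rightarrow> real"
  assumes ab: "a < b"
    and cont_p: "continuous_on {a..b} p" and cont_dp: "continuous_on {a..b} dp"
    and cont_q: "continuous_on {a..b} q" and cont_rho: "continuous_on {a..b} \<rho>"
    and p_deriv: "\<And>z. z \<in> {a..b} \<Longrightarrow> (p has_real_derivative dp z) (at z within {a..b})"
    and p_pos: "\<And>z. z \<in> {a..b} \<Longrightarrow> p z > 0" and rho_pos: "\<And>z. z \<in> {a..b} \<Longrightarrow> \<rho> z > 0"
begin

sublocale N: ip_space "L2 a b" "ip1 a b" by (rule ip_space_L2_1)

abbreviation "X \<equiv> L2 a b"
abbreviation "r \<equiv> restr_class a b"
abbreviation "prm \<equiv> primitive a b"
abbreviation "nrm \<equiv> ip_norm (ip1 a b)"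

lemma p_nonzero: "z \<in> {a..b} \<Longrightarrow> p z \<noteq> 0"
  using p_pos[of z] by simp

lemma cont_over_p: "continuous_on {a..b} u \<Longrightarrow> continuous_on {a..b} (\<lambda>x. u x / p x)"
  using cont_p p_nonzero by (intro continuous_on_divide) auto

lemma cont_inverse_rho: "continuous_on {a..b} (\<lambda>x. 1 / \<rho> x)"
  using cont_rho rho_pos by (intro continuous_on_divide) force+

lemma in_interval: "a \<in> {a..b}" "b \<in> {a..b}"
  using ab by auto

lemma prm_cont: "g \<in> X \<Longrightarrow> continuous_on {a..b} (prm g)"
  by (rule continuous_on_primitive)

lemma cont_affine: "g \<in> X \<Longrightarrow> continuous_on {a..b} (\<lambda>x. c + prm g x)"
  by (intro continuous_on_add continuous_on_const prm_cont)

text \<open>Integrating \<open>(p f')' = h\<close> twice gives \<open>f = d + c Q + K h\<close>, where \<open>Q\<close> is the primitive \<open>P\<close>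
  of \<open>1 / p\<close> made orthogonal to \<open>1\<close>. This orthogonality recovers the constants \<open>c\<close> and \<open>d\<close> from
  \<open>f\<close> and \<open>h\<close> by bounded functionals; \<open>U f h\<close> and \<open>V f h\<close> are the resulting expressions for \<open>f\<close>
  and \<open>f'\<close>.\<close>

definition K :: "L0 \<Rightarrow> real \<Rightarrow> real" where
  "K h = prm (r (\<lambda>x. prm h x / p x))"

definition P :: "real \<Rightarrow> real" where
  "P = prm (r (\<lambda>x. 1 / p x))"

definition Q :: "real \<Rightarrow> real" where
  "Q x = P x - ip1 a b (r P) (r (\<lambda>_. 1)) / (b - a)"

definition coeff_Q :: "L0 \<Rightarrow> L0 \<Rightarrow> real" where
  "coeff_Q f h = ip1 a b (f - r (K h)) (r Q) / ip1 a b (r Q) (r Q)"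

definition coeff_1 :: "L0 \<Rightarrow> L0 \<Rightarrow> real" where
  "coeff_1 f h = ip1 a b (f - r (K h)) (r (\<lambda>_. 1)) / (b - a)"

definition U :: "L0 \<Rightarrow> L0 \<Rightarrow> real \<Rightarrow> real" where
  "U f h x = coeff_1 f h + coeff_Q f h * Q x + K h x"

definition V :: "L0 \<Rightarrow> L0 \<Rightarrow> real \<Rightarrow> real" where
  "V f h x = (coeff_Q f h + prm h x) / p x"

lemma K_cont: "h \<in> X \<Longrightarrow> continuous_on {a..b} (K h)"
  unfolding K_def by (intro prm_cont restr_class_L2 cont_over_p)

lemma P_cont: "continuous_on {a..b} P"
  unfolding P_def by (intro prm_cont restr_class_L2 cont_over_p continuous_on_const)

lemma Q_cont: "continuous_on {a..b} Q"
  unfolding Q_def[abs_def] by (intro continuous_on_diff P_cont continuous_on_const)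

lemma U_cont: "h \<in> X \<Longrightarrow> continuous_on {a..b} (U f h)"
  unfolding U_def[abs_def]
  by (intro continuous_on_add continuous_on_mult continuous_on_const Q_cont K_cont)

lemma V_cont: "h \<in> X \<Longrightarrow> continuous_on {a..b} (V f h)"
  unfolding V_def[abs_def] by (intro cont_over_p cont_affine)

lemma r_in: "r (\<lambda>_. 1) \<in> X" "r P \<in> X" "r Q \<in> X" "h \<in> X \<Longrightarrow> r (K h) \<in> X"
  "h \<in> X \<Longrightarrow> r (U f h) \<in> X" "h \<in> X \<Longrightarrow> r (V f h) \<in> X"
  by (auto intro!: restr_class_L2 P_cont Q_cont K_cont U_cont V_cont)

lemma ip_one_one: "ip1 a b (r (\<lambda>_. 1)) (r (\<lambda>_. 1)) = b - a"
proof -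
  have s: "sqint a b (restr a b (\<lambda>_. 1))" by (rule sqint_restr) simp
  have "(\<lambda>x. restr a b (\<lambda>_. 1) x * restr a b (\<lambda>_. 1) x) = indicator {a..b}"
    by (auto simp: restr_def indicator_def fun_eq_iff)
  then show ?thesis using ab by (simp add: restr_class_eq ip1_abs[OF s s])
qed

lemma r_Q: "r Q = r P - (ip1 a b (r P) (r (\<lambda>_. 1)) / (b - a)) *\<^sub>R r (\<lambda>_. 1)"
proof -
  define m where "m = ip1 a b (r P) (r (\<lambda>_. 1)) / (b - a)"
  have "r Q = r (\<lambda>x. P x - m * 1)" by (simp add: Q_def[abs_def] m_def)
  also have "\<dots> = r P - r (\<lambda>x. m * 1)"
    by (rule restr_class_ops(2)) (auto intro: P_cont)
  also have "r (\<lambda>x. m * 1) = m *\<^sub>R r (\<lambda>_. 1)"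
    using restr_class_ops(4)[of a b "\<lambda>_. 1" "\<lambda>_. 1" m] by simp
  finally show ?thesis by (simp add: m_def)
qed

lemma ip_Q_one: "ip1 a b (r Q) (r (\<lambda>_. 1)) = 0"
  using ab by (simp add: r_Q N.ip_diff_left N.ip_scale_left r_in N.V_closed ip_one_one)

text \<open>If \<open>Q\<close> vanished, \<open>P\<close> would be constant and equal to its value
  0 at \<open>a\<close>, so 1 / p would be 0. Hence the division in \<open>coeff_Q\<close> is
  legitimate.\<close>

lemma ip_Q_pos: "ip1 a b (r Q) (r Q) > 0"
proof (rule N.ip_pos)
  show "r Q \<in> X" by (rule r_in)
  show "r Q \<noteq> 0"
  proof
    define m where "m = ip1 a b (r P) (r (\<lambda>_. 1)) / (b - a)"
    have i: "r (\<lambda>x. 1 / p x) \<in> X" by (intro restr_class_L2 cont_over_p continuous_on_const)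
    assume "r Q = 0"
    then have "r Q = r (\<lambda>_. 0)" by (simp add: restr_class_zero)
    then have Q0: "Q x = 0" if "x \<in> {a..b}" for x
      using that by (subst (asm) restr_class_eq_iff[OF ab Q_cont]) auto
    have "P a = 0" unfolding P_def using ab i by (simp add: primitive_start)
    then have "P x = 0" if "x \<in> {a..b}" for x
      using Q0[OF that] Q0[OF in_interval(1)] by (simp add: Q_def)
    then have "r (\<lambda>x. 1 / p x) = 0"
      using i by (intro primitive_eq_0[OF ab]) (auto simp: P_def)
    then have "r (\<lambda>x. 1 / p x) = r (\<lambda>_. 0)" by (simp add: restr_class_zero)
    then have "1 / p a = 0"
      using in_interval(1) cont_over_p[OF continuous_on_const, of 1]
      by (subst (asm) restr_class_eq_iff[OF ab]) auto
    then show False using p_pos[OF in_interval(1)] by simp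
  qed
qed

lemma K_linear:
  assumes f: "f \<in> X" and g: "g \<in> X" and x: "x \<in> {a..b}"
  shows "K (f + g) x = K f x + K g x" and "K (c *\<^sub>R f) x = c * K f x"
proof -
  have cf: "continuous_on {a..b} (\<lambda>x. prm f x / p x)" and cg: "continuous_on {a..b} (\<lambda>x. prm g x / p x)"
    using f g by (auto intro!: cont_over_p prm_cont)
  have "r (\<lambda>x. prm (f + g) x / p x) = r (\<lambda>x. prm f x / p x) + r (\<lambda>x. prm g x / p x)"
    unfolding restr_class_ops(1)[OF cf cg, symmetric]
    by (rule restr_class_cong) (simp add: primitive_linear f g add_divide_distrib)
  then show "K (f + g) x = K f x + K g x"
    unfolding K_def using cf cg x by (simp add: primitive_linear restr_class_L2)
  have "r (\<lambda>x. prm (c *\<^sub>R f) x / p x) = c *\<^sub>R r (\<lambda>x. prm f x / p x)"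
    unfolding restr_class_ops(4)[OF cf cf, symmetric]
    by (rule restr_class_cong) (simp add: primitive_linear(2)[OF f f])
  then show "K (c *\<^sub>R f) x = c * K f x"
    unfolding K_def using cf x by (simp add: primitive_linear(2)[of _ _ _ "r (\<lambda>x. prm f x / p x)"] restr_class_L2)
qed

lemma r_K_linear:
  assumes f: "f \<in> X" and g: "g \<in> X"
  shows "r (K (f + g)) = r (K f) + r (K g)" and "r (K (c *\<^sub>R f)) = c *\<^sub>R r (K f)"
  unfolding restr_class_ops(1)[OF K_cont[OF f] K_cont[OF g], symmetric]
    restr_class_ops(4)[OF K_cont[OF f] K_cont[OF f], symmetric]
  using f g by (auto intro!: restr_class_cong simp: K_linear)

lemma coeff_linear:
  assumes "f \<in> X" "g \<in> X" "h \<in> X" "k \<in> X"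
  shows "coeff_Q (f + g) (h + k) = coeff_Q f h + coeff_Q g k"
    and "coeff_1 (f + g) (h + k) = coeff_1 f h + coeff_1 g k"
    and "coeff_Q (c *\<^sub>R f) (c *\<^sub>R h) = c * coeff_Q f h"
    and "coeff_1 (c *\<^sub>R f) (c *\<^sub>R h) = c * coeff_1 f h"
proof -
  have eq1: "f + g - r (K (h + k)) = (f - r (K h)) + (g - r (K k))"
    using assms by (simp add: r_K_linear(1))
  have eq2: "c *\<^sub>R f - r (K (c *\<^sub>R h)) = c *\<^sub>R (f - r (K h))"
    using assms by (simp add: r_K_linear(2)[of h h] scaleR_diff_right)
  show "coeff_Q (f + g) (h + k) = coeff_Q f h + coeff_Q g k"
    and "coeff_1 (f + g) (h + k) = coeff_1 f h + coeff_1 g k"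
    and "coeff_Q (c *\<^sub>R f) (c *\<^sub>R h) = c * coeff_Q f h"
    and "coeff_1 (c *\<^sub>R f) (c *\<^sub>R h) = c * coeff_1 f h"
    unfolding coeff_Q_def coeff_1_def eq1 eq2 using assms
    by (simp_all add: N.ip_add_left N.ip_scale_left N.V_closed r_in add_divide_distrib)
qed

lemma UV_linear:
  assumes "f \<in> X" "g \<in> X" "h \<in> X" "k \<in> X" "x \<in> {a..b}"
  shows "U (f + g) (h + k) x = U f h x + U g k x" and "U (c *\<^sub>R f) (c *\<^sub>R h) x = c * U f h x"
    and "V (f + g) (h + k) x = V f h x + V g k x" and "V (c *\<^sub>R f) (c *\<^sub>R h) x = c * V f h x"
  using assms
  by (simp_all add: U_def V_def coeff_linear(1,2) coeff_linear(3,4)[of f f h h] K_linear(1) K_linear(2)[of h h]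
      primitive_linear(1) primitive_linear(2)[of h a b h] algebra_simps add_divide_distrib)

lemma UV_diff:
  assumes "f \<in> X" "g \<in> X" "h \<in> X" "k \<in> X" "x \<in> {a..b}"
  shows "U (f - g) (h - k) x = U f h x - U g k x" and "V (f - g) (h - k) x = V f h x - V g k x"
  using UV_linear(1,3)[of "f - g" g "h - k" k x] assms N.V_closed(3) by simp_all

text \<open>Primitives, multiplication by 1 / p and the pairings with \<open>Q\<close> and 1 are all
  bounded. The bound is uniform in \<open>x\<close> up to the end points, so it covers the boundary
  conditions as well.\<close>

lemma UV_bound:
  obtains C where "C \<ge> 0" "\<And>f h x. f \<in> X \<Longrightarrow> h \<in> X \<Longrightarrow> x \<in> {a..b} \<Longrightarrow>
    \<bar>U f h x\<bar> \<le> C * (nrm f + nrm h) \<and> \<bar>V f h x\<bar> \<le> C * (nrm f + nrm h)"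
proof -
  obtain Bp where Bp: "Bp > 0" "\<And>x. x \<in> {a..b} \<Longrightarrow> \<bar>1 / p x\<bar> \<le> Bp"
    using continuous_on_interval_bounded[OF cont_over_p[OF continuous_on_const, of 1]] by blast
  obtain BQ where BQ: "BQ > 0" "\<And>x. x \<in> {a..b} \<Longrightarrow> \<bar>Q x\<bar> \<le> BQ"
    using continuous_on_interval_bounded[OF Q_cont] by blast
  define w where "w = sqrt (b - a)"
  have w: "w > 0" using ab by (simp add: w_def)
  \<comment> \<open>One factor \<open>w\<close> for the inner primitive, one for passing from the
    supremum to the L^2 norm, and one for the outer primitive.\<close>
  define CK where "CK = w * (w * (w * Bp))"
  have CK: "CK \<ge> 0" using w Bp by (simp add: CK_def)
  have prm_le: "\<bar>prm h x\<bar> \<le> w * nrm h" if "h \<in> X" "x \<in> {a..b}" for h x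
    using primitive_bound[OF less_imp_le[OF ab] that] by (simp add: w_def)
  have K_le: "\<bar>K h x\<bar> \<le> CK * nrm h" if h: "h \<in> X" and x: "x \<in> {a..b}" for h x
  proof -
    have c: "continuous_on {a..b} (\<lambda>x. prm h x / p x)" by (intro cont_over_p prm_cont h)
    have "\<bar>prm h x / p x\<bar> \<le> w * nrm h * Bp" if "x \<in> {a..b}" for x
    proof -
      have "\<bar>prm h x / p x\<bar> = \<bar>prm h x\<bar> * \<bar>1 / p x\<bar>" by (simp add: abs_mult[symmetric])
      also have "\<dots> \<le> w * nrm h * Bp"
        using prm_le[OF h that] Bp(2)[OF that] w N.ip_norm_nonneg[OF h] by (intro mult_mono) auto
      finally show ?thesis .
    qed
    from ip_norm_restr_class[OF less_imp_le[OF ab] c this]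
    have "nrm (r (\<lambda>x. prm h x / p x)) \<le> w * (w * nrm h * Bp)" by (simp add: w_def)
    then have "w * nrm (r (\<lambda>x. prm h x / p x)) \<le> w * (w * (w * nrm h * Bp))"
      using w by (intro mult_left_mono) auto
    then show ?thesis
      using prm_le[OF restr_class_L2[OF c] x] by (simp add: K_def CK_def mult_ac)
  qed
  define C1 where "C1 = 1 + w * CK"
  have C1: "C1 \<ge> 1" "C1 \<ge> w * CK" using w CK by (auto simp: C1_def)
  have res_le: "nrm (f - r (K h)) \<le> C1 * (nrm f + nrm h)" if f: "f \<in> X" and h: "h \<in> X" for f h
  proof -
    have "nrm (r (K h)) \<le> w * (CK * nrm h)"
      using ip_norm_restr_class[OF less_imp_le[OF ab] K_cont[OF h] K_le[OF h]] by (simp add: w_def)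
    moreover have "nrm (f - r (K h)) \<le> nrm f + nrm (- r (K h))"
      using N.ip_norm_triangle[of f "- r (K h)"] f h by (simp add: r_in N.V_closed)
    moreover have "nrm (- r (K h)) = nrm (r (K h))"
      using N.ip_norm_scale[OF r_in(4)[OF h], of "-1"] by simp
    ultimately have "nrm (f - r (K h)) \<le> 1 * nrm f + (w * CK) * nrm h" by simp
    also have "\<dots> \<le> C1 * nrm f + C1 * nrm h"
      using C1 N.ip_norm_nonneg f h by (intro add_mono mult_right_mono) auto
    finally show ?thesis by (simp add: distrib_left)
  qed
  define DQ where "DQ = C1 * nrm (r Q) / ip1 a b (r Q) (r Q)"
  define D1 where "D1 = C1 * nrm (r (\<lambda>_. 1)) / (b - a)"
  have D0: "DQ \<ge> 0" "D1 \<ge> 0"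
    using C1 ab ip_Q_pos N.ip_norm_nonneg[OF r_in(3)] N.ip_norm_nonneg[OF r_in(1)]
    by (auto simp: DQ_def D1_def)
  have ip_le: "\<bar>ip1 a b (f - r (K h)) g\<bar> \<le> C1 * (nrm f + nrm h) * nrm g" if "f \<in> X" "h \<in> X" "g \<in> X" for f h g
  proof -
    have "\<bar>ip1 a b (f - r (K h)) g\<bar> \<le> nrm (f - r (K h)) * nrm g"
      using that by (intro N.Cauchy_Schwarz N.V_closed r_in)
    also have "\<dots> \<le> C1 * (nrm f + nrm h) * nrm g"
      using res_le that N.ip_norm_nonneg by (intro mult_right_mono) auto
    finally show ?thesis .
  qed
  have cQ: "\<bar>coeff_Q f h\<bar> \<le> DQ * (nrm f + nrm h)" and c1: "\<bar>coeff_1 f h\<bar> \<le> D1 * (nrm f + nrm h)"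
    if "f \<in> X" "h \<in> X" for f h
  proof -
    show "\<bar>coeff_Q f h\<bar> \<le> DQ * (nrm f + nrm h)"
      using divide_right_mono[OF ip_le[OF that r_in(3)] less_imp_le[OF ip_Q_pos]]
      by (simp add: coeff_Q_def DQ_def abs_of_pos[OF ip_Q_pos] mult_ac)
    show "\<bar>coeff_1 f h\<bar> \<le> D1 * (nrm f + nrm h)"
      using divide_right_mono[OF ip_le[OF that r_in(1)], of "b - a"] ab
      by (simp add: coeff_1_def D1_def mult_ac)
  qed
  \<comment> \<open>The first three summands bound \<open>U\<close>, the last one bounds
    \<open>V\<close>; the sum serves both.\<close>
  define C where "C = D1 + DQ * BQ + CK + (DQ + w) * Bp"
  have "C \<ge> 0" using D0 CK BQ Bp w by (simp add: C_def)
  moreover have "\<bar>U f h x\<bar> \<le> C * (nrm f + nrm h) \<and> \<bar>V f h x\<bar> \<le> C * (nrm f + nrm h)"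
    if f: "f \<in> X" and h: "h \<in> X" and x: "x \<in> {a..b}" for f h x
  proof
    define n where "n = nrm f + nrm h"
    have n: "0 \<le> n" "nrm h \<le> n" using N.ip_norm_nonneg f h by (auto simp: n_def)
    have "\<bar>coeff_Q f h * Q x\<bar> \<le> (DQ * n) * BQ"
      unfolding abs_mult using cQ[OF f h] BQ(2)[OF x] D0 n by (intro mult_mono) (auto simp: n_def)
    moreover have "\<bar>K h x\<bar> \<le> CK * n"
      using K_le[OF h x] mult_left_mono[OF n(2) CK] by linarith
    moreover have "\<bar>coeff_1 f h\<bar> \<le> D1 * n" using c1[OF f h] by (simp add: n_def)
    ultimately have "\<bar>U f h x\<bar> \<le> D1 * n + (DQ * n) * BQ + CK * n"
      unfolding U_def by linarith
    also have "\<dots> \<le> C * n"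
    proof -
      have "0 \<le> (DQ + w) * Bp * n" using D0 w Bp n by simp
      then show ?thesis by (simp add: C_def algebra_simps)
    qed
    finally show "\<bar>U f h x\<bar> \<le> C * (nrm f + nrm h)" by (simp add: n_def)
    have "\<bar>coeff_Q f h + prm h x\<bar> \<le> (DQ + w) * n"
      using cQ[OF f h] prm_le[OF h x] mult_left_mono[OF n(2) less_imp_le[OF w]]
      by (simp add: n_def[symmetric] distrib_right)
    then have "\<bar>coeff_Q f h + prm h x\<bar> * \<bar>1 / p x\<bar> \<le> (DQ + w) * n * Bp"
      using Bp(2)[OF x] D0 w n by (intro mult_mono) auto
    then have "\<bar>V f h x\<bar> \<le> (DQ + w) * n * Bp"
      by (simp add: V_def abs_mult[symmetric])
    also have "\<dots> \<le> C * n"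
    proof -
      have "0 \<le> (D1 + DQ * BQ + CK) * n" using D0 CK BQ n by simp
      then show ?thesis by (simp add: C_def algebra_simps)
    qed
    finally show "\<bar>V f h x\<bar> \<le> C * (nrm f + nrm h)" by (simp add: n_def)
  qed
  ultimately show ?thesis by (rule that)
qed

section \<open>The differential equation as an integral equation\<close>

lemma prm_affine:
  assumes h: "h \<in> X" and x: "x \<in> {a..b}"
  shows "prm (r (\<lambda>x. (c + prm h x) / p x)) x = c * P x + K h x"
proof -
  have c1: "continuous_on {a..b} (\<lambda>x. 1 / p x)" and c2: "continuous_on {a..b} (\<lambda>x. prm h x / p x)"
    and c3: "continuous_on {a..b} (\<lambda>x. c * (1 / p x))"
    using h by (auto intro!: cont_over_p prm_cont continuous_on_mult[OF continuous_on_const])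
  have "r (\<lambda>x. (c + prm h x) / p x) = r (\<lambda>x. c * (1 / p x) + prm h x / p x)"
    by (simp add: add_divide_distrib)
  also have "\<dots> = c *\<^sub>R r (\<lambda>x. 1 / p x) + r (\<lambda>x. prm h x / p x)"
    unfolding restr_class_ops(1)[OF c3 c2] restr_class_ops(4)[OF c1 c1] ..
  finally show ?thesis
    using x restr_class_L2[OF c1] restr_class_L2[OF c2]
    by (simp add: P_def K_def primitive_linear(1) primitive_linear(2)[of _ _ _ "r (\<lambda>x. 1 / p x)"] N.V_closed)
qed

lemma coeffs_unique:
  assumes h: "h \<in> X" and f: "f = r (\<lambda>x. d + c * Q x + K h x)"
  shows "coeff_Q f h = c" "coeff_1 f h = d"
proof -
  have cc: "continuous_on {a..b} (\<lambda>x. d * 1)" "continuous_on {a..b} (\<lambda>x. c * Q x)"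
    "continuous_on {a..b} (\<lambda>x. d * 1 + c * Q x)"
    by (intro continuous_on_add continuous_on_mult continuous_on_const Q_cont)+
  have "f = r (\<lambda>x. (d * 1 + c * Q x) + K h x)" by (simp add: f)
  also have "\<dots> = d *\<^sub>R r (\<lambda>_. 1) + c *\<^sub>R r Q + r (K h)"
    unfolding restr_class_ops(1)[OF cc(3) K_cont[OF h]] restr_class_ops(1)[OF cc(1,2)]
      restr_class_ops(4)[OF Q_cont Q_cont] restr_class_ops(4)[of a b "\<lambda>_. 1" "\<lambda>_. 1" d, OF continuous_on_const continuous_on_const] ..
  finally have "f - r (K h) = d *\<^sub>R r (\<lambda>_. 1) + c *\<^sub>R r Q" by simp
  then show "coeff_Q f h = c" "coeff_1 f h = d"
    using ip_Q_pos ip_Q_one ip_one_one ab N.ip_commute[OF r_in(3) r_in(1)]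
    by (simp_all add: coeff_Q_def coeff_1_def N.ip_add_left N.ip_scale_left r_in N.V_closed)
qed

text \<open>The hypothesis is an implicit equation, since \<open>f\<close> also enters its
  coefficients. Differentiating once gives \<open>V\<close>; then p V is a constant plus the
  primitive of \<open>h\<close>, so (p f')' = h. Membership of \<open>f'\<close> in
  \<open>H1\<close> comes from the product rule with the factor 1 / p.\<close>

lemma H2_of_U:
  assumes h: "h \<in> X" and f: "f = r (U f h)"
  shows "f \<in> H2 a b" "weak_deriv a b f = r (V f h)"
    "SL_op a b p q \<rho> f = r (\<lambda>z. 1 / \<rho> z) * (r q * f - h)"
proof -
  let ?c = "coeff_Q f h"
  have fX: "f \<in> X" using r_in(5)[OF h, of f] f by simp
  have vX: "r (V f h) \<in> X" by (rule r_in(6)[OF h])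
  \<comment> \<open>\<open>m\<close> is the mean subtracted from \<open>P\<close> in
    \<open>Q\<close>; the constant term is shifted to undo this normalization.\<close>
  define m where "m = ip1 a b (r P) (r (\<lambda>_. 1)) / (b - a)"
  have prm_V: "prm (r (V f h)) x = ?c * P x + K h x" if "x \<in> {a..b}" for x
    using prm_affine[OF h that, of ?c] by (simp add: V_def[abs_def])
  have "r (U f h) = r (\<lambda>x. (coeff_1 f h - ?c * m) + prm (r (V f h)) x)"
    by (rule restr_class_cong) (simp add: U_def prm_V Q_def m_def algebra_simps)
  then have D1: "has_weak_deriv a b f (r (V f h))"
    using has_weak_deriv_primitive[OF ab vX, of "coeff_1 f h - ?c * m"] f by simp
  then show fv: "weak_deriv a b f = r (V f h)" by (rule H1I(2)[OF ab fX vX])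
  let ?\<theta>' = "\<lambda>x. - dp x / (p x * p x)"
  have \<theta>: "((\<lambda>x. 1 / p x) has_real_derivative ?\<theta>' x) (at x within {a..b})" if "x \<in> {a..b}" for x
    using p_deriv[OF that] p_nonzero[OF that] by (auto intro!: derivative_eq_intros)
  have \<theta>': "continuous_on {a..b} ?\<theta>'"
    using p_nonzero by (intro continuous_on_divide continuous_on_minus continuous_on_mult cont_dp cont_p) auto
  have i: "continuous_on {a..b} (\<lambda>x. 1 / p x)" by (intro cont_over_p continuous_on_const)
  have eq: "r (V f h) = r (\<lambda>x. 1 / p x * (?c + prm h x))" by (simp add: V_def[abs_def])
  let ?w = "r (\<lambda>x. 1 / p x) * h + r (\<lambda>x. ?\<theta>' x * (?c + prm h x))"
  have "has_weak_deriv a b (r (V f h)) ?w"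
    unfolding eq by (rule has_weak_deriv_mult[OF ab h \<theta> \<theta>'])
  moreover have "?w \<in> X"
    by (intro N.V_closed restr_class_mult_L2 restr_class_L2 i h continuous_on_mult \<theta>' cont_affine)
  ultimately have "r (V f h) \<in> H1 a b" using vX by (auto simp: H1_def)
  then show "f \<in> H2 a b" using H1I(1)[OF ab fX vX D1] fv by (simp add: H2_def)
  have pv: "r p * r (V f h) = r (\<lambda>x. ?c + prm h x)"
    unfolding restr_class_ops(3)[OF cont_p V_cont[OF h], symmetric]
    by (rule restr_class_cong) (use p_nonzero in \<open>auto simp: V_def\<close>)
  have "- (r p * r (V f h)) = r (\<lambda>x. - ?c + prm (- h) x)"
    unfolding pv restr_class_ops(5)[OF cont_affine[OF h] cont_affine[OF h], symmetric]
    by (rule restr_class_cong) (use primitive_linear(2)[OF h h, of _ "-1"] in simp)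
  then have "has_weak_deriv a b (- (r p * r (V f h))) (- h)"
    using has_weak_deriv_primitive[OF ab, of "- h" "- ?c"] h by (simp add: N.V_closed)
  then have "weak_deriv a b (- (r p * r (V f h))) = - h"
    using h by (intro weak_deriv_eqI[OF ab]) (auto intro!: N.V_closed restr_class_mult_L2 cont_p vX)
  then show "SL_op a b p q \<rho> f = r (\<lambda>z. 1 / \<rho> z) * (r q * f - h)"
    unfolding SL_op_def fv by simp
qed

lemma U_of_H2:
  assumes f: "f \<in> H2 a b"
  obtains h where "h \<in> X" "f = r (U f h)"
proof -
  let ?v = "weak_deriv a b f"
  have f1: "f \<in> H1 a b" and v1: "?v \<in> H1 a b" using f by (auto simp: H2_def)
  obtain d0 where vX: "?v \<in> X" and fd: "f = r (\<lambda>x. d0 + prm ?v x)" using H1D[OF ab f1] by blast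
  obtain c0 where wX: "weak_deriv a b ?v \<in> X" and vc: "?v = r (\<lambda>x. c0 + prm (weak_deriv a b ?v) x)"
    using H1D[OF ab v1] by blast
  let ?u = "\<lambda>x. c0 + prm (weak_deriv a b ?v) x"
  \<comment> \<open>This is the product rule for (p f')', with the continuous representative of
    \<open>f'\<close> in the second term.\<close>
  define h where "h = r p * weak_deriv a b ?v + r (\<lambda>x. dp x * ?u x)"
  have hX: "h \<in> X"
    unfolding h_def
    by (intro N.V_closed restr_class_mult_L2 restr_class_L2 cont_p wX continuous_on_mult cont_dp cont_affine)
  have pu: "continuous_on {a..b} (\<lambda>x. p x * ?u x)" by (intro continuous_on_mult cont_p cont_affine wX)
  have "has_weak_deriv a b (r (\<lambda>x. p x * ?u x)) h"
    unfolding h_def by (rule has_weak_deriv_mult[OF ab wX p_deriv cont_dp])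
  then obtain c where c: "r (\<lambda>x. p x * ?u x) = r (\<lambda>x. c + prm h x)"
    using has_weak_deriv_imp_primitive[OF ab restr_class_L2[OF pu] hX] by blast
  have "?u x = (c + prm h x) / p x" if "x \<in> {a..b}" for x
    using c that p_nonzero[OF that]
    by (subst (asm) restr_class_eq_iff[OF ab pu cont_affine[OF hX]]) (auto simp: field_simps)
  then have "?v = r (\<lambda>x. (c + prm h x) / p x)" by (subst vc) (rule restr_class_cong)
  then have pv: "prm ?v x = c * P x + K h x" if "x \<in> {a..b}" for x
    using prm_affine[OF hX that] by simp
  define m where "m = ip1 a b (r P) (r (\<lambda>_. 1)) / (b - a)"
  have fr: "f = r (\<lambda>x. (d0 + c * m) + c * Q x + K h x)"
    by (subst fd) (rule restr_class_cong, simp add: pv Q_def m_def algebra_simps)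
  have "f = r (U f h)"
    unfolding U_def[abs_def] coeffs_unique[OF hX fr] by (rule fr)
  then show ?thesis using that hX by blast
qed

text \<open>The value of (p f')' when the differential expression maps \<open>f\<close> to
  \<open>g\<close>: the equation -(p f')' + q f = \<rho> g solved for its leading term.\<close>

definition rhs :: "L0 \<Rightarrow> L0 \<Rightarrow> L0" where
  "rhs f g = r q * f - r \<rho> * g"

lemma rhs_in: "f \<in> X \<Longrightarrow> g \<in> X \<Longrightarrow> rhs f g \<in> X"
  unfolding rhs_def by (intro N.V_closed restr_class_mult_L2 cont_q cont_rho)

lemma r_rho_cancel:
  assumes "f \<in> X"
  shows "r \<rho> * (r (\<lambda>z. 1 / \<rho> z) * f) = f" "r (\<lambda>z. 1 / \<rho> z) * (r \<rho> * f) = f"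
proof -
  have "r (\<lambda>z. \<rho> z * (1 / \<rho> z)) = r (\<lambda>_. 1)" "r (\<lambda>z. 1 / \<rho> z * \<rho> z) = r (\<lambda>_. 1)"
    using rho_pos by (auto intro!: restr_class_cong simp: less_imp_neq[symmetric])
  then show "r \<rho> * (r (\<lambda>z. 1 / \<rho> z) * f) = f" "r (\<lambda>z. 1 / \<rho> z) * (r \<rho> * f) = f"
    using assms cont_rho cont_inverse_rho
    by (simp_all only: restr_class_mult_assoc restr_class_one_mult)
qed

lemma H2_X: "f \<in> H2 a b \<Longrightarrow> f \<in> X"
  by (simp add: H2_def H1_def)

text \<open>Regularity and the differential equation together become one identity between classes.
  Both sides depend continuously on \<open>f\<close> and \<open>g\<close>, and weak derivatives no
  longer occur.\<close>

lemma SL_characterization: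
  assumes f: "f \<in> X" and g: "g \<in> X"
  shows "f \<in> H2 a b \<and> SL_op a b p q \<rho> f = g \<longleftrightarrow> f = r (U f (rhs f g))"
proof
  assume "f \<in> H2 a b \<and> SL_op a b p q \<rho> f = g"
  then have f2: "f \<in> H2 a b" and fg: "SL_op a b p q \<rho> f = g" by auto
  obtain h where h: "h \<in> X" "f = r (U f h)" using U_of_H2[OF f2] by blast
  have "r q * f - h \<in> X" using f h by (intro N.V_closed restr_class_mult_L2 cont_q)
  then have "r \<rho> * g = r q * f - h"
    using H2_of_U(3)[OF h] fg r_rho_cancel(1) by simp
  then have "rhs f g = h" by (simp add: rhs_def)
  then show "f = r (U f (rhs f g))" using h by simp
next
  assume eq: "f = r (U f (rhs f g))"
  note * = H2_of_U[OF rhs_in[OF f g] eq]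
  have "SL_op a b p q \<rho> f = r (\<lambda>z. 1 / \<rho> z) * (r \<rho> * g)" unfolding *(3) by (simp add: rhs_def)
  then show "f \<in> H2 a b \<and> SL_op a b p q \<rho> f = g" using *(1) r_rho_cancel(2)[OF g] by simp
qed

lemma SL_op_in:
  assumes "f \<in> H2 a b"
  shows "SL_op a b p q \<rho> f \<in> X"
proof -
  obtain h where h: "h \<in> X" "f = r (U f h)" using U_of_H2[OF assms] by blast
  show ?thesis
    unfolding H2_of_U(3)[OF h]
    by (intro N.V_closed restr_class_mult_L2 cont_q cont_inverse_rho H2_X assms h(1))
qed

lemma point_values:
  assumes f: "f \<in> X" and g: "g \<in> X" and eq: "f = r (U f (rhs f g))" and x: "x \<in> {a..b}"
  shows "point_value a b f x = U f (rhs f g) x" "point_value a b (weak_deriv a b f) x = V f (rhs f g) x"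
proof -
  note h = rhs_in[OF f g]
  have "point_value a b (r (U f (rhs f g))) x = U f (rhs f g) x"
    by (rule point_value_restr[OF ab U_cont[OF h] x])
  then show "point_value a b f x = U f (rhs f g) x" using eq by simp
  show "point_value a b (weak_deriv a b f) x = V f (rhs f g) x"
    unfolding H2_of_U(2)[OF h eq] by (rule point_value_restr[OF ab V_cont[OF h] x])
qed

lemma rhs_linear:
  "rhs (f + f') (g + g') = rhs f g + rhs f' g'" "rhs (c *\<^sub>R f) (c *\<^sub>R g) = c *\<^sub>R rhs f g"
  "rhs (f - f') (g - g') = rhs f g - rhs f' g'"
  by (simp_all add: rhs_def algebra_simps)

text \<open>Allows the implicit equation of \<open>SL_characterization\<close> to be added and
  scaled.\<close>

lemma r_U_linear:
  assumes "f \<in> X" "f' \<in> X" "h \<in> X" "h' \<in> X"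
  shows "r (U (f + f') (h + h')) = r (U f h) + r (U f' h')" "r (U (c *\<^sub>R f) (c *\<^sub>R h)) = c *\<^sub>R r (U f h)"
  unfolding restr_class_ops(1)[OF U_cont[OF assms(3)] U_cont[OF assms(4)], symmetric]
    restr_class_ops(4)[OF U_cont[OF assms(3)] U_cont[OF assms(3)], symmetric]
  using assms by (auto intro!: restr_class_cong simp: UV_linear(1) UV_linear(2)[of f f h h])

lemma UV_zero: "x \<in> {a..b} \<Longrightarrow> U 0 0 x = 0" "x \<in> {a..b} \<Longrightarrow> V 0 0 x = 0"
  using UV_linear(2,4)[of 0 0 0 0 x 0] N.V_closed(1) by auto

lemma r_U_zero: "r (U 0 0) = 0"
  using restr_class_cong[of a b "U 0 0" "\<lambda>_. 0"] by (simp add: UV_zero restr_class_zero)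

section \<open>The operator with its boundary conditions\<close>

context
  fixes \<alpha>a \<beta>a \<alpha>b \<beta>b :: real
begin

abbreviation "DA \<equiv> SL_dom a b \<alpha>a \<beta>a \<alpha>b \<beta>b"
abbreviation "A \<equiv> \<lambda>f. - SL_op a b p q \<rho> f"
abbreviation "ipX \<equiv> ip_weighted a b \<rho>"

text \<open>The boundary conditions, with the end point values of \<open>f\<close> and
  \<open>f'\<close> replaced by the bounded functionals \<open>U\<close> and
  \<open>V\<close>.\<close>

definition bc :: "L0 \<Rightarrow> L0 \<Rightarrow> bool" where
  "bc f h \<longleftrightarrow> \<alpha>a * V f h a + \<beta>a * U f h a = 0 \<and> \<alpha>b * V f h b + \<beta>b * U f h b = 0"

text \<open>\<open>A\<close> is the negative of the differential expression, whence
  \<open>- g\<close> in \<open>rhs\<close>. The boundary conditions can be rewritten because the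
  integral equation already identifies the point values.\<close>

lemma SL_dom_characterization:
  assumes f: "f \<in> X" and g: "g \<in> X"
  shows "f \<in> DA \<and> A f = g \<longleftrightarrow> f = r (U f (rhs f (- g))) \<and> bc f (rhs f (- g))"
proof -
  have g': "- g \<in> X" using g by (rule N.V_closed)
  have "A f = g \<longleftrightarrow> SL_op a b p q \<rho> f = - g" by (auto simp: minus_equation_iff)
  moreover have "f \<in> DA \<longleftrightarrow> f \<in> H2 a b \<and> bc f (rhs f (- g))" if "f = r (U f (rhs f (- g)))"
    unfolding SL_dom_def bc_def
    using point_values[OF f g' that in_interval(1)] point_values[OF f g' that in_interval(2)] by auto
  ultimately show ?thesis
    using SL_characterization[OF f g'] by (auto simp: SL_dom_def)
qed

lemma DA_X: "f \<in> DA \<Longrightarrow> f \<in> X"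
  by (auto simp: SL_dom_def H2_X)

lemma A_in: "f \<in> DA \<Longrightarrow> A f \<in> X"
  using SL_op_in by (auto simp: SL_dom_def intro: N.V_closed)

text \<open>Additivity is read off from the characterization of the graph, where \<open>U\<close>,
  \<open>V\<close> and \<open>rhs\<close> are visibly additive, rather than from the definite
  descriptions in the operator and its domain.\<close>

lemma A_add:
  assumes f: "f \<in> DA" and g: "g \<in> DA"
  shows "f + g \<in> DA \<and> A (f + g) = A f + A g"
proof -
  have X: "f \<in> X" "g \<in> X" "A f \<in> X" "A g \<in> X" "f + g \<in> X" "A f + A g \<in> X"
    by (intro DA_X f g A_in N.V_closed(2))+
  have h: "rhs f (- A f) \<in> X" "rhs g (- A g) \<in> X"
    by (intro rhs_in N.V_closed(4) X)+
  have f': "f = r (U f (rhs f (- A f)))" "bc f (rhs f (- A f))"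
    and g': "g = r (U g (rhs g (- A g)))" "bc g (rhs g (- A g))"
    using SL_dom_characterization[OF X(1,3)] SL_dom_characterization[OF X(2,4)] f g by blast+
  have sum: "rhs (f + g) (- (A f + A g)) = rhs f (- A f) + rhs g (- A g)"
    unfolding rhs_linear(1)[symmetric] by (simp add: add.commute)
  show ?thesis
    unfolding SL_dom_characterization[OF X(5,6)] sum r_U_linear(1)[OF X(1,2) h]
  proof
    show "f + g = r (U f (rhs f (- A f))) + r (U g (rhs g (- A g)))" using f'(1) g'(1) by metis
    show "bc (f + g) (rhs f (- A f) + rhs g (- A g))"
      using f'(2) g'(2) unfolding bc_def
      by (simp only: UV_linear(1,3)[OF X(1,2) h in_interval(1)] UV_linear(1,3)[OF X(1,2) h in_interval(2)])
        (simp add: algebra_simps)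
  qed
qed

lemma A_scale:
  assumes f: "f \<in> DA"
  shows "c *\<^sub>R f \<in> DA \<and> A (c *\<^sub>R f) = c *\<^sub>R A f"
proof -
  have X: "f \<in> X" "A f \<in> X" "c *\<^sub>R f \<in> X" "c *\<^sub>R A f \<in> X"
    by (intro DA_X f A_in N.V_closed(5))+
  have h: "rhs f (- A f) \<in> X" by (intro rhs_in N.V_closed(4) X)
  have f': "f = r (U f (rhs f (- A f)))" "bc f (rhs f (- A f))"
    using SL_dom_characterization[OF X(1,2)] f by blast+
  have scale: "rhs (c *\<^sub>R f) (- (c *\<^sub>R A f)) = c *\<^sub>R rhs f (- A f)"
    unfolding rhs_linear(2)[symmetric] by simp
  show ?thesis
    unfolding SL_dom_characterization[OF X(3,4)] scale r_U_linear(2)[OF X(1,1) h h]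
  proof
    show "c *\<^sub>R f = c *\<^sub>R r (U f (rhs f (- A f)))" using f'(1) by metis
    show "bc (c *\<^sub>R f) (c *\<^sub>R rhs f (- A f))"
      using f'(2) unfolding bc_def
      by (simp only: UV_linear(2,4)[OF X(1,1) h h in_interval(1)] UV_linear(2,4)[OF X(1,1) h h in_interval(2)])
        (simp add: mult.left_commute[of _ c] distrib_left[symmetric])
  qed
qed

lemma DA_zero: "0 \<in> DA"
proof -
  have "rhs 0 (- 0) = 0" by (simp add: rhs_def)
  then show ?thesis
    using SL_dom_characterization[OF N.V_closed(1) N.V_closed(1)]
    by (simp add: r_U_zero bc_def UV_zero[OF in_interval(1)] UV_zero[OF in_interval(2)])
qed

lemma linear_A: "linear_operator_on X DA A"
  unfolding linear_operator_on_def
  using A_add A_scale DA_zero DA_X A_in by (auto simp: subspace_def)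

text \<open>Convergence of \<open>s n\<close> and \<open>A (s n)\<close> carries over to the
  right-hand sides \<open>h n\<close>. By \<open>UV_bound\<close> the functions
  \<open>U (s n) (h n)\<close> and \<open>V (s n) (h n)\<close> then converge uniformly on [a,b], so
  the integral equation and both boundary conditions pass to the limit.\<close>

lemma closed_A: "closed_operator_on X ipX DA A"
  unfolding closed_operator_on_def
proof (intro conjI allI ballI impI linear_A; elim conjE)
  fix s f g
  assume f: "f \<in> X" and g: "g \<in> X" and s: "\<forall>n. s n \<in> DA"
    and sf: "ip_tendsto ipX s f" and Asg: "ip_tendsto ipX (\<lambda>n. A (s n)) g"
  have sX: "s n \<in> X" and AsX: "A (s n) \<in> X" for n using s DA_X A_in by blast+
  obtain m M where m: "m > 0" and "M > 0"
    and le_m: "\<And>f. f \<in> X \<Longrightarrow> nrm f \<le> m * ip_norm ipX f"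
    and "\<And>f. f \<in> X \<Longrightarrow> ip_norm ipX f \<le> M * nrm f"
    using ip_weighted_bounds[OF cont_rho rho_pos] by blast
  have sf1: "ip_tendsto (ip1 a b) s f"
    by (rule ip_tendsto_bound[OF sf le_m]) (use sX f in \<open>auto intro: N.V_closed N.ip_norm_nonneg\<close>)
  have Asg1: "ip_tendsto (ip1 a b) (\<lambda>n. A (s n)) g"
    by (rule ip_tendsto_bound[OF Asg le_m]; intro N.V_closed(3) N.ip_norm_nonneg AsX g)
  obtain Bq where Bq: "Bq \<ge> 0" "\<And>f. f \<in> X \<Longrightarrow> nrm (r q * f) \<le> Bq * nrm f"
    using ip_norm_restr_class_mult_bound[OF cont_q] by blast
  obtain Br where Br: "Br \<ge> 0" "\<And>f. f \<in> X \<Longrightarrow> nrm (r \<rho> * f) \<le> Br * nrm f"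
    using ip_norm_restr_class_mult_bound[OF cont_rho] by blast
  define h where "h n = rhs (s n) (- A (s n))" for n
  define k where "k = rhs f (- g)"
  have hX: "h n \<in> X" for n unfolding h_def by (intro rhs_in sX N.V_closed AsX)
  have kX: "k \<in> X" unfolding k_def by (intro rhs_in f N.V_closed g)
  have sn: "s n = r (U (s n) (h n))" "bc (s n) (h n)" for n
    using SL_dom_characterization[OF sX AsX, of n n] s unfolding h_def by blast+
  define e where "e n = nrm (s n - f) + nrm (h n - k)" for n
  have e: "e \<longlonglongrightarrow> 0"
  proof -
    have le: "nrm (h n - k) \<le> Bq * nrm (s n - f) + Br * nrm (A (s n) - g)" for n
    proof -
      have "h n - k = r q * (s n - f) + r \<rho> * (A (s n) - g)"
        by (simp add: h_def k_def rhs_def algebra_simps)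
      moreover have "nrm (r q * (s n - f) + r \<rho> * (A (s n) - g)) \<le> nrm (r q * (s n - f)) + nrm (r \<rho> * (A (s n) - g))"
        by (intro N.ip_norm_triangle restr_class_mult_L2 cont_q cont_rho N.V_closed(3) sX f AsX g)
      ultimately show ?thesis
        using Bq(2)[OF N.V_closed(3)[OF sX f]] Br(2)[OF N.V_closed(3)[OF AsX g]] by (smt (verit))
    qed
    have "(\<lambda>n. Bq * nrm (s n - f) + Br * nrm (A (s n) - g)) \<longlonglongrightarrow> Bq * 0 + Br * 0"
      using sf1 Asg1 unfolding ip_tendsto_def by (intro tendsto_intros)
    then have lim: "(\<lambda>n. Bq * nrm (s n - f) + Br * nrm (A (s n) - g)) \<longlonglongrightarrow> 0" by simp
    have "(\<lambda>n. nrm (h n - k)) \<longlonglongrightarrow> 0"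
      by (rule Lim_null_comparison[OF _ lim])
        (use le N.ip_norm_nonneg[OF N.V_closed(3)[OF hX kX]] in \<open>auto intro!: always_eventually\<close>)
    then show ?thesis
      using sf1 tendsto_add[of "\<lambda>n. nrm (s n - f)" 0 _ "\<lambda>n. nrm (h n - k)" 0]
      by (simp add: ip_tendsto_def e_def[abs_def])
  qed
  obtain C where C: "C \<ge> 0" "\<And>f h x. f \<in> X \<Longrightarrow> h \<in> X \<Longrightarrow> x \<in> {a..b} \<Longrightarrow>
    \<bar>U f h x\<bar> \<le> C * (nrm f + nrm h) \<and> \<bar>V f h x\<bar> \<le> C * (nrm f + nrm h)"
    using UV_bound by blast
  have diff: "\<bar>U (s n) (h n) x - U f k x\<bar> \<le> C * e n" "\<bar>V (s n) (h n) x - V f k x\<bar> \<le> C * e n"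
    if x: "x \<in> {a..b}" for n x
    using C(2)[OF N.V_closed(3)[OF sX f] N.V_closed(3)[OF hX kX] x, of n n]
    unfolding UV_diff[OF sX f hX kX x] e_def by auto
  have Ce: "(\<lambda>n. C * e n) \<longlonglongrightarrow> 0" using tendsto_mult_right_zero[OF e] by simp
  have U_lim: "(\<lambda>n. U (s n) (h n) x) \<longlonglongrightarrow> U f k x" and V_lim: "(\<lambda>n. V (s n) (h n) x) \<longlonglongrightarrow> V f k x"
    if x: "x \<in> {a..b}" for x
    by (rule LIM_zero_cancel, rule Lim_null_comparison[OF _ Ce], use diff[OF x] in \<open>auto intro!: always_eventually\<close>)+
  have "bc f k"
    unfolding bc_def
  proof
    have "(\<lambda>n. \<alpha>a * V (s n) (h n) a + \<beta>a * U (s n) (h n) a) \<longlonglongrightarrow> \<alpha>a * V f k a + \<beta>a * U f k a"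
      by (intro tendsto_intros U_lim V_lim in_interval)
    then show "\<alpha>a * V f k a + \<beta>a * U f k a = 0"
      using sn(2) by (simp add: bc_def LIMSEQ_const_iff)
    have "(\<lambda>n. \<alpha>b * V (s n) (h n) b + \<beta>b * U (s n) (h n) b) \<longlonglongrightarrow> \<alpha>b * V f k b + \<beta>b * U f k b"
      by (intro tendsto_intros U_lim V_lim in_interval)
    then show "\<alpha>b * V f k b + \<beta>b * U f k b = 0"
      using sn(2) by (simp add: bc_def LIMSEQ_const_iff)
  qed
  \<comment> \<open>\<open>s n\<close> equals \<open>r (U (s n) (h n))\<close>, which tends to
    \<open>r (U f k)\<close>; uniqueness of limits identifies this with \<open>f\<close>.\<close>
  moreover have "f = r (U f k)"
  proof (rule N.ip_tendsto_unique[OF sf1 _ sX f r_in(5)[OF kX]])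
    have "nrm (s n - r (U f k)) \<le> sqrt (b - a) * (C * e n)" for n
    proof -
      have "s n - r (U f k) = r (\<lambda>x. U (s n) (h n) x - U f k x)"
        using restr_class_ops(2)[OF U_cont[OF hX] U_cont[OF kX]] sn(1) by metis
      moreover have "nrm (r (\<lambda>x. U (s n) (h n) x - U f k x)) \<le> sqrt (b - a) * (C * e n)"
        by (intro ip_norm_restr_class less_imp_le[OF ab] continuous_on_diff U_cont hX kX diff)
      ultimately show ?thesis by simp
    qed
    then have le: "norm (nrm (s n - r (U f k))) \<le> sqrt (b - a) * (C * e n)" for n
      using N.ip_norm_nonneg[OF N.V_closed(3)[OF sX[of n] r_in(5)[OF kX, of f]]] by simp
    have lim: "(\<lambda>n. sqrt (b - a) * (C * e n)) \<longlonglongrightarrow> 0" using tendsto_mult_right_zero[OF Ce] by simp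
    show "ip_tendsto (ip1 a b) s (r (U f k))"
      unfolding ip_tendsto_def by (rule Lim_null_comparison[OF always_eventually[OF allI[OF le]] lim])
  qed
  ultimately show "f \<in> DA" "A f = g"
    using SL_dom_characterization[OF f g] by (auto simp: k_def)
qed

section \<open>Point evaluation in the graph norm\<close>

lemma point_value_A:
  assumes "f \<in> DA" "x \<in> {a..b}"
  shows "point_value a b f x = U f (rhs f (- A f)) x"
proof -
  have "f = r (U f (rhs f (- A f)))"
    using SL_dom_characterization[OF DA_X A_in] assms(1) by blast
  then show ?thesis
    by (rule point_values(1)[OF DA_X[OF assms(1)] N.V_closed(4)[OF A_in[OF assms(1)]] _ assms(2)])
qed

lemma continuous_on_point_value:
  assumes "f \<in> DA"
  shows "continuous_on {a..b} (point_value a b f)" "f = r (point_value a b f)"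
proof -
  let ?h = "rhs f (- A f)"
  have h: "?h \<in> X" by (intro rhs_in DA_X N.V_closed(4) A_in assms)
  show "continuous_on {a..b} (point_value a b f)"
    by (rule continuous_on_eq[OF U_cont[OF h, of f]]) (simp add: point_value_A[OF assms])
  have "f = r (U f ?h)"
    using SL_dom_characterization[OF DA_X A_in] assms by blast
  also have "\<dots> = r (point_value a b f)"
    by (rule restr_class_cong) (simp add: point_value_A[OF assms])
  finally show "f = r (point_value a b f)" .
qed

lemma point_value_linear:
  assumes f: "f \<in> DA" and g: "g \<in> DA" and x: "x \<in> {a..b}"
  shows "point_value a b (f + g) x = point_value a b f x + point_value a b g x"
    and "point_value a b (c *\<^sub>R f) x = c * point_value a b f x"
proof -
  have X: "f \<in> X" "g \<in> X" "rhs f (- A f) \<in> X" "rhs g (- A g) \<in> X"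
    by (intro DA_X f g rhs_in N.V_closed(4) A_in)+
  have "rhs (f + g) (- A (f + g)) = rhs f (- A f) + rhs g (- A g)"
    using A_add[OF f g] unfolding rhs_linear(1)[symmetric] by (simp add: add.commute)
  then show "point_value a b (f + g) x = point_value a b f x + point_value a b g x"
    using UV_linear(1)[OF X x] point_value_A[OF f x] point_value_A[OF g x]
      point_value_A[OF conjunct1[OF A_add[OF f g]] x] by simp
  have "rhs (c *\<^sub>R f) (- A (c *\<^sub>R f)) = c *\<^sub>R rhs f (- A f)"
    using A_scale[OF f, of c] unfolding rhs_linear(2)[symmetric] by simp
  then show "point_value a b (c *\<^sub>R f) x = c * point_value a b f x"
    using UV_linear(2)[OF X(1,1,3,3) x] point_value_A[OF f x]
      point_value_A[OF conjunct1[OF A_scale[OF f]] x] by simp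
qed

text \<open>The point value is \<open>U\<close> at the pair of \<open>f\<close> and
  \<open>q f + \<rho> A f\<close>, and the norm of the latter is controlled by those of
  \<open>f\<close> and \<open>A f\<close>.\<close>

lemma point_value_bound:
  obtains C where "C \<ge> 0" "\<And>f x. f \<in> DA \<Longrightarrow> x \<in> {a..b} \<Longrightarrow>
    \<bar>point_value a b f x\<bar> \<le> C * (ip_norm ipX f + ip_norm ipX (A f))"
proof -
  obtain C where C: "C \<ge> 0" "\<And>f h x. f \<in> X \<Longrightarrow> h \<in> X \<Longrightarrow> x \<in> {a..b} \<Longrightarrow>
    \<bar>U f h x\<bar> \<le> C * (nrm f + nrm h) \<and> \<bar>V f h x\<bar> \<le> C * (nrm f + nrm h)"
    using UV_bound by blast
  obtain Bq where Bq: "Bq \<ge> 0" "\<And>f. f \<in> X \<Longrightarrow> nrm (r q * f) \<le> Bq * nrm f"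
    using ip_norm_restr_class_mult_bound[OF cont_q] by blast
  obtain Br where Br: "Br \<ge> 0" "\<And>f. f \<in> X \<Longrightarrow> nrm (r \<rho> * f) \<le> Br * nrm f"
    using ip_norm_restr_class_mult_bound[OF cont_rho] by blast
  obtain m M where m: "m > 0" and "M > 0"
    and le_m: "\<And>f. f \<in> X \<Longrightarrow> nrm f \<le> m * ip_norm ipX f"
    and "\<And>f. f \<in> X \<Longrightarrow> ip_norm ipX f \<le> M * nrm f"
    using ip_weighted_bounds[OF cont_rho rho_pos] by blast
  define B where "B = 1 + Bq + Br"
  show ?thesis
  proof (rule that[of "C * (B * m)"])
    show "C * (B * m) \<ge> 0" using C Bq Br m by (simp add: B_def)
    fix f x assume f: "f \<in> DA" and x: "x \<in> {a..b}"
    have X: "f \<in> X" "A f \<in> X" by (intro DA_X A_in f)+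
    have eq: "rhs f (- A f) = r q * f + r \<rho> * A f" by (simp add: rhs_def)
    have "nrm (r q * f + r \<rho> * A f) \<le> nrm (r q * f) + nrm (r \<rho> * A f)"
      by (intro N.ip_norm_triangle restr_class_mult_L2 cont_q cont_rho X)
    then have h: "nrm (rhs f (- A f)) \<le> Bq * nrm f + Br * nrm (A f)"
      unfolding eq using Bq(2)[OF X(1)] Br(2)[OF X(2)] by linarith
    have "nrm f + nrm (rhs f (- A f)) \<le> (1 + Bq) * nrm f + Br * nrm (A f)"
      using h by (simp add: distrib_right)
    also have "\<dots> \<le> B * nrm f + B * nrm (A f)"
      using Bq(1) Br(1)
      by (intro add_mono mult_right_mono N.ip_norm_nonneg X) (auto simp: B_def)
    also have "\<dots> \<le> B * (m * ip_norm ipX f) + B * (m * ip_norm ipX (A f))"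
      using Bq(1) Br(1) by (intro add_mono mult_left_mono le_m X) (auto simp: B_def)
    also have "\<dots> = (B * m) * (ip_norm ipX f + ip_norm ipX (A f))"
      by (simp add: algebra_simps)
    finally have "C * (nrm f + nrm (rhs f (- A f))) \<le> C * ((B * m) * (ip_norm ipX f + ip_norm ipX (A f)))"
      using C(1) by (rule mult_left_mono)
    moreover have "\<bar>U f (rhs f (- A f)) x\<bar> \<le> C * (nrm f + nrm (rhs f (- A f)))"
      using C(2)[OF X(1) rhs_in[OF X(1) N.V_closed(4)[OF X(2)]] x] by blast
    ultimately show "\<bar>point_value a b f x\<bar> \<le> C * (B * m) * (ip_norm ipX f + ip_norm ipX (A f))"
      unfolding point_value_A[OF f x] by (simp only: mult.assoc)
  qed
qed

text \<open>Eigenvalues do not accumulate. If \<open>f\<close> is the combination of the \<open>\<phi> n\<close>, \<open>n \<in> S\<close>, with the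
  coefficients \<open>\<phi> n x\<close>, then \<open>f x\<close> and the square of the norm of \<open>f\<close> both equal the sum of the
  \<open>(\<phi> n x)\<^sup>2\<close>. The bound on point values hence bounds this sum uniformly in \<open>x\<close>, and its
  integral against \<open>\<rho>\<close> is the cardinality of \<open>S\<close>.\<close>

lemma finite_bounded_eigenvalues:
  assumes onb: "orthonormal_basis X ipX \<phi>" and eigen: "\<And>n. eigenvector DA A (l n) (\<phi> n)"
  shows "finite {n. \<bar>l n\<bar> \<le> R}"
proof -
  interpret O: onb_space X ipX \<phi>
    by (rule onb_space.intro[OF hilbert_space_L2[OF less_imp_le[OF ab] cont_rho rho_pos] onb])
  obtain C where C: "C \<ge> 0" "\<And>f x. f \<in> DA \<Longrightarrow> x \<in> {a..b} \<Longrightarrow>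
    \<bar>point_value a b f x\<bar> \<le> C * (ip_norm ipX f + ip_norm ipX (A f))"
    using point_value_bound by blast
  have \<phi>: "\<phi> n \<in> DA" "A (\<phi> n) = l n *\<^sub>R \<phi> n" for n
    using eigen by (auto simp: eigenvector_def)
  let ?u = "\<lambda>n. point_value a b (\<phi> n)"
  \<comment> \<open>On combinations of eigenvectors with |l n| \<le> R the operator has norm at most
    |R|, so the graph norm is at most 1 + |R| times the norm.\<close>
  define B where "B = C * (1 + \<bar>R\<bar>)"
  have B: "B \<ge> 0" using C by (simp add: B_def)
  define I where "I = (\<integral>x. B\<^sup>2 * restr a b \<rho> x \<partial>lborel)"
  have card: "card S \<le> nat \<lceil>I\<rceil>" if S: "S \<subseteq> {n. \<bar>l n\<bar> \<le> R}" and fin: "finite S" for S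
  proof -
    \<comment> \<open>Membership, image and point value share one induction, because each additivity
      law needs summands already known to lie in \<open>DA\<close>.\<close>
    have comb: "(\<Sum>n\<in>S. c n *\<^sub>R \<phi> n) \<in> DA \<and> A (\<Sum>n\<in>S. c n *\<^sub>R \<phi> n) = (\<Sum>n\<in>S. (c n * l n) *\<^sub>R \<phi> n)
        \<and> (x \<in> {a..b} \<longrightarrow> point_value a b (\<Sum>n\<in>S. c n *\<^sub>R \<phi> n) x = (\<Sum>n\<in>S. c n * ?u n x))" for c x
      using fin
    proof (induction S)
      case empty
      then show ?case
        using DA_zero A_scale[OF DA_zero, of 0] point_value_linear(2)[OF DA_zero DA_zero, of x 0] by simp
    next
      case (insert n S)
      have s: "c n *\<^sub>R \<phi> n \<in> DA" "A (c n *\<^sub>R \<phi> n) = (c n * l n) *\<^sub>R \<phi> n"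
        using A_scale[OF \<phi>(1)[of n], of "c n"] unfolding \<phi>(2) scaleR_scaleR by blast+
      have t: "(\<Sum>n\<in>S. c n *\<^sub>R \<phi> n) \<in> DA" "A (\<Sum>n\<in>S. c n *\<^sub>R \<phi> n) = (\<Sum>n\<in>S. (c n * l n) *\<^sub>R \<phi> n)"
        using insert.IH by blast+
      show ?case
        unfolding sum.insert[OF insert.hyps]
        using A_add[OF s(1) t(1)] point_value_linear(1)[OF s(1) t(1), of x] insert.IH
          point_value_linear(2)[OF \<phi>(1) \<phi>(1), of x "c n" n] s(2) t(2) by simp
    qed
    have bound: "(\<Sum>n\<in>S. (?u n x)\<^sup>2) \<le> B\<^sup>2" if x: "x \<in> {a..b}" for x
    proof -
      define s where "s = (\<Sum>n\<in>S. (?u n x)\<^sup>2)"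
      let ?f = "\<Sum>n\<in>S. ?u n x *\<^sub>R \<phi> n"
      have s0: "s \<ge> 0" by (simp add: s_def sum_nonneg)
      have nf: "ip_norm ipX ?f = sqrt s" using fin by (simp add: ip_norm_def O.ip_lincomb_self s_def)
      have "(\<Sum>n\<in>S. (?u n x * l n)\<^sup>2) \<le> (\<Sum>n\<in>S. R\<^sup>2 * (?u n x)\<^sup>2)"
      proof (rule sum_mono)
        fix n assume "n \<in> S"
        then have "\<bar>l n\<bar>\<^sup>2 \<le> R\<^sup>2" using S by (intro power_mono) auto
        then show "(?u n x * l n)\<^sup>2 \<le> R\<^sup>2 * (?u n x)\<^sup>2"
          using mult_right_mono[of "(l n)\<^sup>2" "R\<^sup>2" "(?u n x)\<^sup>2"]
          by (simp add: power_mult_distrib mult.commute)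
      qed
      also have "\<dots> = R\<^sup>2 * s" by (simp add: s_def sum_distrib_left)
      finally have "ip_norm ipX (A ?f) \<le> sqrt (R\<^sup>2 * s)"
        unfolding conjunct1[OF conjunct2[OF comb]] ip_norm_def O.ip_lincomb_self[OF fin]
        by (rule real_sqrt_le_mono)
      then have "ip_norm ipX (A ?f) \<le> \<bar>R\<bar> * sqrt s" by (simp add: real_sqrt_mult)
      then have "C * (ip_norm ipX ?f + ip_norm ipX (A ?f)) \<le> C * ((1 + \<bar>R\<bar>) * sqrt s)"
        unfolding nf using C(1) by (intro mult_left_mono) (auto simp: distrib_right)
      moreover have "point_value a b ?f x = s"
        using comb[of "\<lambda>n. ?u n x" x] x by (simp add: s_def power2_eq_square)
      ultimately have "s \<le> B * sqrt s"
        using C(2)[OF conjunct1[OF comb] x, of "\<lambda>n. ?u n x"] s0 by (simp add: B_def mult.assoc)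
      then have "sqrt s * sqrt s \<le> B * sqrt s" using s0 by simp
      \<comment> \<open>The sum occurs squared against the norm, so cancelling \<open>sqrt s\<close>
        leaves a bound free of \<open>x\<close> and \<open>S\<close>. If \<open>s\<close> is 0,
        nonnegativity of \<open>B\<close> suffices.\<close>
      then have "sqrt s \<le> B"
        using B s0 mult_right_le_imp_le[of "sqrt s" "sqrt s" B] by (cases "s = 0") auto
      then have "(sqrt s)\<^sup>2 \<le> B\<^sup>2" using s0 by (intro power_mono) auto
      then show ?thesis using s0 by (simp add: s_def)
    qed
    have su: "sqint a b (restr a b (?u n))" for n
      by (intro sqint_restr continuous_on_point_value(1) \<phi>(1))
    have int: "integrable lborel (\<lambda>x. restr a b (?u n) x * restr a b (?u n) x * restr a b \<rho> x)" for n
      by (rule sqint_integrable_weighted[OF su su cont_rho])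
    have one: "(\<integral>x. restr a b (?u n) x * restr a b (?u n) x * restr a b \<rho> x \<partial>lborel) = 1" for n
    proof -
      have "ipX (r (?u n)) (r (?u n)) = 1"
        using O.ip_basis[of n n] continuous_on_point_value(2)[OF \<phi>(1)[of n]] by simp
      then show ?thesis unfolding restr_class_eq ip_weighted_abs[OF su su cont_rho] .
    qed
    have "real (card S) = (\<Sum>n\<in>S. \<integral>x. restr a b (?u n) x * restr a b (?u n) x * restr a b \<rho> x \<partial>lborel)"
      by (simp add: one)
    also have "\<dots> = (\<integral>x. (\<Sum>n\<in>S. restr a b (?u n) x * restr a b (?u n) x * restr a b \<rho> x) \<partial>lborel)"
      by (rule Bochner_Integration.integral_sum[symmetric]) (rule int)
    also have "\<dots> \<le> I"
      unfolding I_def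
    proof (rule integral_mono)
      show "integrable lborel (\<lambda>x. \<Sum>n\<in>S. restr a b (?u n) x * restr a b (?u n) x * restr a b \<rho> x)"
        by (intro Bochner_Integration.integrable_sum int)
      show "integrable lborel (\<lambda>x. B\<^sup>2 * restr a b \<rho> x)"
        by (intro Bochner_Integration.integrable_mult_right restr_integrable cont_rho)
      fix x
      show "(\<Sum>n\<in>S. restr a b (?u n) x * restr a b (?u n) x * restr a b \<rho> x) \<le> B\<^sup>2 * restr a b \<rho> x"
      proof (cases "x \<in> {a..b}")
        case True
        then show ?thesis
          using mult_right_mono[OF bound[OF True] less_imp_le[OF rho_pos[OF True]]]
          by (simp add: restr_simps sum_distrib_right power2_eq_square)
      qed (simp add: restr_simps)
    qed
    finally show ?thesis by linarith
  qed
  show ?thesis using finite_if_finite_subsets_card_bdd[of "{n. \<bar>l n\<bar> \<le> R}" "nat \<lceil>I\<rceil>"] card by blast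
qed

end

end

text \<open>A bounded window meets the range in a finite set, so the closure adds no points and is
  countable. A connected set of reals with two points is uncountable.\<close>

lemma totally_disconnected_closure_range:
  fixes l :: "nat \<Rightarrow> real"
  assumes fin: "\<And>R. finite {n. \<bar>l n\<bar> \<le> R}"
  shows "totally_disconnected (closure (range l))"
proof -
  have "closure (range l) \<subseteq> range l"
  proof
    fix x assume x: "x \<in> closure (range l)"
    \<comment> \<open>The open window of radius \<open>R\<close> about 0 contains \<open>x\<close>,
      so \<open>x\<close> is already in the closure of the finite part inside it.\<close>
    define R where "R = \<bar>x\<bar> + 1"
    let ?S = "range l \<inter> {-R<..<R}"
    have "?S \<subseteq> l ` {n. \<bar>l n\<bar> \<le> R}" by auto
    then have "finite ?S" using fin finite_surj by blast
    moreover have "x \<in> {-R<..<R}" by (auto simp: R_def)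
    then have "x \<in> closure ?S"
      using x open_Int_closure_subset[of "{-R<..<R}" "range l"] by (auto simp: Int_commute)
    ultimately show "x \<in> range l" by (simp add: finite_imp_closed)
  qed
  then have "countable (closure (range l))" by (rule countable_subset) simp
  then have "\<exists>x. C \<subseteq> {x}" if "C \<subseteq> closure (range l)" "connected C" for C
    using countable_subset[OF that(1)] connected_card_eq_iff_nontrivial[OF that(2)] by simp
  then show ?thesis
    by (simp add: totally_disconnected_def)
qed


theorem mainTheorem1:
  fixes a b :: real
    and p dp q \<rho> :: "real \<Rightarrow> real"
    and \<alpha>a \<beta>a \<alpha>b \<beta>b :: real
    and lam :: "nat \<Rightarrow> real" and \<phi> :: "nat \<Rightarrow> L0"
    and \<mu> \<gamma> \<epsilon> \<alpha> :: real
  defines "X \<equiv> L2 a b"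
    and "ipX \<equiv> ip_weighted a b \<rho>"
    and "A \<equiv> (\<lambda>f. - SL_op a b p q \<rho> f)"
    and "DA \<equiv> SL_dom a b \<alpha>a \<beta>a \<alpha>b \<beta>b"
  defines "X\<alpha> \<equiv> frac_power_dom X ipX lam \<phi> \<mu> \<alpha>"
    and "ip\<alpha> \<equiv> ip_frac X ipX lam \<phi> \<mu> \<alpha>"
    and "\<phi>\<alpha> \<equiv> (\<lambda>n. ((\<mu> - lam n) powr (- \<alpha>)) *\<^sub>R \<phi> n)"
  defines "DA\<alpha> \<equiv> {f \<in> X\<alpha>. summable (\<lambda>n. (lam n)\<^sup>2 * (ip\<alpha> f (\<phi>\<alpha> n))\<^sup>2)}"
  assumes "a < b"
    and "continuous_on {a..b} p" and "continuous_on {a..b} dp"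
    and "continuous_on {a..b} q" and "continuous_on {a..b} \<rho>"
    and "\<forall>z\<in>{a..b}. (p has_real_derivative dp z) (at z within {a..b})"
    and "\<forall>z\<in>{a..b}. p z > 0" and "\<forall>z\<in>{a..b}. \<rho> z > 0"
    and "(\<alpha>a, \<beta>a) \<noteq> (0, 0)" and "(\<alpha>b, \<beta>b) \<noteq> (0, 0)"
    and "bij_betw lam UNIV (eigenvalues DA A)"
    and "\<forall>n. eigenvector DA A (lam n) (\<phi> n)"
    and "orthonormal_basis X ipX \<phi>"
    and "\<epsilon> > 0" and "\<forall>n. lam n < \<gamma>" and "\<mu> = \<gamma> + \<epsilon>" and "\<alpha> > 0"
  shows "DA\<alpha> \<subseteq> DA \<and>
    self_adjoint_on X\<alpha> ip\<alpha> DA\<alpha> A \<and>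
    riesz_spectral_on X\<alpha> ip\<alpha> DA\<alpha> A \<and>
    bij_betw lam UNIV (eigenvalues DA\<alpha> A) \<and>
    (\<forall>n. simple_eigenvalue DA\<alpha> A (lam n)) \<and>
    (\<forall>n. eigenvector DA\<alpha> A (lam n) (\<phi>\<alpha> n)) \<and>
    orthonormal_basis X\<alpha> ip\<alpha> \<phi>\<alpha>"
proof -
  interpret SL: sturm_liouville a b p dp q \<rho>
    by unfold_locales (use assms in auto)
  have "onb_space X ipX \<phi>"
    unfolding X_def ipX_def
  proof (rule onb_space.intro)
    show "hilbert_space_on (L2 a b) (ip_weighted a b \<rho>)"
      by (rule hilbert_space_L2) (use assms in auto)
    show "orthonormal_basis (L2 a b) (ip_weighted a b \<rho>) \<phi>"
      using assms by (simp only: X_def ipX_def)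
  qed
  \<comment> \<open>The gap is \<open>\<epsilon>\<close>, since \<mu> - lam n is \<epsilon> plus the
    positive number \<gamma> - lam n.\<close>
  moreover have "frac_power_space_axioms lam \<mu> \<alpha> \<epsilon>"
  proof
    show "\<epsilon> \<le> \<mu> - lam n" for n
      using \<open>\<forall>n. lam n < \<gamma>\<close> \<open>\<mu> = \<gamma> + \<epsilon>\<close> by (smt (verit))
  qed (use assms in auto)
  ultimately interpret FP: frac_power_space X ipX \<phi> lam \<mu> \<alpha> \<epsilon>
    by (rule frac_power_space.intro)
  have inj: "inj lam"
    using \<open>bij_betw lam UNIV (eigenvalues DA A)\<close> by (simp add: bij_betw_def)
  have closed: "closed_operator_on X ipX DA A"
    unfolding X_def ipX_def A_def DA_def by (rule SL.closed_A)
  have eigen: "eigenvector DA A (lam n) (\<phi> n)" for n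
    using \<open>\<forall>n. eigenvector DA A (lam n) (\<phi> n)\<close> by blast
  have "finite {n. \<bar>lam n\<bar> \<le> R}" for R
    using SL.finite_bounded_eigenvalues[of \<phi> \<alpha>a \<beta>a \<alpha>b \<beta>b lam R] FP.onb eigen
    by (simp add: X_def ipX_def A_def DA_def)
  then have disc: "totally_disconnected (closure (range lam))"
    by (rule totally_disconnected_closure_range)
  have sub: "DA\<alpha> \<subseteq> DA" and "diagonal_operator X\<alpha> ip\<alpha> \<phi>\<alpha> DA\<alpha> A lam"
    using FP.closed_operator_restrict[OF closed eigen inj]
    unfolding X\<alpha>_def ip\<alpha>_def \<phi>\<alpha>_def DA\<alpha>_def by blast+
  then interpret D: diagonal_operator X\<alpha> ip\<alpha> \<phi>\<alpha> DA\<alpha> A lam by blast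
  show ?thesis
    using sub inj D.self_adjoint D.riesz_spectral[OF disc] D.simple_eigenvalue D.eigenvector_basis D.onb
    by (simp add: bij_betw_def D.eigenvalues_eq)
qed

end
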